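(* Let $a$ and $d$ be positive integers. Then: (i) There exist infinitely many mutually non-isomorphic Drury-Arveson-type Hilbert modules $\mathscr H_{\mathfrak c_a}(\mathscr T)$ (with $\mathscr T$ a directed Cartesian product of $d$ locally finite rooted directed trees, of finite joint branching index). (ii) Given any positive integer $k$, there exist $k$ mutually non-isomorphic (as directed graphs) directed Cartesian products $\mathscr T=(V,\mathcal E)$ of locally finite rooted directed trees $\mathscr T_1,\ldots,\mathscr T_d$, of finite joint branching index, such that the associated Drury-Arveson-type Hilbert modules $\mathscr H_{\mathfrak c_a}(\mathscr T)$ are (all mutually) isomorphic.
   Context: Conventions: $\mathbb N=\{0,1,2,\ldots\}$; for $\alpha\in\mathbb N^d$, $\alpha!=\prod_j\alpha_j!$ and $|\alpha|=\sum_j\alpha_j$; empty sums are $0$, empty products are $1$. $\mathscr P$ is the set of all subsets of $\{1,\ldots,d\}$. $\mathbb B^d$ is the open unit ball of $\mathbb C^d$. Trees: a rooted directed tree is a connected directed graph without circuits in which every vertex has at most one parent and exactly one vertex (the root) has no parent. $\mathsf{Chi}(u)$ is the set of children of $u$; for a non-root $u$, $\mathsf{par}(u)$ is its parent and $\mathsf{sib}(u)=\mathsf{Chi}(\mathsf{par}(u))$ (so $u\in\mathsf{sib}(u)$). All directed trees are assumed countably infinite and leafless ($\mathrm{card}(\mathsf{Chi}(u))\geq 1$ for all $u$). Locally finite: every $\mathsf{Chi}(u)$ is finite. The depth of $u$ is the length of the path from the root to $u$. Two directed graphs are isomorphic if there is a bijection between their vertex sets preserving directed edges (in both directions). Products: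 for rooted directed trees $\mathscr T_j=(V_j,\mathcal E_j)$ with roots $\mathsf{root}_j$, the directed Cartesian product $\mathscr T=(V,\mathcal E)$ has $V=V_1\times\cdots\times V_d$ and $(v,w)\in\mathcal E$ iff there is $k$ with $v_j=w_j$ for $j\neq k$ and $(v_k,w_k)\in\mathcal E_k$. Put $\mathsf{root}=(\mathsf{root}_1,\ldots,\mathsf{root}_d)$. The depth of $v\in V$ is $\mathsf d_v=(\mathsf d_{v_1},\ldots,\mathsf d_{v_d})$ with $\mathsf d_{v_j}$ the depth of $v_j$ in $\mathscr T_j$. $\mathsf{Chi}_j(v)$ (resp. $\mathsf{sib}_j(v)$, for $v_j\neq\mathsf{root}_j$) is the set of $w\in V$ with $w_i=v_i$ for $i\ne j$ and $w_j\in\mathsf{Chi}(v_j)$ (resp. $w_j\in\mathsf{sib}(v_j)$). $\mathscr T$ is of finite joint branching index if, for each $j$, the set of depths of the branching vertices of $\mathscr T_j$ (vertices with at least two children) is bounded (possibly empty). Weights: for $a>0$, let $\lambda_j(w)=\frac{1}{\sqrt{\mathrm{card}(\mathsf{Chi}_j(v))}}\sqrt{\frac{\mathsf d_{v_j}+1}{|\mathsf d_v|+a}}$ for $w\in\mathsf{Chi}_j(v)$, $v\in V$, $j=1,\ldots,d$. On $l^2(V)$ with orthonormal basis $\{e_v\}_{v\in V}$ of indicator functions, the Drury-Arveson-type multishift is the commuting $d$-tuple $(S_1,\ldots,S_d)$ with $S_je_v=\sum_{w\in\mathsf{Chi}_j(v)}\lambda_j(w)e_w$. Spaces $\mathcal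 L_{u,F}$: for $F\in\mathscr P$ let $\Phi_F=\{v\in V: v_j\neq\mathsf{root}_j\text{ if }j\in F,\ v_j=\mathsf{root}_j\text{ if }j\notin F\}$. For $u\in\Phi_F$, $\mathsf{sib}_F(u)$ is the set of $w\in V$ with $w_j\in\mathsf{sib}(u_j)$ for $j\in F$ and $w_j=u_j$ for $j\notin F$. These sets partition $\Phi_F$, and $\Omega_F$ is any set containing exactly one element of each class. For $G\in\mathscr P$, $v_G$ is $v$ with all coordinates $v_j$, $j\notin G$, replaced by $\mathsf{root}_j$; $\mathsf{sib}_{F,G}(u)=\{v_G: v\in\mathsf{sib}_F(u)\}$ for $G\subseteq F$; for $j\notin G$, $v_G|u_j$ is $v_G$ with $j$-th coordinate replaced by $u_j$. $\mathcal L_{u,F}\subseteq l^2(\mathsf{sib}_F(u))$ is the space of $f$ with $\sum_{w\in\mathsf{sib}_j(v_G|u_j)}f(w)\lambda_j(w)=0$ for all $j\in F$, $G=F\setminus\{j\}$, $v_G\in\mathsf{sib}_{F,G}(u)$ ($\mathcal L_{\mathsf{root},\emptyset}$ is the span of $e_{\mathsf{root}}$). The joint kernel $E=\bigcap_j\ker S_j^*$ equals $\bigoplus_{F\in\mathscr P}\bigoplus_{u\in\Omega_F}\mathcal L_{u,F}$ and is finite dimensional when $\mathscr T$ is of finite joint branching index. Hilbert modules: for $\mathscr T$ of finite joint branching index, the Drury-Arveson-type Hilbert module $\mathscr H_{\mathfrak c_a}(\mathscr T)$ is the reproducing kernel Hilbert space of $E$-valued holomorphic functions on $\mathbb B^d$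 with $B(E)$-valued kernel $$\kappa(z,w)=\sum_{F\in\mathscr P}\sum_{u\in\Omega_F}\Big(\sum_{\alpha\in\mathbb N^d}\frac{\mathsf d_u!}{(\mathsf d_u+\alpha)!}\prod_{i=0}^{|\alpha|-1}(|\mathsf d_u|+a+i)\,z^\alpha\overline w^\alpha\Big)P_{\mathcal L_{u,F}},$$ $P_{\mathcal L_{u,F}}$ being the orthogonal projection of $E$ onto $\mathcal L_{u,F}$. It is a module over $\mathbb C[z_1,\ldots,z_d]$ through $p\cdot h=p(\mathscr M_z)h$, with $\mathscr M_z$ the $d$-tuple of (bounded) multiplications by coordinate functions. Two such modules are isomorphic if there is a unitary between them intertwining the multiplication operators $\mathscr M_{z_k}$ for all $k=1,\ldots,d$. *)

theory Defs
  imports "HOL-Analysis.Analysis" "HOL-Library.Function_Algebras"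
begin

section \<open>Directed graphs and rooted directed trees\<close>

record 'a dgraph =
  verts :: "'a set"
  edges :: "('a \<times> 'a) set"

definition dgraph_iso :: "'a dgraph \<Rightarrow> 'b dgraph \<Rightarrow> bool" where
  "dgraph_iso G H \<longleftrightarrow> (\<exists>\<phi>. bij_betw \<phi> (verts G) (verts H) \<and>
     (\<forall>u\<in>verts G. \<forall>v\<in>verts G. (u, v) \<in> edges G \<longleftrightarrow> (\<phi> u, \<phi> v) \<in> edges H))"

definition Chi :: "'a dgraph \<Rightarrow> 'a \<Rightarrow> 'a set" where
  "Chi G u = {w. (u, w) \<in> edges G}"

definition dgraph_connected :: "'a dgraph \<Rightarrow> bool" where
  "dgraph_connected G \<longleftrightarrow>
     (\<forall>u\<in>verts G. \<forall>v\<in>verts G. (u, v) \<in> (edges G \<union> (edges G)\<inverse>)\<^sup>*)"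

text \<open>Includes the standing assumptions: countably infinite and leafless.\<close>

definition rooted_directed_tree :: "'a dgraph \<Rightarrow> bool" where
  "rooted_directed_tree G \<longleftrightarrow>
     edges G \<subseteq> verts G \<times> verts G \<and>
     dgraph_connected G \<and>
     acyclic (edges G) \<and>
     (\<forall>u p q. (p, u) \<in> edges G \<and> (q, u) \<in> edges G \<longrightarrow> p = q) \<and>
     (\<exists>!r. r \<in> verts G \<and> (\<forall>p. (p, r) \<notin> edges G)) \<and>
     countable (verts G) \<and> infinite (verts G) \<and>
     (\<forall>u\<in>verts G. Chi G u \<noteq> {})"

definition locally_finite :: "'a dgraph \<Rightarrow> bool" where
  "locally_finite G \<longleftrightarrow> (\<forall>u\<in>verts G. finite (Chi G u))"

definition tree_root :: "'a dgraph \<Rightarrow> 'a" where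
  "tree_root G = (THE r. r \<in> verts G \<and> (\<forall>p. (p, r) \<notin> edges G))"

definition par :: "'a dgraph \<Rightarrow> 'a \<Rightarrow> 'a" where
  "par G u = (THE p. (p, u) \<in> edges G)"

definition sib :: "'a dgraph \<Rightarrow> 'a \<Rightarrow> 'a set" where
  "sib G u = Chi G (par G u)"

definition depth :: "'a dgraph \<Rightarrow> 'a \<Rightarrow> nat" where
  "depth G u = (THE n. (tree_root G, u) \<in> edges G ^^ n)"

definition branching_vertices :: "'a dgraph \<Rightarrow> 'a set" where
  "branching_vertices G = {u \<in> verts G. 2 \<le> card (Chi G u)}"


section \<open>Directed Cartesian products\<close>

text \<open>
  A \<open>d\<close>-tuple of trees is a family \<open>T :: 'n \<Rightarrow> 'a dgraph\<close> over a finite index type with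
  \<open>d = CARD('n)\<close>; vertices of the product and multi-indices are functions on \<open>'n\<close>.
\<close>

definition dcart_prod :: "('n::finite \<Rightarrow> 'a dgraph) \<Rightarrow> ('n \<Rightarrow> 'a) dgraph" where
  "dcart_prod T = (let V = {v. \<forall>j. v j \<in> verts (T j)} in
     \<lparr>verts = V,
      edges = {(v, w). v \<in> V \<and> w \<in> V \<and>
        (\<exists>k. (\<forall>j. j \<noteq> k \<longrightarrow> v j = w j) \<and> (v k, w k) \<in> edges (T k))}\<rparr>)"

definition finite_joint_branching_index :: "('n::finite \<Rightarrow> 'a dgraph) \<Rightarrow> bool" where
  "finite_joint_branching_index T \<longleftrightarrow>
     (\<forall>j. bdd_above (depth (T j) ` branching_vertices (T j)))"

definition admissible :: "('n::finite \<Rightarrow> 'a dgraph) \<Rightarrow> bool" where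
  "admissible T \<longleftrightarrow>
     (\<forall>j. rooted_directed_tree (T j) \<and> locally_finite (T j)) \<and>
     finite_joint_branching_index T"

definition mdepth :: "('n::finite \<Rightarrow> 'a dgraph) \<Rightarrow> ('n \<Rightarrow> 'a) \<Rightarrow> ('n \<Rightarrow> nat)" where
  "mdepth T v = (\<lambda>j. depth (T j) (v j))"

definition Chi_at :: "('n::finite \<Rightarrow> 'a dgraph) \<Rightarrow> 'n \<Rightarrow> ('n \<Rightarrow> 'a) \<Rightarrow> ('n \<Rightarrow> 'a) set" where
  "Chi_at T j v =
     {w \<in> verts (dcart_prod T). (\<forall>i. i \<noteq> j \<longrightarrow> w i = v i) \<and> w j \<in> Chi (T j) (v j)}"

definition sib_at :: "('n::finite \<Rightarrow> 'a dgraph) \<Rightarrow> 'n \<Rightarrow> ('n \<Rightarrow> 'a) \<Rightarrow> ('n \<Rightarrow> 'a) set" where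
  "sib_at T j v =
     {w \<in> verts (dcart_prod T). (\<forall>i. i \<noteq> j \<longrightarrow> w i = v i) \<and> w j \<in> sib (T j) (v j)}"

definition Phi :: "('n::finite \<Rightarrow> 'a dgraph) \<Rightarrow> 'n set \<Rightarrow> ('n \<Rightarrow> 'a) set" where
  "Phi T F = {v \<in> verts (dcart_prod T). \<forall>j. j \<in> F \<longleftrightarrow> v j \<noteq> tree_root (T j)}"

definition sibF :: "('n::finite \<Rightarrow> 'a dgraph) \<Rightarrow> 'n set \<Rightarrow> ('n \<Rightarrow> 'a) \<Rightarrow> ('n \<Rightarrow> 'a) set" where
  "sibF T F u = {w \<in> verts (dcart_prod T).
     \<forall>j. if j \<in> F then w j \<in> sib (T j) (u j) else w j = u j}"

text \<open>
  An arbitrary choice of one element from each class \<open>sibF T F u\<close>. The choice is immaterial: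
  the depth of \<open>u\<close> and the space \<open>Lspace a T F u\<close> below only depend on the class of \<open>u\<close>.
\<close>

definition Omega :: "('n::finite \<Rightarrow> 'a dgraph) \<Rightarrow> 'n set \<Rightarrow> ('n \<Rightarrow> 'a) set" where
  "Omega T F = (\<lambda>C. SOME u. u \<in> C) ` (sibF T F ` Phi T F)"

text \<open>The vertex \<open>v\<^sub>G\<close>.\<close>

definition root_off :: "('n::finite \<Rightarrow> 'a dgraph) \<Rightarrow> 'n set \<Rightarrow> ('n \<Rightarrow> 'a) \<Rightarrow> ('n \<Rightarrow> 'a)" where
  "root_off T G v = (\<lambda>i. if i \<in> G then v i else tree_root (T i))"


section \<open>Multi-indices\<close>

definition msize :: "('n::finite \<Rightarrow> nat) \<Rightarrow> nat" where
  "msize \<alpha> = (\<Sum>j\<in>UNIV. \<alpha> j)"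

definition mfact :: "('n::finite \<Rightarrow> nat) \<Rightarrow> nat" where
  "mfact \<alpha> = (\<Prod>j\<in>UNIV. fact (\<alpha> j))"

definition mpow :: "complex ^ 'n::finite \<Rightarrow> ('n \<Rightarrow> nat) \<Rightarrow> complex" where
  "mpow z \<alpha> = (\<Prod>j\<in>UNIV. (z $ j) ^ \<alpha> j)"


section \<open>The multishift, its joint kernel and the spaces \<open>\<L>\<^sub>u\<^sub>,\<^sub>F\<close>\<close>

text \<open>Elements of \<open>l\<^sup>2(V)\<close> are extended by \<open>0\<close> outside \<open>V\<close>.\<close>

definition l2 :: "'v set \<Rightarrow> ('v \<Rightarrow> complex) set" where
  "l2 V = {f. (\<forall>v. v \<notin> V \<longrightarrow> f v = 0) \<and> (\<lambda>v. (cmod (f v))\<^sup>2) summable_on V}"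

definition l2_inner :: "'v set \<Rightarrow> ('v \<Rightarrow> complex) \<Rightarrow> ('v \<Rightarrow> complex) \<Rightarrow> complex" where
  "l2_inner V f g = (\<Sum>\<^sub>\<infinity>v\<in>V. f v * cnj (g v))"

definition lam :: "real \<Rightarrow> ('n::finite \<Rightarrow> 'a dgraph) \<Rightarrow> 'n \<Rightarrow> ('n \<Rightarrow> 'a) \<Rightarrow> real" where
  "lam a T j w = (let v = w(j := par (T j) (w j)) in
     1 / sqrt (card (Chi_at T j v)) *
     sqrt ((real (mdepth T v j) + 1) / (real (msize (mdepth T v)) + a)))"

text \<open>
  The bounded linear operator with \<open>S\<^sub>j e\<^sub>v = (\<Sum>w\<in>Chi\<^sub>j(v). \<lambda>\<^sub>j(w) e\<^sub>w)\<close>: the value of \<open>S\<^sub>j f\<close>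
  at \<open>w\<close> comes from the unique \<open>v\<close> with \<open>w \<in> Chi\<^sub>j(v)\<close>, if there is one.
\<close>

definition shift_op ::
  "real \<Rightarrow> ('n::finite \<Rightarrow> 'a dgraph) \<Rightarrow> 'n \<Rightarrow> (('n \<Rightarrow> 'a) \<Rightarrow> complex) \<Rightarrow> (('n \<Rightarrow> 'a) \<Rightarrow> complex)" where
  "shift_op a T j f = (\<lambda>w.
     if w \<in> verts (dcart_prod T) \<and> w j \<noteq> tree_root (T j)
     then complex_of_real (lam a T j w) * f (w(j := par (T j) (w j))) else 0)"

text \<open>\<open>S\<^sub>j\<^sup>* f = 0\<close> means \<open>\<langle>S\<^sub>j h, f\<rangle> = \<langle>h, S\<^sub>j\<^sup>* f\<rangle> = 0\<close> for all \<open>h\<close> in \<open>l\<^sup>2(V)\<close>.\<close>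

definition joint_kernel ::
  "real \<Rightarrow> ('n::finite \<Rightarrow> 'a dgraph) \<Rightarrow> (('n \<Rightarrow> 'a) \<Rightarrow> complex) set" where
  "joint_kernel a T = (let V = verts (dcart_prod T) in
     {f \<in> l2 V. \<forall>j. \<forall>h\<in>l2 V. l2_inner V (shift_op a T j h) f = 0})"

definition Lspace ::
  "real \<Rightarrow> ('n::finite \<Rightarrow> 'a dgraph) \<Rightarrow> 'n set \<Rightarrow> ('n \<Rightarrow> 'a) \<Rightarrow> (('n \<Rightarrow> 'a) \<Rightarrow> complex) set" where
  "Lspace a T F u = {f \<in> l2 (sibF T F u).
     \<forall>j\<in>F. \<forall>vG \<in> root_off T (F - {j}) ` sibF T F u.
       (\<Sum>w\<in>sib_at T j (vG(j := u j)). f w * complex_of_real (lam a T j w)) = 0}"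

definition orth_proj :: "'v set \<Rightarrow> ('v \<Rightarrow> complex) set \<Rightarrow> ('v \<Rightarrow> complex) \<Rightarrow> ('v \<Rightarrow> complex)" where
  "orth_proj V L x = (THE y. y \<in> L \<and> (\<forall>g\<in>L. l2_inner V (x - y) g = 0))"


section \<open>The reproducing kernel\<close>

definition kcoeff ::
  "real \<Rightarrow> ('n::finite \<Rightarrow> nat) \<Rightarrow> complex ^ 'n \<Rightarrow> complex ^ 'n \<Rightarrow> complex" where
  "kcoeff a \<beta> z w = (\<Sum>\<^sub>\<infinity>\<alpha>\<in>UNIV.
     complex_of_real (real (mfact \<beta>) / real (mfact (\<lambda>j. \<beta> j + \<alpha> j)) *
       (\<Prod>i<msize \<alpha>. real (msize \<beta>) + a + real i)) *
     mpow z \<alpha> * cnj (mpow w \<alpha>))"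

text \<open>
  The operator \<open>\<kappa>(z,w)\<close> applied to \<open>x \<in> E\<close>. The set \<open>Omega T F\<close> may be infinite, but only
  finitely many \<open>Lspace a T F u\<close> are nonzero if \<open>T\<close> is admissible; \<open>infsum\<close> (unlike \<open>sum\<close>)
  then yields the finite sum of the nonzero terms.
\<close>

definition kernel ::
  "real \<Rightarrow> ('n::finite \<Rightarrow> 'a dgraph) \<Rightarrow> complex ^ 'n \<Rightarrow> complex ^ 'n \<Rightarrow>
   (('n \<Rightarrow> 'a) \<Rightarrow> complex) \<Rightarrow> (('n \<Rightarrow> 'a) \<Rightarrow> complex)" where
  "kernel a T z w x = (\<lambda>v. \<Sum>F\<in>UNIV. \<Sum>\<^sub>\<infinity>u\<in>Omega T F.
     kcoeff a (mdepth T u) z w * orth_proj (verts (dcart_prod T)) (Lspace a T F u) x v)"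


section \<open>Hilbert modules\<close>

text \<open>
  Vector-valued functions have type \<open>'z \<Rightarrow> 'v \<Rightarrow> complex\<close>; addition and zero on them are
  pointwise, as in \<open>HOL-Library.Function_Algebras\<close>.
\<close>

record ('z, 'v) hspace =
  hcarrier :: "('z \<Rightarrow> 'v \<Rightarrow> complex) set"
  hinner :: "('z \<Rightarrow> 'v \<Rightarrow> complex) \<Rightarrow> ('z \<Rightarrow> 'v \<Rightarrow> complex) \<Rightarrow> complex"

definition cscale :: "complex \<Rightarrow> ('z \<Rightarrow> 'v \<Rightarrow> complex) \<Rightarrow> ('z \<Rightarrow> 'v \<Rightarrow> complex)" where
  "cscale c f = (\<lambda>z v. c * f z v)"

definition hnorm :: "('z, 'v) hspace \<Rightarrow> ('z \<Rightarrow> 'v \<Rightarrow> complex) \<Rightarrow> real" where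
  "hnorm H f = sqrt (Re (hinner H f f))"

definition complex_hilbert_space :: "('z, 'v) hspace \<Rightarrow> bool" where
  "complex_hilbert_space H \<longleftrightarrow>
     module.subspace cscale (hcarrier H) \<and>
     (\<forall>f\<in>hcarrier H. \<forall>g\<in>hcarrier H. \<forall>h\<in>hcarrier H.
        hinner H (f + g) h = hinner H f h + hinner H g h) \<and>
     (\<forall>c. \<forall>f\<in>hcarrier H. \<forall>g\<in>hcarrier H. hinner H (cscale c f) g = c * hinner H f g) \<and>
     (\<forall>f\<in>hcarrier H. \<forall>g\<in>hcarrier H. hinner H g f = cnj (hinner H f g)) \<and>
     (\<forall>f\<in>hcarrier H. f \<noteq> 0 \<longrightarrow> 0 < Re (hinner H f f)) \<and>
     (\<forall>X. (\<forall>n::nat. X n \<in> hcarrier H) \<and>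
          (\<forall>\<epsilon>>0. \<exists>N. \<forall>m\<ge>N. \<forall>n\<ge>N. hnorm H (X m - X n) < \<epsilon>) \<longrightarrow>
          (\<exists>f\<in>hcarrier H. (\<lambda>n. hnorm H (X n - f)) \<longlonglongrightarrow> 0))"

text \<open>
  \<open>H\<close> is the reproducing kernel Hilbert space of \<open>E\<close>-valued functions on \<open>X\<close> with kernel \<open>K\<close>,
  where \<open>ipE\<close> is the inner product of \<open>E\<close>. Functions are extended by \<open>0\<close> outside \<open>X\<close>. These
  conditions determine the carrier and the inner product on the carrier.
\<close>

definition is_rkhs ::
  "'z set \<Rightarrow> ('v \<Rightarrow> complex) set \<Rightarrow> (('v \<Rightarrow> complex) \<Rightarrow> ('v \<Rightarrow> complex) \<Rightarrow> complex) \<Rightarrow>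
   ('z \<Rightarrow> 'z \<Rightarrow> ('v \<Rightarrow> complex) \<Rightarrow> ('v \<Rightarrow> complex)) \<Rightarrow> ('z, 'v) hspace \<Rightarrow> bool" where
  "is_rkhs X E ipE K H \<longleftrightarrow>
     complex_hilbert_space H \<and>
     (\<forall>f\<in>hcarrier H. (\<forall>z\<in>X. f z \<in> E) \<and> (\<forall>z. z \<notin> X \<longrightarrow> f z = 0)) \<and>
     (\<forall>w\<in>X. \<forall>x\<in>E. let k = (\<lambda>z. if z \<in> X then K z w x else 0) in
        k \<in> hcarrier H \<and> (\<forall>f\<in>hcarrier H. hinner H f k = ipE (f w) x))"

definition holomorphic_on_ball :: "(complex ^ 'n::finite \<Rightarrow> complex) \<Rightarrow> bool" where
  "holomorphic_on_ball g \<longleftrightarrow>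
     (\<forall>z\<in>ball 0 1. \<exists>D. (g has_derivative D) (at z) \<and> (\<forall>c v. D (c *s v) = c * D v))"

definition mult_coord ::
  "'n::finite \<Rightarrow> (complex ^ 'n \<Rightarrow> 'v \<Rightarrow> complex) \<Rightarrow> (complex ^ 'n \<Rightarrow> 'v \<Rightarrow> complex)" where
  "mult_coord k f = (\<lambda>z v. z $ k * f z v)"

text \<open>
  Holomorphy of an \<open>E\<close>-valued function, for the finite-dimensional space \<open>E\<close>, is holomorphy of
  its coordinates \<open>\<langle>f(\<cdot>), x\<rangle>\<close>, \<open>x \<in> E\<close>.
\<close>

definition is_DA_module ::
  "real \<Rightarrow> ('n::finite \<Rightarrow> 'a dgraph) \<Rightarrow> (complex ^ 'n, 'n \<Rightarrow> 'a) hspace \<Rightarrow> bool" where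
  "is_DA_module a T H \<longleftrightarrow> (let V = verts (dcart_prod T); E = joint_kernel a T in
     is_rkhs (ball 0 1) E (l2_inner V) (kernel a T) H \<and>
     (\<forall>f\<in>hcarrier H. \<forall>x\<in>E. holomorphic_on_ball (\<lambda>z. l2_inner V (f z) x)) \<and>
     (\<forall>k. (\<forall>f\<in>hcarrier H. mult_coord k f \<in> hcarrier H) \<and>
          (\<exists>C. \<forall>f\<in>hcarrier H. hnorm H (mult_coord k f) \<le> C * hnorm H f)))"

definition hmodule_iso ::
  "(complex ^ 'n::finite, 'v) hspace \<Rightarrow> (complex ^ 'n, 'w) hspace \<Rightarrow> bool" where
  "hmodule_iso H K \<longleftrightarrow> (\<exists>U. bij_betw U (hcarrier H) (hcarrier K) \<and>
     (\<forall>f\<in>hcarrier H. \<forall>g\<in>hcarrier H. U (f + g) = U f + U g) \<and>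
     (\<forall>c. \<forall>f\<in>hcarrier H. U (cscale c f) = cscale c (U f)) \<and>
     (\<forall>f\<in>hcarrier H. \<forall>g\<in>hcarrier H. hinner K (U f) (U g) = hinner H f g) \<and>
     (\<forall>k. \<forall>f\<in>hcarrier H. U (mult_coord k f) = mult_coord k (U f)))"

end

theory Submission
  imports Defs "HOL-Complex_Analysis.Cauchy_Integral_Formula" "HOL-Real_Asymp.Real_Asymp"
begin

text \<open>
  If \<open>e\<close> is an orthonormal basis of the joint kernel adapted to the spaces \<open>\<L>\<^sub>u\<^sub>,\<^sub>F\<close>, with \<open>e b\<close>
  in a space of depth \<open>\<beta> b\<close>, then the Hilbert module consists of the functions
  \<open>\<Sum>b. f b \<cdot> e b\<close>, where \<open>f b\<close> is a power series whose coefficients, normalised by the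
  square roots of the coefficients of the scalar kernel of depth \<open>\<beta> b\<close>, are square-summable. Hence
  its isomorphism class depends only on the multiset of the depths \<open>\<beta> b\<close>, and the number of basis
  vectors is the dimension of the orthogonal complement of the ranges of the coordinate
  multiplications, an isomorphism invariant.

  Take all trees but one to be paths, and let the remaining one branch at its root, into two
  vertices, and at these, into \<open>p\<close> and \<open>q\<close> vertices. Then the depths occur with multiplicities
  \<open>1\<close>, \<open>1\<close> and \<open>p + q - 2\<close>. Varying \<open>p + q\<close> gives non-isomorphic modules, whereas
  different \<open>p \<le> q\<close> with the same sum give isomorphic modules over products with
  different maximal out-degrees.
\<close>

section \<open>Square-summable functions\<close>

text \<open>The inner product of the module is carried over from square-summable coefficient
  families, so the analytic core is that a function on the ball determines its coefficients.

  A set of r siblings contributes r - 1 basis vectors, all of the same depth. With branching at the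
  root alone the number of basis vectors would reveal the tree; two branching vertices of equal
  depth let p - 1 and q - 1 merge into one number, and only p + q remains visible. In a path every
  sibling set is a singleton, which kills each space L_{u,F} whose F contains a path direction; only
  F = {} and F = {j0} survive, with j0 the direction of the branching tree.

  Fourier modes serve as the basis because they diagonalise the condition "sum zero": mode 0 is
  constant and all other modes are orthogonal to it, so no orthogonalisation procedure is required.
  That \<open>a\<close> is an integer, hence at least 1, makes the coordinate multiplications
  contractive.\<close>

lemma l2_mult_abs_summable:
  assumes "f \<in> l2 V" "g \<in> l2 V"
  shows "(\<lambda>v. norm (f v * cnj (g v))) summable_on V"
proof (rule Infinite_Sum.abs_summable_on_comparison_test')
  show "(\<lambda>v. (cmod (f v))\<^sup>2 + (cmod (g v))\<^sup>2) summable_on V"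
    using assms by (auto simp: l2_def intro: summable_on_add)
  show "norm (f v * cnj (g v)) \<le> (cmod (f v))\<^sup>2 + (cmod (g v))\<^sup>2" for v
  proof -
    have "0 \<le> cmod (f v) * cmod (g v)" by simp
    with sum_squares_bound[of "cmod (f v)" "cmod (g v)"] show ?thesis
      by (simp only: norm_mult complex_mod_cnj)
  qed
qed

lemma l2_mult_summable:
  "f \<in> l2 V \<Longrightarrow> g \<in> l2 V \<Longrightarrow> (\<lambda>v. f v * cnj (g v)) summable_on V"
  by (rule abs_summable_summable) (rule l2_mult_abs_summable)

lemma l2_zero [simp]: "(0 :: 'v \<Rightarrow> complex) \<in> l2 V"
  by (simp add: l2_def)

lemma l2_add:
  assumes "f \<in> l2 V" "g \<in> l2 V" shows "f + g \<in> l2 V"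
proof -
  have "(\<lambda>v. (cmod ((f + g) v))\<^sup>2) summable_on V"
  proof (rule summable_on_comparison_test)
    show "(\<lambda>v. 2 * (cmod (f v))\<^sup>2 + 2 * (cmod (g v))\<^sup>2) summable_on V"
      using assms by (auto simp: l2_def intro!: summable_on_add summable_on_cmult_right)
    show "(cmod ((f + g) v))\<^sup>2 \<le> 2 * (cmod (f v))\<^sup>2 + 2 * (cmod (g v))\<^sup>2" for v
    proof -
      have "(cmod ((f + g) v))\<^sup>2 \<le> (cmod (f v) + cmod (g v))\<^sup>2"
        by (simp add: norm_triangle_ineq power_mono)
      also have "\<dots> \<le> 2 * (cmod (f v))\<^sup>2 + 2 * (cmod (g v))\<^sup>2"
        using sum_squares_bound[of "cmod (f v)" "cmod (g v)"] by (simp add: power2_sum)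
      finally show ?thesis .
    qed
  qed auto
  with assms show ?thesis by (simp add: l2_def)
qed

lemma l2_scale: "f \<in> l2 V \<Longrightarrow> (\<lambda>v. c * f v) \<in> l2 V"
  by (auto simp: l2_def norm_mult power_mult_distrib intro!: summable_on_cmult_right)

lemma l2_diff:
  assumes "f \<in> l2 V" "g \<in> l2 V" shows "f - g \<in> l2 V"
  using l2_add[OF assms(1) l2_scale[OF assms(2), of "-1"]] by (simp add: plus_fun_def fun_diff_def)

lemma l2_finite_support:
  assumes "finite S" "\<And>v. v \<notin> S \<Longrightarrow> f v = 0" "S \<subseteq> V"
  shows "f \<in> l2 V"
proof -
  have "finite {v\<in>V. (cmod (f v))\<^sup>2 \<noteq> 0}"
    by (rule finite_subset[OF _ assms(1)]) (use assms(2) in auto)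
  then have "(\<lambda>v. (cmod (f v))\<^sup>2) summable_on V"
    by (rule finite_nonzero_values_imp_summable_on)
  with assms show ?thesis by (auto simp: l2_def)
qed

lemma l2_inner_add_left:
  "f \<in> l2 V \<Longrightarrow> g \<in> l2 V \<Longrightarrow> h \<in> l2 V \<Longrightarrow> l2_inner V (f + g) h = l2_inner V f h + l2_inner V g h"
  by (simp add: l2_inner_def distrib_right infsum_add l2_mult_summable)

lemma l2_inner_scale_left: "l2_inner V (\<lambda>v. c * f v) g = c * l2_inner V f g"
  by (simp add: l2_inner_def mult.assoc infsum_cmult_right')

lemma l2_inner_diff_left:
  assumes "f \<in> l2 V" "g \<in> l2 V" "h \<in> l2 V"
  shows "l2_inner V (f - g) h = l2_inner V f h - l2_inner V g h"
  using l2_inner_add_left[OF assms(1) l2_scale[OF assms(2), of "-1"] assms(3)]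
    l2_inner_scale_left[of V "-1" g h]
  by (simp add: plus_fun_def fun_diff_def)

lemma l2_inner_cnj: "l2_inner V g f = cnj (l2_inner V f g)"
  unfolding l2_inner_def infsum_cnj[symmetric] by (simp add: mult.commute)

lemma l2_inner_self: "l2_inner V f f = complex_of_real (\<Sum>\<^sub>\<infinity>v\<in>V. (cmod (f v))\<^sup>2)"
proof (cases "(\<lambda>v. (cmod (f v))\<^sup>2) summable_on V")
  case True
  then show ?thesis
    unfolding l2_inner_def complex_norm_square[symmetric]
    by (intro infsumI has_sum_of_real has_sum_infsum)
next
  case False
  then have "\<not> (\<lambda>v. complex_of_real ((cmod (f v))\<^sup>2)) summable_on V"
    by (auto dest: summable_on_Re)
  with False show ?thesis
    unfolding l2_inner_def complex_norm_square[symmetric] by (simp add: infsum_not_exists)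
qed

lemma l2_inner_self_pos:
  assumes "f \<in> l2 V" "f \<noteq> 0" shows "0 < Re (l2_inner V f f)"
proof -
  obtain v where v: "f v \<noteq> 0" using assms(2) by (auto simp: fun_eq_iff)
  with assms have "v \<in> V" by (auto simp: l2_def)
  have "(cmod (f v))\<^sup>2 \<le> (\<Sum>\<^sub>\<infinity>v\<in>V. (cmod (f v))\<^sup>2)"
    using finite_sum_le_infsum[of "\<lambda>v. (cmod (f v))\<^sup>2" V "{v}"] assms \<open>v \<in> V\<close>
    by (simp add: l2_def)
  moreover have "0 < (cmod (f v))\<^sup>2" using v by simp
  ultimately have "0 < (\<Sum>\<^sub>\<infinity>v\<in>V. (cmod (f v))\<^sup>2)" by (rule less_le_trans[rotated])
  then show ?thesis by (simp add: l2_inner_self)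
qed

lemma l2_inner_finite_support:
  assumes "finite S" "S \<subseteq> V" "\<And>v. v \<notin> S \<Longrightarrow> g v = 0"
  shows "l2_inner V f g = (\<Sum>v\<in>S. f v * cnj (g v))"
proof -
  have "l2_inner V f g = (\<Sum>\<^sub>\<infinity>v\<in>S. f v * cnj (g v))"
    unfolding l2_inner_def using assms(2,3) by (intro infsum_cong_neutral) auto
  with assms(1) show ?thesis by simp
qed

text \<open>The Cauchy bound holds on every finite index set, where it passes to the pointwise
  limit; being uniform in the finite set, it then holds for the infinite sum.\<close>

lemma l2_complete:
  fixes X :: "nat \<Rightarrow> 'v \<Rightarrow> complex"
  assumes X: "\<And>n. X n \<in> l2 V"
    and cauchy: "\<And>\<epsilon>. \<epsilon> > 0 \<Longrightarrow> \<exists>N. \<forall>m\<ge>N. \<forall>n\<ge>N. (\<Sum>\<^sub>\<infinity>v\<in>V. (cmod (X m v - X n v))\<^sup>2) < \<epsilon>"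
  shows "\<exists>f\<in>l2 V. (\<lambda>n. \<Sum>\<^sub>\<infinity>v\<in>V. (cmod (X n v - f v))\<^sup>2) \<longlonglongrightarrow> 0"
proof -
  have summ: "(\<lambda>v. (cmod (X m v - X n v))\<^sup>2) summable_on V" for m n
    using l2_diff[OF X X, of m n] by (simp add: l2_def)
  have fin_le: "(\<Sum>v\<in>F. (cmod (X m v - X n v))\<^sup>2) \<le> (\<Sum>\<^sub>\<infinity>v\<in>V. (cmod (X m v - X n v))\<^sup>2)"
    if "finite F" "F \<subseteq> V" for F m n
    using that by (intro finite_sum_le_infsum summ) auto
  have "Cauchy (\<lambda>n. X n v)" for v
  proof (cases "v \<in> V")
    case False
    with X have "X n v = 0" for n by (auto simp: l2_def)
    then show ?thesis by (simp add: Cauchy_def)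
  next
    case True
    show ?thesis
    proof (rule metric_CauchyI)
      fix e :: real assume "e > 0"
      then have "e\<^sup>2 > 0" by simp
      from cauchy[OF this] obtain N where
        N: "\<And>m n. m \<ge> N \<Longrightarrow> n \<ge> N \<Longrightarrow> (\<Sum>\<^sub>\<infinity>v\<in>V. (cmod (X m v - X n v))\<^sup>2) < e\<^sup>2" by blast
      have "dist (X m v) (X n v) < e" if "m \<ge> N" "n \<ge> N" for m n
      proof -
        have "(cmod (X m v - X n v))\<^sup>2 < e\<^sup>2"
          using fin_le[of "{v}" m n] N[OF that] True by simp
        then show ?thesis
          unfolding dist_norm by (rule power2_less_imp_less) (use \<open>e > 0\<close> in simp)
      qed
      then show "\<exists>N. \<forall>m\<ge>N. \<forall>n\<ge>N. dist (X m v) (X n v) < e" by blast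
    qed
  qed
  then have "\<forall>v. \<exists>l. (\<lambda>n. X n v) \<longlonglongrightarrow> l"
    by (simp add: Cauchy_convergent_iff convergent_def)
  then obtain f where f: "\<And>v. (\<lambda>n. X n v) \<longlonglongrightarrow> f v" by metis
  have tail: "\<exists>N. \<forall>n\<ge>N. \<forall>F. finite F \<and> F \<subseteq> V \<longrightarrow> (\<Sum>v\<in>F. (cmod (X n v - f v))\<^sup>2) \<le> e" if "e > 0" for e
  proof -
    from cauchy[OF that] obtain N where
      N: "\<And>m n. m \<ge> N \<Longrightarrow> n \<ge> N \<Longrightarrow> (\<Sum>\<^sub>\<infinity>v\<in>V. (cmod (X m v - X n v))\<^sup>2) < e" by blast
    have "(\<Sum>v\<in>F. (cmod (X n v - f v))\<^sup>2) \<le> e" if "n \<ge> N" "finite F" "F \<subseteq> V" for n F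
    proof (rule tendsto_upperbound)
      show "(\<lambda>m. \<Sum>v\<in>F. (cmod (X n v - X m v))\<^sup>2) \<longlonglongrightarrow> (\<Sum>v\<in>F. (cmod (X n v - f v))\<^sup>2)"
        by (intro tendsto_intros f)
      show "\<forall>\<^sub>F m in sequentially. (\<Sum>v\<in>F. (cmod (X n v - X m v))\<^sup>2) \<le> e"
        using eventually_ge_at_top[of N]
        by eventually_elim (rule order_trans[OF fin_le less_imp_le[OF N]], use that in auto)
    qed simp
    then show ?thesis by blast
  qed
  have "f v = 0" if "v \<notin> V" for v
    using f[of v] X that by (auto simp: l2_def LIMSEQ_const_iff)
  \<comment> \<open>One approximant at finite distance is enough: \<open>f\<close> is then a
    difference of two square-summable functions.\<close>
  moreover obtain n where n: "\<And>F. finite F \<Longrightarrow> F \<subseteq> V \<Longrightarrow> (\<Sum>v\<in>F. (cmod (X n v - f v))\<^sup>2) \<le> 1"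
    using tail[of 1] by auto
  have "(\<lambda>v. (cmod (X n v - f v))\<^sup>2) summable_on V"
    by (rule nonneg_bdd_above_summable_on) (auto intro!: bdd_aboveI[of _ 1] n)
  ultimately have "X n - f \<in> l2 V"
    using X[of n] by (simp add: l2_def)
  from l2_diff[OF X[of n] this] have fl2: "f \<in> l2 V" by simp
  have summf: "(\<lambda>v. (cmod (X n v - f v))\<^sup>2) summable_on V" for n
    using l2_diff[OF X fl2, of n] by (simp add: l2_def)
  have "(\<lambda>n. \<Sum>\<^sub>\<infinity>v\<in>V. (cmod (X n v - f v))\<^sup>2) \<longlonglongrightarrow> 0"
  proof (rule LIMSEQ_I)
    fix e :: real assume "e > 0"
    with tail[of "e/2"] obtain N where
      N: "\<And>n F. n \<ge> N \<Longrightarrow> finite F \<Longrightarrow> F \<subseteq> V \<Longrightarrow> (\<Sum>v\<in>F. (cmod (X n v - f v))\<^sup>2) \<le> e/2" by auto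
    have "norm ((\<Sum>\<^sub>\<infinity>v\<in>V. (cmod (X n v - f v))\<^sup>2) - 0) < e" if "n \<ge> N" for n
    proof -
      have "(\<Sum>\<^sub>\<infinity>v\<in>V. (cmod (X n v - f v))\<^sup>2) \<le> e/2"
        using N[OF that] by (intro infsum_le_finite_sums summf) auto
      moreover have "(\<Sum>\<^sub>\<infinity>v\<in>V. (cmod (X n v - f v))\<^sup>2) \<ge> 0"
        by (intro infsum_nonneg) auto
      ultimately show ?thesis using \<open>e > 0\<close> by simp
    qed
    then show "\<exists>no. \<forall>n\<ge>no. norm ((\<Sum>\<^sub>\<infinity>v\<in>V. (cmod (X n v - f v))\<^sup>2) - 0) < e" by blast
  qed
  with fl2 show ?thesis by blast
qed


section \<open>Multi-indices and kernel coefficients\<close>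

lemma finite_msize: "finite {\<alpha> :: 'n::finite \<Rightarrow> nat. msize \<alpha> = n}"
proof (rule finite_subset)
  show "{\<alpha> :: 'n \<Rightarrow> nat. msize \<alpha> = n} \<subseteq> PiE UNIV (\<lambda>_. {..n})"
    by (auto simp: msize_def intro: member_le_sum)
qed (simp add: finite_PiE)

lemma msize_zero [simp]: "msize (\<lambda>_. 0) = 0"
  by (simp add: msize_def)

lemma msize_Suc: "msize (\<alpha>(k := Suc (\<alpha> k))) = Suc (msize \<alpha>)"
  by (simp add: msize_def sum.remove[of UNIV k])

lemma mfact_pos: "0 < mfact \<alpha>"
  by (simp add: mfact_def prod_pos)

lemma prod_power_Suc:
  fixes t :: "'n::finite \<Rightarrow> 'a::comm_monoid_mult"
  shows "(\<Prod>j\<in>UNIV. t j ^ (\<alpha>(k := Suc (\<alpha> k))) j) = t k * (\<Prod>j\<in>UNIV. t j ^ \<alpha> j)"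
  by (simp add: prod.remove[of UNIV k] mult.assoc)

lemma has_sum_sum:
  fixes f :: "'i \<Rightarrow> 'x \<Rightarrow> 'b::topological_comm_monoid_add"
  assumes "\<And>i. i \<in> I \<Longrightarrow> (f i has_sum s i) A"
  shows "((\<lambda>x. \<Sum>i\<in>I. f i x) has_sum (\<Sum>i\<in>I. s i)) A"
  using assms by (induction I rule: infinite_finite_induct) (simp_all add: has_sum_add)

text \<open>Grouping by total degree turns an unordered sum into an ordinary series of homogeneous
  parts, to which one-variable power series arguments apply.\<close>

lemma sums_by_msize:
  fixes f :: "('n::finite \<Rightarrow> nat) \<Rightarrow> 'b::banach"
  assumes "f summable_on UNIV"
  shows "(\<lambda>n. \<Sum>\<alpha> | msize \<alpha> = n. f \<alpha>) sums (\<Sum>\<^sub>\<infinity>\<alpha>. f \<alpha>)"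
proof -
  have "(f has_sum infsum f UNIV) UNIV"
    using assms by simp
  also have "?this \<longleftrightarrow> ((\<lambda>(n, \<alpha>). f \<alpha>) has_sum infsum f UNIV) (SIGMA n:UNIV. {\<alpha>. msize \<alpha> = n})"
    by (rule has_sum_reindex_bij_witness[of _ snd "\<lambda>\<alpha>. (msize \<alpha>, \<alpha>)"]) auto
  finally have "((\<lambda>n. \<Sum>\<alpha> | msize \<alpha> = n. f \<alpha>) has_sum infsum f UNIV) UNIV"
    by (rule has_sum_SigmaD) (simp add: finite_msize has_sum_finiteI)
  then show ?thesis by (rule has_sum_imp_sums)
qed

text \<open>The coefficient of z^\<alpha> cnj(w)^\<alpha> in the scalar kernel of depth \<beta>.
  Monomials scaled by its square root form an orthonormal basis of the scalar space.\<close>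

definition wt :: "nat \<Rightarrow> ('n::finite \<Rightarrow> nat) \<Rightarrow> ('n \<Rightarrow> nat) \<Rightarrow> real" where
  "wt a \<beta> \<alpha> = real (mfact \<beta>) / real (mfact (\<lambda>j. \<beta> j + \<alpha> j)) *
     (\<Prod>i<msize \<alpha>. real (msize \<beta>) + real a + real i)"

lemma wt_pos: "a > 0 \<Longrightarrow> 0 < wt a \<beta> \<alpha>"
  unfolding wt_def by (intro mult_pos_pos divide_pos_pos prod_pos) (simp_all add: mfact_pos)

lemma wt_zero: "wt a \<beta> (\<lambda>_. 0) = 1"
  using mfact_pos[of \<beta>] by (simp add: wt_def)

text \<open>Passing from \<alpha> to \<alpha> + e_k adds one factor to the rising product and one to
  the factorial in coordinate k. This recursion yields both the convergence estimate and the weights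
  of the coordinate multiplications.\<close>

lemma wt_Suc:
  "wt a \<beta> (\<alpha>(k := Suc (\<alpha> k))) * (real (\<beta> k) + real (\<alpha> k) + 1) =
   wt a \<beta> \<alpha> * (real (msize \<beta>) + real a + real (msize \<alpha>))"
proof -
  have "mfact (\<lambda>j. \<beta> j + (\<alpha>(k := Suc (\<alpha> k))) j) = mfact (\<lambda>j. \<beta> j + \<alpha> j) * Suc (\<beta> k + \<alpha> k)"
    by (simp add: mfact_def prod.remove[of UNIV k] algebra_simps)
  then have "real (mfact (\<lambda>j. \<beta> j + (\<alpha>(k := Suc (\<alpha> k))) j)) =
      real (mfact (\<lambda>j. \<beta> j + \<alpha> j)) * (real (\<beta> k) + real (\<alpha> k) + 1)"
    by (simp only: of_nat_mult of_nat_Suc of_nat_add) (simp only: add_ac)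
  moreover have "x / (M * c) * (P * y) * c = x / M * P * y" if "c \<noteq> 0" for x M c P y :: real
    using that by simp
  moreover have "real (\<beta> k) + real (\<alpha> k) + 1 \<noteq> 0" by linarith
  ultimately show ?thesis
    by (simp only: wt_def msize_Suc prod.lessThan_Suc)
qed

section \<open>Convergence of the scalar kernel on the ball\<close>

definition homsum :: "nat \<Rightarrow> ('n::finite \<Rightarrow> nat) \<Rightarrow> ('n \<Rightarrow> real) \<Rightarrow> nat \<Rightarrow> real" where
  "homsum a \<beta> t n = (\<Sum>\<alpha> | msize \<alpha> = n. wt a \<beta> \<alpha> * (\<Prod>j\<in>UNIV. t j ^ \<alpha> j))"

text \<open>
  Euler's identity for the homogeneous part of degree \<open>n + 1\<close>, combined with the recursion for
  the coefficients, bounds that part by a multiple of the previous one.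
\<close>

lemma homsum_Suc_le:
  fixes t :: "'n::finite \<Rightarrow> real"
  assumes a: "a > 0" and t: "\<And>j. t j \<ge> 0"
  shows "real (Suc n) * homsum a \<beta> t (Suc n) \<le>
    (real (msize \<beta>) + real a + real n) * (\<Sum>j\<in>UNIV. t j) * homsum a \<beta> t n"
proof -
  let ?m = "\<lambda>\<alpha>. \<Prod>j\<in>UNIV. t j ^ \<alpha> j"
  have nonneg: "0 \<le> wt a \<beta> \<alpha> * ?m \<alpha>" for \<alpha>
    using wt_pos[OF a, of \<beta> \<alpha>] t by (simp add: prod_nonneg)
  have "real (Suc n) * homsum a \<beta> t (Suc n) =
      (\<Sum>\<alpha> | msize \<alpha> = Suc n. (\<Sum>k\<in>UNIV. real (\<alpha> k)) * (wt a \<beta> \<alpha> * ?m \<alpha>))"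
    unfolding homsum_def sum_distrib_left
    by (intro sum.cong) (auto simp: msize_def simp flip: of_nat_sum)
  \<comment> \<open>Terms with \<alpha> k = 0 vanish on the left; in the others \<alpha> k is
    enlarged to \<beta> k + \<alpha> k, exactly the factor that the recursion for \<open>wt\<close>
    absorbs.\<close>
  also have "\<dots> \<le> (\<Sum>\<alpha> | msize \<alpha> = Suc n. \<Sum>k\<in>UNIV.
      if \<alpha> k > 0 then (real (\<beta> k) + real (\<alpha> k)) * (wt a \<beta> \<alpha> * ?m \<alpha>) else 0)"
    unfolding sum_distrib_right
    by (intro sum_mono) (auto intro!: mult_right_mono nonneg)
  also have "\<dots> = (\<Sum>k\<in>UNIV. \<Sum>\<alpha> | msize \<alpha> = Suc n.
      if \<alpha> k > 0 then (real (\<beta> k) + real (\<alpha> k)) * (wt a \<beta> \<alpha> * ?m \<alpha>) else 0)"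
    by (rule sum.swap)
  also have "\<dots> = (\<Sum>k\<in>UNIV. \<Sum>\<alpha> | msize \<alpha> = Suc n \<and> \<alpha> k > 0.
      (real (\<beta> k) + real (\<alpha> k)) * (wt a \<beta> \<alpha> * ?m \<alpha>))"
    by (intro sum.cong refl sum.mono_neutral_cong_right finite_msize) auto
  also have "\<dots> = (\<Sum>k\<in>UNIV. \<Sum>\<alpha> | msize \<alpha> = n.
      (real (msize \<beta>) + real a + real n) * (t k * (wt a \<beta> \<alpha> * ?m \<alpha>)))"
  proof (rule sum.cong[OF refl])
    fix k
    show "(\<Sum>\<alpha> | msize \<alpha> = Suc n \<and> \<alpha> k > 0. (real (\<beta> k) + real (\<alpha> k)) * (wt a \<beta> \<alpha> * ?m \<alpha>)) =
      (\<Sum>\<alpha> | msize \<alpha> = n. (real (msize \<beta>) + real a + real n) * (t k * (wt a \<beta> \<alpha> * ?m \<alpha>)))"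
    proof (rule sum.reindex_bij_witness[of _ "\<lambda>\<alpha>. \<alpha>(k := Suc (\<alpha> k))" "\<lambda>\<alpha>. \<alpha>(k := \<alpha> k - 1)"])
      fix \<alpha> :: "'n \<Rightarrow> nat" assume \<alpha>: "\<alpha> \<in> {\<alpha>. msize \<alpha> = Suc n \<and> \<alpha> k > 0}"
      let ?\<alpha>' = "\<alpha>(k := \<alpha> k - 1)"
      have up: "?\<alpha>'(k := Suc (?\<alpha>' k)) = \<alpha>" using \<alpha> by auto
      show "?\<alpha>'(k := Suc (?\<alpha>' k)) = \<alpha>" by (fact up)
      have n: "msize ?\<alpha>' = n" using msize_Suc[of ?\<alpha>' k] \<alpha> unfolding up by simp
      then show "?\<alpha>' \<in> {\<alpha>. msize \<alpha> = n}" by simp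
      have "?m \<alpha> = t k * ?m ?\<alpha>'" using prod_power_Suc[of t ?\<alpha>' k] unfolding up .
      moreover have "wt a \<beta> \<alpha> * (real (\<beta> k) + real (\<alpha> k)) =
          wt a \<beta> ?\<alpha>' * (real (msize \<beta>) + real a + real n)"
        using wt_Suc[of a \<beta> ?\<alpha>' k] \<alpha> unfolding up n by (simp add: algebra_simps)
      ultimately show "(real (msize \<beta>) + real a + real n) * (t k * (wt a \<beta> ?\<alpha>' * ?m ?\<alpha>')) =
          (real (\<beta> k) + real (\<alpha> k)) * (wt a \<beta> \<alpha> * ?m \<alpha>)"
        by (simp add: mult.assoc) (simp add: mult.left_commute mult.commute)
    qed (auto simp: msize_Suc)
  qed
  also have "\<dots> = (real (msize \<beta>) + real a + real n) * (\<Sum>j\<in>UNIV. t j) * homsum a \<beta> t n"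
    by (simp add: homsum_def sum_distrib_left sum_distrib_right mult.assoc sum.swap[of _ UNIV])
  finally show ?thesis .
qed

text \<open>The coefficients of the binomial series of (1 - s)^-(|\<beta>| + a).\<close>

definition growth :: "nat \<Rightarrow> ('n::finite \<Rightarrow> nat) \<Rightarrow> nat \<Rightarrow> real" where
  "growth a \<beta> n = (\<Prod>i<n. (real (msize \<beta>) + real a + real i) / real (Suc i))"

lemma growth_nonneg: "0 \<le> growth a \<beta> n"
  unfolding growth_def by (intro prod_nonneg) auto

text \<open>For \<beta> = 0 this is an equality, the multinomial theorem. With t_j = |z_j|^2 the sum
  of the t_j is |z|^2, so the bound converges on the Euclidean unit ball.\<close>

lemma homsum_le_growth:
  fixes t :: "'n::finite \<Rightarrow> real"
  assumes a: "a > 0" and t: "\<And>j. t j \<ge> 0"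
  shows "homsum a \<beta> t n \<le> growth a \<beta> n * (\<Sum>j\<in>UNIV. t j) ^ n"
proof (induction n)
  case 0
  have "{\<alpha> :: 'n \<Rightarrow> nat. msize \<alpha> = 0} = {\<lambda>_. 0}" by (auto simp: msize_def)
  then show ?case by (simp add: homsum_def growth_def wt_zero)
next
  case (Suc n)
  let ?s = "\<Sum>j\<in>UNIV. t j" and ?b = "real (msize \<beta>) + real a + real n"
  have s: "?s \<ge> 0" using t by (simp add: sum_nonneg)
  have "real (Suc n) * homsum a \<beta> t (Suc n) \<le> ?b * ?s * homsum a \<beta> t n"
    by (rule homsum_Suc_le[OF a t])
  also have "\<dots> \<le> ?b * ?s * (growth a \<beta> n * ?s ^ n)"
    using s by (intro mult_left_mono Suc) auto
  also have "\<dots> = real (Suc n) * (growth a \<beta> (Suc n) * ?s ^ Suc n)"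
    by (simp add: growth_def del: of_nat_Suc)
  finally show ?case
    by (rule mult_left_le_imp_le) simp
qed

lemma summable_growth:
  assumes "0 \<le> s" "s < 1"
  shows "summable (\<lambda>n. growth a \<beta> n * s ^ n)"
proof -
  have "(\<lambda>n. (b + real n) / real (Suc n)) \<longlonglongrightarrow> 1" for b :: real
    by real_asymp
  from tendsto_mult_right[OF this[of "real (msize \<beta>) + real a"], of s]
  have "(\<lambda>n. (real (msize \<beta>) + real a + real n) / real (Suc n) * s) \<longlonglongrightarrow> s"
    by (simp only: mult_1_left)
  \<comment> \<open>The ratios tend to s, so from some index on they stay below the midpoint of s
    and 1.\<close>
  then have "\<forall>\<^sub>F n in sequentially. (real (msize \<beta>) + real a + real n) / real (Suc n) * s < (1 + s) / 2"
    using assms by (intro order_tendstoD(2)) auto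
  then obtain N where N: "\<And>n. n \<ge> N \<Longrightarrow>
      (real (msize \<beta>) + real a + real n) / real (Suc n) * s < (1 + s) / 2"
    unfolding eventually_sequentially by blast
  show ?thesis
  proof (rule summable_ratio_test[of "(1 + s) / 2" N])
    show "(1 + s) / 2 < 1" using assms by simp
    fix n assume "n \<ge> N"
    have nn: "0 \<le> growth a \<beta> m * s ^ m" for m
      using assms growth_nonneg by (intro mult_nonneg_nonneg) auto
    have "growth a \<beta> (Suc n) * s ^ Suc n =
        (real (msize \<beta>) + real a + real n) / real (Suc n) * s * (growth a \<beta> n * s ^ n)"
      by (simp add: growth_def)
    also have "\<dots> \<le> (1 + s) / 2 * (growth a \<beta> n * s ^ n)"
      using N[OF \<open>n \<ge> N\<close>] nn by (intro mult_right_mono) auto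
    finally show "norm (growth a \<beta> (Suc n) * s ^ Suc n) \<le> (1 + s) / 2 * norm (growth a \<beta> n * s ^ n)"
      by (simp only: real_norm_def abs_of_nonneg nn)
  qed
qed

lemma norm_sq_eq_sum: "(norm z)\<^sup>2 = (\<Sum>j\<in>UNIV. (cmod (z $ j))\<^sup>2)" for z :: "complex ^ 'n::finite"
  by (simp add: norm_vec_def L2_set_def sum_nonneg)

lemma cmod_mpow_sq: "(cmod (mpow z \<alpha>))\<^sup>2 = (\<Prod>j\<in>UNIV. (cmod (z $ j))\<^sup>2 ^ \<alpha> j)"
  by (simp add: mpow_def prod_norm[symmetric] norm_power prod_power_distrib power_mult[symmetric] mult.commute)

lemma wt_mpow_le:
  assumes "a > 0"
  shows "(\<Sum>\<alpha> | msize \<alpha> = n. wt a \<beta> \<alpha> * (cmod (mpow z \<alpha>))\<^sup>2) \<le> growth a \<beta> n * ((norm z)\<^sup>2) ^ n"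
  using homsum_le_growth[OF assms, of "\<lambda>j. (cmod (z $ j))\<^sup>2" \<beta> n]
  by (simp add: homsum_def cmod_mpow_sq norm_sq_eq_sum)

lemma wt_mpow_summable:
  assumes a: "a > 0" and z: "norm z < 1"
  shows "(\<lambda>\<alpha>. wt a \<beta> \<alpha> * (cmod (mpow z \<alpha>))\<^sup>2) summable_on UNIV"
proof (rule nonneg_bdd_above_summable_on)
  let ?f = "\<lambda>\<alpha>. wt a \<beta> \<alpha> * (cmod (mpow z \<alpha>))\<^sup>2"
  have nn: "0 \<le> ?f \<alpha>" for \<alpha> using wt_pos[OF a, of \<beta> \<alpha>] by simp
  then show "0 \<le> ?f \<alpha>" for \<alpha> .
  have z2: "(norm z)\<^sup>2 < 1" using z by (simp add: power_less_one_iff abs_square_less_1)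
  have "sum ?f F \<le> (\<Sum>n. growth a \<beta> n * ((norm z)\<^sup>2) ^ n)" if "finite F" for F
  proof -
    define N where "N = Max (msize ` F)"
    have "sum ?f F = (\<Sum>n\<le>N. \<Sum>\<alpha> | \<alpha> \<in> F \<and> msize \<alpha> = n. ?f \<alpha>)"
      by (rule sum.group[symmetric]) (use that in \<open>auto simp: N_def\<close>)
    also have "\<dots> \<le> (\<Sum>n\<le>N. \<Sum>\<alpha> | msize \<alpha> = n. ?f \<alpha>)"
      by (intro sum_mono sum_mono2 finite_msize nn) auto
    also have "\<dots> \<le> (\<Sum>n\<le>N. growth a \<beta> n * ((norm z)\<^sup>2) ^ n)"
      by (intro sum_mono wt_mpow_le a)
    also have "\<dots> \<le> (\<Sum>n. growth a \<beta> n * ((norm z)\<^sup>2) ^ n)"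
      using z2 by (intro sum_le_suminf summable_growth mult_nonneg_nonneg growth_nonneg) auto
    finally show ?thesis .
  qed
  then show "bdd_above (sum ?f ` {F. F \<subseteq> UNIV \<and> finite F})"
    by (auto intro!: bdd_aboveI)
qed


section \<open>Roots of unity\<close>

definition unit_root :: "nat \<Rightarrow> nat \<Rightarrow> complex" where
  "unit_root N l = cis (2 * pi * real l / real N)"

text \<open>The symmetry of the discrete Fourier matrix; it converts orthogonality of rows into
  orthogonality of columns.\<close>

lemma unit_root_power_swap: "unit_root N l ^ m = unit_root N m ^ l"
proof -
  have "real m * (2 * pi * real l / real N) = real l * (2 * pi * real m / real N)" by simp
  then show ?thesis by (simp only: unit_root_def Complex.DeMoivre)
qed

lemma cmod_unit_root [simp]: "cmod (unit_root N l) = 1"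
  by (simp add: unit_root_def)

lemma unit_root_0 [simp]: "unit_root N 0 = 1"
  by (simp add: unit_root_def)

lemma unit_root_orthogonal:
  assumes "l < N" "l' < N"
  shows "(\<Sum>m<N. unit_root N l ^ m * cnj (unit_root N l' ^ m)) = (if l = l' then of_nat N else 0)"
proof -
  \<comment> \<open>The sum is geometric in \<open>q\<close>, which is an N-th root of unity and
    differs from 1 unless l = l'.\<close>
  define q where "q = unit_root N l * cnj (unit_root N l')"
  have unit: "unit_root N k * cnj (unit_root N k) = 1" for k
    by (simp flip: complex_norm_square)
  have N: "N > 0" using assms by simp
  have qm: "unit_root N l ^ m * cnj (unit_root N l' ^ m) = q ^ m" for m
    by (simp add: q_def power_mult_distrib)
  show ?thesis
  proof (cases "l = l'")
    case True
    then have "q = 1" using unit by (simp add: q_def)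
    with True show ?thesis unfolding qm by simp
  next
    case False
    have bij: "inj_on (unit_root N) {..<N}"
      using Complex.bij_betw_roots_unity[OF N] by (simp add: bij_betw_def unit_root_def[abs_def])
    have "q \<noteq> 1"
    proof
      assume "q = 1"
      then have "unit_root N l * (cnj (unit_root N l') * unit_root N l') = unit_root N l'"
        by (simp add: q_def flip: mult.assoc)
      then have "unit_root N l = unit_root N l'"
        using unit[of l'] by (simp add: mult.commute)
      with bij assms False show False by (auto dest: inj_onD)
    qed
    moreover have "unit_root N k ^ N = 1" for k
      using N by (simp add: unit_root_def Complex.DeMoivre)
    then have "q ^ N = 1"
      by (simp add: q_def power_mult_distrib flip: complex_cnj_power)
    ultimately show ?thesis
      using False unfolding qm by (simp add: sum_gp_strict)
  qed
qed


section \<open>Power series with square-summable normalised coefficients\<close>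

text \<open>The coefficient family of the kernel function at z. Because of the conjugate, having it
  as second argument of the inner product means evaluation at z.\<close>

definition kvec :: "nat \<Rightarrow> ('n::finite \<Rightarrow> nat) \<Rightarrow> complex ^ 'n \<Rightarrow> ('n \<Rightarrow> nat) \<Rightarrow> complex" where
  "kvec a \<beta> z = (\<lambda>\<alpha>. cnj (complex_of_real (sqrt (wt a \<beta> \<alpha>)) * mpow z \<alpha>))"

definition pser :: "nat \<Rightarrow> ('n::finite \<Rightarrow> nat) \<Rightarrow> (('n \<Rightarrow> nat) \<Rightarrow> complex) \<Rightarrow> complex ^ 'n \<Rightarrow> complex" where
  "pser a \<beta> c z = l2_inner UNIV c (kvec a \<beta> z)"

lemma cmod_kvec_sq: "a > 0 \<Longrightarrow> (cmod (kvec a \<beta> z \<alpha>))\<^sup>2 = wt a \<beta> \<alpha> * (cmod (mpow z \<alpha>))\<^sup>2"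
  using wt_pos[of a \<beta> \<alpha>] by (simp add: kvec_def norm_mult power_mult_distrib)

lemma kvec_l2: "a > 0 \<Longrightarrow> norm z < 1 \<Longrightarrow> kvec a \<beta> z \<in> l2 UNIV"
  by (simp add: l2_def cmod_kvec_sq wt_mpow_summable)

lemma pser_eq: "pser a \<beta> c z = (\<Sum>\<^sub>\<infinity>\<alpha>. c \<alpha> * (complex_of_real (sqrt (wt a \<beta> \<alpha>)) * mpow z \<alpha>))"
  by (simp add: pser_def l2_inner_def kvec_def)

lemma pser_summable:
  assumes "a > 0" "norm z < 1" "c \<in> l2 UNIV"
  shows "(\<lambda>\<alpha>. c \<alpha> * (complex_of_real (sqrt (wt a \<beta> \<alpha>)) * mpow z \<alpha>)) summable_on UNIV"
  using l2_mult_summable[OF assms(3) kvec_l2[OF assms(1,2)]] by (simp add: kvec_def)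

lemma pser_kvec: 
  assumes "a > 0"
  shows "pser a \<beta> (kvec a \<beta> w) z = kcoeff (real a) \<beta> z w"
proof -
  have sq: "complex_of_real (sqrt (wt a \<beta> \<alpha>)) * complex_of_real (sqrt (wt a \<beta> \<alpha>)) =
      complex_of_real (wt a \<beta> \<alpha>)" for \<alpha>
    using wt_pos[OF assms, of \<beta> \<alpha>] by (simp flip: of_real_mult)
  have "kvec a \<beta> w \<alpha> * (complex_of_real (sqrt (wt a \<beta> \<alpha>)) * mpow z \<alpha>) =
      complex_of_real (wt a \<beta> \<alpha>) * mpow z \<alpha> * cnj (mpow w \<alpha>)" for \<alpha>
    unfolding kvec_def sq[symmetric] by simp
  then show ?thesis
    by (simp only: pser_eq kcoeff_def wt_def[symmetric])
qed

section \<open>Coordinate multiplications as weighted shifts\<close>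

lemma has_sum_Suc_index:
  fixes g :: "('n::finite \<Rightarrow> nat) \<Rightarrow> 'b::{topological_comm_monoid_add,t2_space}"
  assumes "\<And>\<alpha>. \<alpha> k = 0 \<Longrightarrow> g \<alpha> = 0"
  shows "(g has_sum s) UNIV \<longleftrightarrow> ((\<lambda>\<alpha>. g (\<alpha>(k := Suc (\<alpha> k)))) has_sum s) UNIV"
proof -
  have "(g has_sum s) UNIV \<longleftrightarrow> (g has_sum s) {\<alpha>. \<alpha> k > 0}"
    using assms by (intro has_sum_cong_neutral) auto
  also have "\<dots> \<longleftrightarrow> ((\<lambda>\<alpha>. g (\<alpha>(k := Suc (\<alpha> k)))) has_sum s) UNIV"
    by (rule has_sum_reindex_bij_witness[of _ "\<lambda>\<alpha>. \<alpha>(k := Suc (\<alpha> k))" "\<lambda>\<alpha>. \<alpha>(k := \<alpha> k - 1)"]) auto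
  finally show ?thesis .
qed

text \<open>The quotient of \<open>wt\<close> at \<alpha> by \<open>wt\<close> at \<alpha> + e_k:
  the squared weight of the shift that multiplication by z_k induces on normalised
  coefficients.\<close>

definition shift_ratio :: "nat \<Rightarrow> ('n::finite \<Rightarrow> nat) \<Rightarrow> 'n \<Rightarrow> ('n \<Rightarrow> nat) \<Rightarrow> real" where
  "shift_ratio a \<beta> k \<alpha> =
     (real (\<beta> k) + real (\<alpha> k) + 1) / (real (msize \<beta>) + real a + real (msize \<alpha>))"

definition shift_coeffs ::
  "nat \<Rightarrow> ('n::finite \<Rightarrow> nat) \<Rightarrow> 'n \<Rightarrow> (('n \<Rightarrow> nat) \<Rightarrow> complex) \<Rightarrow> (('n \<Rightarrow> nat) \<Rightarrow> complex)" where
  "shift_coeffs a \<beta> k c = (\<lambda>\<alpha>. if \<alpha> k = 0 then 0 else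
     complex_of_real (sqrt (shift_ratio a \<beta> k (\<alpha>(k := \<alpha> k - 1)))) * c (\<alpha>(k := \<alpha> k - 1)))"

lemma shift_coeffs_Suc:
  "shift_coeffs a \<beta> k c (\<alpha>(k := Suc (\<alpha> k))) = complex_of_real (sqrt (shift_ratio a \<beta> k \<alpha>)) * c \<alpha>"
  by (simp add: shift_coeffs_def)

lemma shift_ratio_pos: "a > 0 \<Longrightarrow> 0 < shift_ratio a \<beta> k \<alpha>"
  unfolding shift_ratio_def by (intro divide_pos_pos) auto

text \<open>Each coordinate is at most the total degree, and the 1 in the numerator is absorbed by
  the integer \<open>a\<close>. Hence the shifts are contractions.\<close>

lemma shift_ratio_le_1:
  assumes "a > 0" shows "shift_ratio a \<beta> k \<alpha> \<le> 1"
proof -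
  have "\<beta> k \<le> msize \<beta>" "\<alpha> k \<le> msize \<alpha>"
    by (auto simp: msize_def intro: member_le_sum)
  then have "real (\<beta> k) + real (\<alpha> k) + 1 \<le> real (msize \<beta>) + real a + real (msize \<alpha>)"
    using assms by linarith
  then show ?thesis using assms by (simp add: shift_ratio_def divide_le_eq_1)
qed

lemma shift_coeffs_l2:
  assumes a: "a > 0" and c: "c \<in> l2 UNIV"
  shows "shift_coeffs a \<beta> k c \<in> l2 UNIV"
    and "(\<Sum>\<^sub>\<infinity>\<alpha>. (cmod (shift_coeffs a \<beta> k c \<alpha>))\<^sup>2) \<le> (\<Sum>\<^sub>\<infinity>\<alpha>. (cmod (c \<alpha>))\<^sup>2)"
proof -
  let ?d = "\<lambda>\<alpha>. (cmod (shift_coeffs a \<beta> k c (\<alpha>(k := Suc (\<alpha> k)))))\<^sup>2"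
  have le: "?d \<alpha> \<le> (cmod (c \<alpha>))\<^sup>2" for \<alpha>
    using shift_ratio_pos[OF a, of \<beta> k \<alpha>] shift_ratio_le_1[OF a, of \<beta> k \<alpha>]
    by (simp add: shift_coeffs_Suc norm_mult power_mult_distrib mult_left_le_one_le)
  have csum: "(\<lambda>\<alpha>. (cmod (c \<alpha>))\<^sup>2) summable_on UNIV"
    using c by (simp add: l2_def)
  have dsum: "?d summable_on UNIV"
    by (rule summable_on_comparison_test[OF csum le]) simp
  have iff: "((\<lambda>\<alpha>. (cmod (shift_coeffs a \<beta> k c \<alpha>))\<^sup>2) has_sum s) UNIV \<longleftrightarrow> (?d has_sum s) UNIV" for s
    by (rule has_sum_Suc_index) (simp add: shift_coeffs_def)
  then show "shift_coeffs a \<beta> k c \<in> l2 UNIV"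
    using dsum unfolding l2_def summable_on_def mem_Collect_eq iff by simp
  have "(\<Sum>\<^sub>\<infinity>\<alpha>. (cmod (shift_coeffs a \<beta> k c \<alpha>))\<^sup>2) = infsum ?d UNIV"
    by (rule infsumI) (simp add: iff dsum)
  also have "\<dots> \<le> (\<Sum>\<^sub>\<infinity>\<alpha>. (cmod (c \<alpha>))\<^sup>2)"
    by (intro infsum_mono dsum csum le)
  finally show "(\<Sum>\<^sub>\<infinity>\<alpha>. (cmod (shift_coeffs a \<beta> k c \<alpha>))\<^sup>2) \<le> (\<Sum>\<^sub>\<infinity>\<alpha>. (cmod (c \<alpha>))\<^sup>2)" .
qed

lemma pser_shift_coeffs:
  fixes z :: "complex ^ 'n::finite"
  assumes a: "a > 0" and z: "norm z < 1" and c: "c \<in> l2 UNIV"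
  shows "pser a \<beta> (shift_coeffs a \<beta> k c) z = z $ k * pser a \<beta> c z"
proof -
  let ?f = "\<lambda>\<alpha>. c \<alpha> * (complex_of_real (sqrt (wt a \<beta> \<alpha>)) * mpow z \<alpha>)"
  let ?g = "\<lambda>\<alpha>. shift_coeffs a \<beta> k c \<alpha> * (complex_of_real (sqrt (wt a \<beta> \<alpha>)) * mpow z \<alpha>)"
  have step: "?g (\<alpha>(k := Suc (\<alpha> k))) = z $ k * ?f \<alpha>" for \<alpha>
  proof -
    have "shift_ratio a \<beta> k \<alpha> * wt a \<beta> (\<alpha>(k := Suc (\<alpha> k))) = wt a \<beta> \<alpha>"
    proof -
      have "wt a \<beta> (\<alpha>(k := Suc (\<alpha> k))) * (real (\<beta> k) + real (\<alpha> k) + 1) / C = wt a \<beta> \<alpha>"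
        if "C = real (msize \<beta>) + real a + real (msize \<alpha>)" for C
        using a by (simp add: wt_Suc that)
      then show ?thesis by (simp add: shift_ratio_def mult.commute)
    qed
    then have r: "sqrt (shift_ratio a \<beta> k \<alpha>) * sqrt (wt a \<beta> (\<alpha>(k := Suc (\<alpha> k)))) = sqrt (wt a \<beta> \<alpha>)"
      by (simp flip: real_sqrt_mult)
    have m: "mpow z (\<alpha>(k := Suc (\<alpha> k))) = z $ k * mpow z \<alpha>"
      unfolding mpow_def by (rule prod_power_Suc)
    show ?thesis
      unfolding shift_coeffs_Suc m r[symmetric] of_real_mult by (simp only: mult_ac)
  qed
  have "(?f has_sum pser a \<beta> c z) UNIV"
    unfolding pser_eq using pser_summable[OF a z c] by (rule has_sum_infsum)
  then have "((\<lambda>\<alpha>. ?g (\<alpha>(k := Suc (\<alpha> k)))) has_sum z $ k * pser a \<beta> c z) UNIV"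
    unfolding step by (rule has_sum_cmult_right)
  moreover have "(?g has_sum z $ k * pser a \<beta> c z) UNIV \<longleftrightarrow>
      ((\<lambda>\<alpha>. ?g (\<alpha>(k := Suc (\<alpha> k)))) has_sum z $ k * pser a \<beta> c z) UNIV"
    by (rule has_sum_Suc_index) (simp add: shift_coeffs_def)
  ultimately show ?thesis
    unfolding pser_eq[of a \<beta> "shift_coeffs a \<beta> k c"] by (simp only: infsumI)
qed

section \<open>Homogeneous parts and uniqueness of coefficients\<close>

definition homog ::
  "nat \<Rightarrow> ('n::finite \<Rightarrow> nat) \<Rightarrow> (('n \<Rightarrow> nat) \<Rightarrow> complex) \<Rightarrow> nat \<Rightarrow> complex ^ 'n \<Rightarrow> complex" where
  "homog a \<beta> c n z = (\<Sum>\<alpha> | msize \<alpha> = n. c \<alpha> * (complex_of_real (sqrt (wt a \<beta> \<alpha>)) * mpow z \<alpha>))"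

lemma homog_sums_pser:
  assumes "a > 0" "norm z < 1" "c \<in> l2 UNIV"
  shows "(\<lambda>n. homog a \<beta> c n z) sums pser a \<beta> c z"
  unfolding homog_def pser_eq by (rule sums_by_msize[OF pser_summable[OF assms]])

lemma homog_scale:
  fixes z :: "complex ^ 'n::finite"
  shows "homog a \<beta> c n (t *s z) = homog a \<beta> c n z * t ^ n"
proof -
  have "mpow (t *s z) \<alpha> = mpow z \<alpha> * t ^ msize \<alpha>" for \<alpha>
    by (simp add: mpow_def msize_def power_mult_distrib prod.distrib power_sum)
  then show ?thesis
    by (simp add: homog_def sum_distrib_right mult.assoc)
qed

lemma norm_vector_scale:
  fixes z :: "complex ^ 'n::finite" shows "norm (t *s z) = cmod t * norm z"
proof -
  have "(norm (t *s z))\<^sup>2 = (cmod t * norm z)\<^sup>2"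
    by (simp add: norm_sq_eq_sum norm_mult power_mult_distrib sum_distrib_left)
  then show ?thesis by simp
qed

text \<open>On the complex line through z the homogeneous parts are the coefficients of a
  one-variable power series in t that vanishes on the unit disc.\<close>

lemma homog_eq_0:
  fixes z :: "complex ^ 'n::finite"
  assumes a: "a > 0" and c: "c \<in> l2 UNIV" and zero: "\<And>z. norm z < 1 \<Longrightarrow> pser a \<beta> c z = 0"
    and z: "norm z < 1"
  shows "homog a \<beta> c n z = 0"
proof -
  have sums: "(\<lambda>n. homog a \<beta> c n z * t ^ n) sums 0" if "cmod t < 1" for t
  proof -
    have "cmod t * norm z < 1"
      using mult_strict_mono'[OF that z] by simp
    then have "norm (t *s z) < 1" by (simp only: norm_vector_scale)
    from homog_sums_pser[OF a this c, of \<beta>] zero[OF this] show ?thesis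
      by (simp add: homog_scale)
  qed
  \<comment> \<open>A nonzero coefficient of positive index would make the zero at t = 0 isolated;
    the constant coefficient is read off at t = 0 instead.\<close>
  show ?thesis
  proof (cases "n = 0")
    case True
    have "(\<lambda>n. homog a \<beta> c n z * 0 ^ n) sums homog a \<beta> c 0 z"
      using powser_sums_zero[of "\<lambda>n. homog a \<beta> c n z"] .
    with sums[of 0] True show ?thesis by (auto dest: sums_unique2)
  next
    case False
    show ?thesis
    proof (rule ccontr)
      assume "homog a \<beta> c n z \<noteq> 0"
      then obtain s where s: "0 < s" "\<And>t. t \<in> cball (0::complex) s - {0} \<Longrightarrow> (\<lambda>_. 0::complex) t \<noteq> 0"
        using powser_0_nonzero[of 1 0 "\<lambda>n. homog a \<beta> c n z" "\<lambda>_. 0" n] sums False by auto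
      then show False using s(2)[of "of_real s"] by auto
    qed
  qed
qed

text \<open>The homogeneous part of degree n is sampled on a grid of scaled roots of unity, and a
  multidimensional discrete Fourier transform isolates the coefficient at \<gamma>.\<close>

lemma pser_eq_0_imp:
  fixes c :: "('n::finite \<Rightarrow> nat) \<Rightarrow> complex"
  assumes a: "a > 0" and c: "c \<in> l2 UNIV" and zero: "\<And>z. norm z < 1 \<Longrightarrow> pser a \<beta> c z = 0"
  shows "c = 0"
proof
  fix \<gamma> :: "'n \<Rightarrow> nat"
  define n where "n = msize \<gamma>"
  \<comment> \<open>Exponents in degree n are at most n, so n + 1 samples per coordinate prevent
    aliasing.\<close>
  define N where "N = Suc n"
  \<comment> \<open>Small enough to put the whole grid into the open ball: d r^2 < 1 for d
    coordinates.\<close>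
  define r :: real where "r = 1 / (1 + real CARD('n))"
  define W :: "('n \<Rightarrow> nat) \<Rightarrow> complex ^ 'n" where
    "W m = (\<chi> j. complex_of_real r * unit_root N (m j))" for m
  have r: "r > 0" by (simp add: r_def)
  have "norm (W m) < 1" for m
  proof -
    have "(norm (W m))\<^sup>2 = real CARD('n) * r\<^sup>2"
      using r by (simp add: norm_sq_eq_sum W_def norm_mult)
    also have "\<dots> < 1"
    proof -
      have "real CARD('n) < (1 + real CARD('n))\<^sup>2"
        by (simp add: power2_eq_square algebra_simps add_pos_nonneg)
      then show ?thesis by (simp add: r_def power_divide)
    qed
    finally show ?thesis by (simp add: abs_square_less_1)
  qed
  then have W0: "homog a \<beta> c n (W m) = 0" for m
    by (intro homog_eq_0[OF a c zero])
  let ?M = "PiE (UNIV :: 'n set) (\<lambda>_. {..<N})"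
  let ?d = "\<lambda>\<alpha>. c \<alpha> * complex_of_real (sqrt (wt a \<beta> \<alpha>))"
  have le: "\<alpha> j < N" if "msize \<alpha> = n" for \<alpha> :: "'n \<Rightarrow> nat" and j
    using member_le_sum[of j UNIV \<alpha>] that by (simp add: msize_def N_def)
  have inner: "(\<Sum>m\<in>?M. \<Prod>j\<in>UNIV. unit_root N (m j) ^ \<alpha> j * cnj (unit_root N (m j) ^ \<gamma> j)) =
      (if \<alpha> = \<gamma> then of_nat N ^ CARD('n) else 0)" if \<alpha>: "msize \<alpha> = n" for \<alpha>
  proof -
    have "(\<Sum>m\<in>?M. \<Prod>j\<in>UNIV. unit_root N (m j) ^ \<alpha> j * cnj (unit_root N (m j) ^ \<gamma> j)) =
        (\<Prod>j\<in>UNIV. \<Sum>m<N. unit_root N m ^ \<alpha> j * cnj (unit_root N m ^ \<gamma> j))"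
      by (rule prod_sum_PiE[symmetric]) auto
    also have "\<dots> = (\<Prod>j\<in>UNIV. if \<alpha> j = \<gamma> j then of_nat N else 0)"
    proof (rule prod.cong[OF refl])
      fix j
      have "\<gamma> j < N" by (rule le) (simp add: n_def)
      from unit_root_orthogonal[OF le[OF \<alpha>] this]
      show "(\<Sum>m<N. unit_root N m ^ \<alpha> j * cnj (unit_root N m ^ \<gamma> j)) =
          (if \<alpha> j = \<gamma> j then of_nat N else 0)"
        by (simp only: unit_root_power_swap[of N _ "\<alpha> j"] unit_root_power_swap[of N _ "\<gamma> j"])
    qed
    also have "\<dots> = (if \<alpha> = \<gamma> then of_nat N ^ CARD('n) else 0)"
      by (cases "\<alpha> = \<gamma>") (auto simp: fun_eq_iff)
    finally show ?thesis .
  qed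
  have mW: "mpow (W m) \<alpha> = complex_of_real r ^ n * (\<Prod>j\<in>UNIV. unit_root N (m j) ^ \<alpha> j)"
    if "msize \<alpha> = n" for \<alpha> m
    using that by (simp add: mpow_def W_def power_mult_distrib prod.distrib power_sum[symmetric] msize_def)
  have "0 = (\<Sum>m\<in>?M. homog a \<beta> c n (W m) * (\<Prod>j\<in>UNIV. cnj (unit_root N (m j) ^ \<gamma> j)))"
    by (simp add: W0)
  also have "\<dots> = (\<Sum>m\<in>?M. \<Sum>\<alpha> | msize \<alpha> = n. complex_of_real r ^ n * ?d \<alpha> *
      (\<Prod>j\<in>UNIV. unit_root N (m j) ^ \<alpha> j * cnj (unit_root N (m j) ^ \<gamma> j)))"
    unfolding homog_def sum_distrib_right
  proof (intro sum.cong refl)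
    fix m \<alpha> assume "\<alpha> \<in> {\<alpha> :: 'n \<Rightarrow> nat. msize \<alpha> = n}"
    then show "c \<alpha> * (complex_of_real (sqrt (wt a \<beta> \<alpha>)) * mpow (W m) \<alpha>) *
         (\<Prod>j\<in>UNIV. cnj (unit_root N (m j) ^ \<gamma> j)) = complex_of_real r ^ n * ?d \<alpha> *
      (\<Prod>j\<in>UNIV. unit_root N (m j) ^ \<alpha> j * cnj (unit_root N (m j) ^ \<gamma> j))"
      unfolding prod.distrib by (simp only: mW mem_Collect_eq mult_ac)
  qed
  also have "\<dots> = (\<Sum>\<alpha> | msize \<alpha> = n. complex_of_real r ^ n * ?d \<alpha> *
      (if \<alpha> = \<gamma> then of_nat N ^ CARD('n) else 0))"
    unfolding sum.swap[of _ _ ?M] sum_distrib_left[symmetric]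
    by (intro sum.cong refl) (simp only: inner mem_Collect_eq)
  also have "\<dots> = complex_of_real r ^ n * ?d \<gamma> * of_nat N ^ CARD('n)"
    by (simp add: if_distrib[of "\<lambda>x. _ * x"] sum.delta[OF finite_msize] n_def cong: if_cong)
  finally have "complex_of_real r ^ n * ?d \<gamma> * of_nat N ^ CARD('n) = 0" by simp
  moreover have "of_nat N \<noteq> (0 :: complex)" by (simp add: N_def del: of_nat_Suc)
  ultimately show "c \<gamma> = 0 \<gamma>"
    using r wt_pos[OF a, of \<beta> \<gamma>] by simp
qed


section \<open>Holomorphy\<close>

lemma holomorphic_on_ball_const [simp]: "holomorphic_on_ball (\<lambda>_. c)"
  unfolding holomorphic_on_ball_def by (auto intro!: exI[of _ "\<lambda>_. 0"])

lemma holomorphic_on_ball_coord: "holomorphic_on_ball (\<lambda>z. z $ j)"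
  unfolding holomorphic_on_ball_def
  by (auto intro!: exI[of _ "\<lambda>h. h $ j"] bounded_linear_imp_has_derivative bounded_linear_vec_nth)

lemma holomorphic_on_ball_add:
  assumes "holomorphic_on_ball f" "holomorphic_on_ball g"
  shows "holomorphic_on_ball (\<lambda>z. f z + g z)"
  unfolding holomorphic_on_ball_def
proof
  fix z :: "complex ^ 'a" assume "z \<in> ball 0 1"
  with assms obtain D1 D2 where "(f has_derivative D1) (at z)" "(g has_derivative D2) (at z)"
    "\<And>c v. D1 (c *s v) = c * D1 v" "\<And>c v. D2 (c *s v) = c * D2 v"
    unfolding holomorphic_on_ball_def by metis
  then show "\<exists>D. ((\<lambda>z. f z + g z) has_derivative D) (at z) \<and> (\<forall>c v. D (c *s v) = c * D v)"
    by (intro exI[of _ "\<lambda>h. D1 h + D2 h"]) (auto intro: has_derivative_add simp: algebra_simps)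
qed

lemma holomorphic_on_ball_mult:
  assumes "holomorphic_on_ball f" "holomorphic_on_ball g"
  shows "holomorphic_on_ball (\<lambda>z. f z * g z)"
  unfolding holomorphic_on_ball_def
proof
  fix z :: "complex ^ 'a" assume "z \<in> ball 0 1"
  with assms obtain D1 D2 where "(f has_derivative D1) (at z)" "(g has_derivative D2) (at z)"
    "\<And>c v. D1 (c *s v) = c * D1 v" "\<And>c v. D2 (c *s v) = c * D2 v"
    unfolding holomorphic_on_ball_def by metis
  then show "\<exists>D. ((\<lambda>z. f z * g z) has_derivative D) (at z) \<and> (\<forall>c v. D (c *s v) = c * D v)"
    by (intro exI[of _ "\<lambda>h. f z * D2 h + D1 h * g z"] conjI has_derivative_mult)
       (auto simp: algebra_simps)
qed

lemma holomorphic_on_ball_sum: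
  "(\<And>i. i \<in> A \<Longrightarrow> holomorphic_on_ball (f i)) \<Longrightarrow> holomorphic_on_ball (\<lambda>z. \<Sum>i\<in>A. f i z)"
  by (induction A rule: infinite_finite_induct) (simp_all add: holomorphic_on_ball_add)

lemma holomorphic_on_ball_prod:
  "(\<And>i. i \<in> A \<Longrightarrow> holomorphic_on_ball (f i)) \<Longrightarrow> holomorphic_on_ball (\<lambda>z. \<Prod>i\<in>A. f i z)"
  by (induction A rule: infinite_finite_induct) (simp_all add: holomorphic_on_ball_mult)

lemma holomorphic_on_ball_power: "holomorphic_on_ball f \<Longrightarrow> holomorphic_on_ball (\<lambda>z. f z ^ n)"
  by (induction n) (simp_all add: holomorphic_on_ball_mult)

lemma holomorphic_on_ball_homog: "holomorphic_on_ball (homog a \<beta> c n)"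
  unfolding homog_def[abs_def] mpow_def
  by (intro holomorphic_on_ball_sum holomorphic_on_ball_mult holomorphic_on_ball_const
      holomorphic_on_ball_prod holomorphic_on_ball_power holomorphic_on_ball_coord)

text \<open>Cauchy's inequality on the complex line through \<open>z\<close> in direction \<open>h\<close>.\<close>

lemma directional_derivative_bound:
  fixes f :: "complex ^ 'n::finite \<Rightarrow> complex"
  assumes D: "\<And>z. norm z < 1 \<Longrightarrow> (f has_derivative D z) (at z)"
    and lin: "\<And>z c v. norm z < 1 \<Longrightarrow> D z (c *s v) = c * D z v"
    and bnd: "\<And>w. norm (w - z) \<le> \<rho> \<Longrightarrow> norm w < 1 \<and> cmod (f w) \<le> M"
    and \<rho>: "\<rho> > 0"
  shows "cmod (D z h) \<le> M * norm h / \<rho>"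
proof (cases "h = 0")
  case True
  have "norm z < 1" using bnd[of z] \<rho> by simp
  from lin[OF this, of 0 h] True show ?thesis by simp
next
  case False
  \<comment> \<open>As long as |t| is at most \<open>R\<close>, the point z + t h stays within
    \<rho> of z.\<close>
  define R where "R = \<rho> / norm h"
  have R: "R > 0" using False \<rho> by (simp add: R_def)
  let ?\<phi> = "\<lambda>t. f (z + t *s h)"
  have near: "norm (z + t *s h - z) \<le> \<rho>" if "cmod t \<le> R" for t
    using that False by (simp add: norm_vector_scale R_def pos_le_divide_eq)
  have deriv: "(?\<phi> has_field_derivative D (z + t *s h) h) (at t)" if "cmod t \<le> R" for t
  proof -
    have in1: "norm (z + t *s h) < 1" using bnd[OF near[OF that]] by blast
    have bl: "bounded_linear (\<lambda>s. s *s h)"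
      by (rule linear_conv_bounded_linear[THEN iffD1])
         (auto intro!: linearI simp: vec_eq_iff distrib_right)
    have "((\<lambda>t. z + t *s h) has_derivative (\<lambda>s. s *s h)) (at t)"
      using has_derivative_add[OF has_derivative_const bounded_linear_imp_has_derivative[OF bl]]
      by simp
    from has_derivative_compose[OF this D[OF in1]]
    have "(?\<phi> has_derivative (\<lambda>s. D (z + t *s h) (s *s h))) (at t)" .
    moreover have "(\<lambda>s. D (z + t *s h) (s *s h)) = (*) (D (z + t *s h) h)"
      by (simp add: fun_eq_iff lin[OF in1] mult.commute)
    ultimately show ?thesis by (simp add: has_field_derivative_def)
  qed
  have "norm ((deriv ^^ 1) ?\<phi> 0) \<le> fact 1 * M / R ^ 1"
  proof (rule Cauchy_inequality)
    show "?\<phi> holomorphic_on ball 0 R"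
      unfolding holomorphic_on_def field_differentiable_def
      by (auto intro!: exI has_field_derivative_at_within[OF deriv])
    show "continuous_on (cball 0 R) ?\<phi>"
      by (intro continuous_at_imp_continuous_on ballI DERIV_isCont[OF deriv]) auto
    show "cmod (?\<phi> t) \<le> M" if "norm (0 - t) = R" for t
      using bnd[OF near[of t]] that by simp
  qed (fact R)
  moreover have "deriv ?\<phi> 0 = D (z + 0 *s h) h"
    by (rule DERIV_imp_deriv[OF deriv]) (use R in simp)
  ultimately show ?thesis
    by (simp add: R_def)
qed

text \<open>Weierstrass' theorem on the ball: by Cauchy's inequality in every direction, local
  majorants of the terms also majorise their derivatives, so the series may be differentiated
  termwise.\<close>

lemma holomorphic_on_ball_suminf:
  fixes f :: "nat \<Rightarrow> complex ^ 'n::finite \<Rightarrow> complex"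
  assumes holo: "\<And>n. holomorphic_on_ball (f n)"
    and bnd: "\<And>r. 0 < r \<Longrightarrow> r < 1 \<Longrightarrow>
      \<exists>M. summable M \<and> (\<forall>n z. norm z \<le> r \<longrightarrow> cmod (f n z) \<le> M n)"
  shows "holomorphic_on_ball (\<lambda>z. \<Sum>n. f n z)"
proof -
  have "\<forall>n z. \<exists>D. norm z < 1 \<longrightarrow> (f n has_derivative D) (at z) \<and> (\<forall>c v. D (c *s v) = c * D v)"
    using holo unfolding holomorphic_on_ball_def by auto
  then obtain D where D: "\<And>n z. norm z < 1 \<Longrightarrow> (f n has_derivative D n z) (at z)"
    and lin: "\<And>n z c v. norm z < 1 \<Longrightarrow> D n z (c *s v) = c * D n z v"
    by metis
  show ?thesis
    unfolding holomorphic_on_ball_def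
  proof
    fix z0 :: "complex ^ 'n" assume "z0 \<in> ball 0 1"
    then have z0: "norm z0 < 1" by simp
    \<comment> \<open>One third of the distance to the sphere: a radius \<rho> for the neighbourhood
      of \<open>z0\<close> and another \<rho> for Cauchy's inequality still leave a ball of radius
      below 1.\<close>
    define \<rho> where "\<rho> = (1 - norm z0) / 3"
    have \<rho>: "\<rho> > 0" using z0 by (simp add: \<rho>_def)
    have r: "0 < norm z0 + 2 * \<rho>" "norm z0 + 2 * \<rho> < 1"
      using z0 \<rho> norm_ge_zero[of z0] by (simp_all add: \<rho>_def add_nonneg_pos field_simps)
    from bnd[OF r] obtain M where M: "summable M"
      and le: "\<And>n z. norm z \<le> norm z0 + 2 * \<rho> \<Longrightarrow> cmod (f n z) \<le> M n" by blast
    let ?S = "ball z0 \<rho>"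
    have S1: "norm z < 1" if "z \<in> ?S" for z
      using that r norm_triangle_ineq2[of z z0] \<rho> by (simp add: dist_norm norm_minus_commute)
    have Dle: "cmod (D n z h) \<le> M n * (norm h / \<rho>)" if "z \<in> ?S" for n z h
    proof -
      have "cmod (D n z h) \<le> M n * norm h / \<rho>"
      proof (rule directional_derivative_bound[OF D lin _ \<rho>])
        fix w assume "norm (w - z) \<le> \<rho>"
        moreover have "norm w \<le> norm z0 + norm (z - z0) + norm (w - z)"
          using norm_triangle_ineq[of "z0 + (z - z0)" "w - z"] norm_triangle_ineq[of z0 "z - z0"] by simp
        ultimately have "norm w \<le> norm z0 + 2 * \<rho>"
          using that by (simp add: dist_norm norm_minus_commute)
        then show "norm w < 1 \<and> cmod (f n w) \<le> M n"
          using le r by force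
      qed
      then show ?thesis by simp
    qed
    have summD: "summable (\<lambda>n. D n z h)" if "z \<in> ?S" for z h
      by (rule summable_comparison_test'[OF summable_mult2[OF M]]) (rule Dle[OF that])
    have ex: "\<exists>g. \<forall>z\<in>?S. (\<lambda>n. f n z) sums g z \<and>
        (g has_derivative (\<lambda>h. \<Sum>n. D n z h)) (at z within ?S)"
    proof (rule has_derivative_series)
      show "(f n has_derivative D n z) (at z within ?S)" if "z \<in> ?S" for n z
        by (rule has_derivative_at_withinI[OF D[OF S1[OF that]]])
      show "z0 \<in> ?S" using \<rho> by simp
      have "cmod (f n z0) \<le> M n" for n
        by (rule le) (use \<rho> in simp)
      then show "(\<lambda>n. f n z0) sums (\<Sum>n. f n z0)"
        by (intro summable_sums summable_comparison_test'[OF M]) 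
      show "\<forall>\<^sub>F n in sequentially. \<forall>z\<in>?S. \<forall>h.
          norm ((\<Sum>i<n. D i z h) - (\<Sum>n. D n z h)) \<le> e * norm h" if "e > 0" for e
      proof -
        have "e * \<rho> > 0" using \<rho> that by simp
        from suminf_exist_split[OF this M] obtain N where
          N: "\<And>n. n \<ge> N \<Longrightarrow> norm (\<Sum>i. M (i + n)) < e * \<rho>" by blast
        have "norm ((\<Sum>i<n. D i z h) - (\<Sum>n. D n z h)) \<le> e * norm h"
          if n: "n \<ge> N" and z: "z \<in> ?S" for n z h
        proof -
          have sM: "summable (\<lambda>i. M (i + n) * (norm h / \<rho>))"
            using summable_ignore_initial_segment[OF M] by (rule summable_mult2)
          have "norm ((\<Sum>i<n. D i z h) - (\<Sum>n. D n z h)) = norm (\<Sum>i. D (i + n) z h)"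
            by (simp add: suminf_minus_initial_segment[OF summD[OF z]] norm_minus_commute)
          also have "\<dots> \<le> (\<Sum>i. M (i + n) * (norm h / \<rho>))"
            by (rule norm_suminf_le) (use Dle[OF z] sM in auto)
          also have "\<dots> = (\<Sum>i. M (i + n)) * (norm h / \<rho>)"
            by (rule suminf_mult2[symmetric]) (rule summable_ignore_initial_segment[OF M])
          also have "\<dots> \<le> e * \<rho> * (norm h / \<rho>)"
            using N[OF n] \<rho> by (intro mult_right_mono) auto
          finally show ?thesis using \<rho> by simp
        qed
        then show ?thesis unfolding eventually_sequentially by blast
      qed
    qed simp
    then obtain g where g: "\<And>z. z \<in> ?S \<Longrightarrow> (\<lambda>n. f n z) sums g z"
      and gd: "\<And>z. z \<in> ?S \<Longrightarrow> (g has_derivative (\<lambda>h. \<Sum>n. D n z h)) (at z within ?S)" by blast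
    have z0S: "z0 \<in> ?S" using \<rho> by simp
    have "(g has_derivative (\<lambda>h. \<Sum>n. D n z0 h)) (at z0)"
      using gd[OF z0S] by (simp add: at_within_open[OF z0S])
    then have "((\<lambda>z. \<Sum>n. f n z) has_derivative (\<lambda>h. \<Sum>n. D n z0 h)) (at z0)"
      by (rule has_derivative_transform_within_open[OF _ open_ball z0S]) (simp add: g sums_unique)
    moreover have "(\<Sum>n. D n z0 (c *s v)) = c * (\<Sum>n. D n z0 v)" for c v
      by (simp add: lin[OF z0] suminf_mult[OF summD[OF z0S]])
    ultimately show "\<exists>D. ((\<lambda>z. \<Sum>n. f n z) has_derivative D) (at z0) \<and> (\<forall>c v. D (c *s v) = c * D v)"
      by blast
  qed
qed

lemma holomorphic_on_ball_cong:
  assumes "holomorphic_on_ball f" "\<And>z. norm z < 1 \<Longrightarrow> f z = g z"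
  shows "holomorphic_on_ball g"
  unfolding holomorphic_on_ball_def
proof
  fix z :: "complex ^ 'a" assume z: "z \<in> ball 0 1"
  with assms(1) obtain D where "(f has_derivative D) (at z)" "\<forall>c v. D (c *s v) = c * D v"
    unfolding holomorphic_on_ball_def by blast
  then show "\<exists>D. (g has_derivative D) (at z) \<and> (\<forall>c v. D (c *s v) = c * D v)"
    using has_derivative_transform_within_open[OF _ open_ball z, of f D UNIV g] assms(2) by auto
qed

text \<open>The inequality x y \<le> (x^2 + y^2) / 2 separates coefficients from points: one half is
  summable since \<open>c\<close> is square-summable, the other is dominated for |z| \<le> r by the
  growth series at r^2.\<close>

lemma holomorphic_on_ball_pser:
  fixes c :: "('n::finite \<Rightarrow> nat) \<Rightarrow> complex"
  assumes a: "a > 0" and c: "c \<in> l2 UNIV"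
  shows "holomorphic_on_ball (pser a \<beta> c)"
proof -
  have "holomorphic_on_ball (\<lambda>z. \<Sum>n. homog a \<beta> c n z)"
  proof (rule holomorphic_on_ball_suminf[OF holomorphic_on_ball_homog])
    fix r :: real assume r: "0 < r" "r < 1"
    let ?C = "\<lambda>n. \<Sum>\<alpha> | msize \<alpha> = n. (cmod (c \<alpha>))\<^sup>2"
    let ?M = "\<lambda>n. (?C n + growth a \<beta> n * (r\<^sup>2) ^ n) / 2"
    have "summable ?C"
      using sums_by_msize[of "\<lambda>\<alpha>. (cmod (c \<alpha>))\<^sup>2"] c by (auto simp: l2_def sums_iff)
    moreover have "summable (\<lambda>n. growth a \<beta> n * (r\<^sup>2) ^ n)"
      using r by (intro summable_growth) (auto simp: abs_square_less_1)
    ultimately have "summable ?M" by (intro summable_divide summable_add)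
    moreover have "cmod (homog a \<beta> c n z) \<le> ?M n" if "norm z \<le> r" for n z
    proof -
      have le: "cmod (c \<alpha> * (complex_of_real (sqrt (wt a \<beta> \<alpha>)) * mpow z \<alpha>)) \<le>
          ((cmod (c \<alpha>))\<^sup>2 + wt a \<beta> \<alpha> * (cmod (mpow z \<alpha>))\<^sup>2) / 2" for \<alpha>
      proof -
        have w: "cmod (complex_of_real (sqrt (wt a \<beta> \<alpha>)) * mpow z \<alpha>) = cmod (kvec a \<beta> z \<alpha>)"
          by (simp add: kvec_def del: complex_cnj_mult)
        show ?thesis
          using sum_squares_bound[of "cmod (c \<alpha>)" "cmod (kvec a \<beta> z \<alpha>)"]
          unfolding norm_mult[of "c \<alpha>"] w cmod_kvec_sq[OF a, symmetric] by simp
      qed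
      have "cmod (homog a \<beta> c n z) \<le>
          (\<Sum>\<alpha> | msize \<alpha> = n. ((cmod (c \<alpha>))\<^sup>2 + wt a \<beta> \<alpha> * (cmod (mpow z \<alpha>))\<^sup>2) / 2)"
        unfolding homog_def by (rule order_trans[OF norm_sum sum_mono[OF le]])
      also have "\<dots> = (?C n + (\<Sum>\<alpha> | msize \<alpha> = n. wt a \<beta> \<alpha> * (cmod (mpow z \<alpha>))\<^sup>2)) / 2"
        by (simp add: sum.distrib flip: sum_divide_distrib)
      also have "\<dots> \<le> (?C n + growth a \<beta> n * ((norm z)\<^sup>2) ^ n) / 2"
        using wt_mpow_le[OF a, where z = z] by (intro divide_right_mono add_left_mono) auto
      also have "\<dots> \<le> ?M n"
        using that by (intro divide_right_mono add_left_mono mult_left_mono power_mono growth_nonneg) auto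
      finally show ?thesis .
    qed
    ultimately show "\<exists>M. summable M \<and> (\<forall>n z. norm z \<le> r \<longrightarrow> cmod (homog a \<beta> c n z) \<le> M n)"
      by blast
  qed
  then show ?thesis
    by (rule holomorphic_on_ball_cong) (use homog_sums_pser[OF a _ c] in \<open>simp add: sums_iff\<close>)
qed


section \<open>A concrete model of the module\<close>

lemma pser_add:
  "a > 0 \<Longrightarrow> norm z < 1 \<Longrightarrow> c \<in> l2 UNIV \<Longrightarrow> d \<in> l2 UNIV \<Longrightarrow>
   pser a \<beta> (c + d) z = pser a \<beta> c z + pser a \<beta> d z"
  by (simp add: pser_def l2_inner_add_left kvec_l2)

lemma pser_diff:
  "a > 0 \<Longrightarrow> norm z < 1 \<Longrightarrow> c \<in> l2 UNIV \<Longrightarrow> d \<in> l2 UNIV \<Longrightarrow>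
   pser a \<beta> (c - d) z = pser a \<beta> c z - pser a \<beta> d z"
  by (simp add: pser_def l2_inner_diff_left kvec_l2)

lemma pser_scale: "pser a \<beta> (\<lambda>\<alpha>. s * c \<alpha>) z = s * pser a \<beta> c z"
  by (simp add: pser_def l2_inner_scale_left)

text \<open>Components from N on are set to 0, so that a family is determined by its first N
  components and synthesis can be injective.\<close>

definition coeff_seqs :: "nat \<Rightarrow> (nat \<Rightarrow> ('n::finite \<Rightarrow> nat) \<Rightarrow> complex) set" where
  "coeff_seqs N = {c. (\<forall>b<N. c b \<in> l2 UNIV) \<and> (\<forall>b\<ge>N. c b = 0)}"

definition coeffs_inner ::
  "nat \<Rightarrow> (nat \<Rightarrow> ('n::finite \<Rightarrow> nat) \<Rightarrow> complex) \<Rightarrow> (nat \<Rightarrow> ('n \<Rightarrow> nat) \<Rightarrow> complex) \<Rightarrow> complex" where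
  "coeffs_inner N c d = (\<Sum>b<N. l2_inner UNIV (c b) (d b))"

definition synth ::
  "nat \<Rightarrow> nat \<Rightarrow> (nat \<Rightarrow> 'n::finite \<Rightarrow> nat) \<Rightarrow> (nat \<Rightarrow> 'v \<Rightarrow> complex) \<Rightarrow>
   (nat \<Rightarrow> ('n \<Rightarrow> nat) \<Rightarrow> complex) \<Rightarrow> (complex ^ 'n \<Rightarrow> 'v \<Rightarrow> complex)" where
  "synth a N \<beta> e c = (\<lambda>z. if norm z < 1 then (\<lambda>v. \<Sum>b<N. pser a (\<beta> b) (c b) z * e b v) else 0)"

definition analysis ::
  "nat \<Rightarrow> nat \<Rightarrow> (nat \<Rightarrow> 'n::finite \<Rightarrow> nat) \<Rightarrow> (nat \<Rightarrow> 'v \<Rightarrow> complex) \<Rightarrow>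
   (complex ^ 'n \<Rightarrow> 'v \<Rightarrow> complex) \<Rightarrow> (nat \<Rightarrow> ('n \<Rightarrow> nat) \<Rightarrow> complex)" where
  "analysis a N \<beta> e = inv_into (coeff_seqs N) (synth a N \<beta> e)"

text \<open>The inner product is transported from the coefficient side, which is sound because
  synthesis from an orthonormal family turns out to be injective.\<close>

definition model ::
  "nat \<Rightarrow> nat \<Rightarrow> (nat \<Rightarrow> 'n::finite \<Rightarrow> nat) \<Rightarrow> (nat \<Rightarrow> 'v \<Rightarrow> complex) \<Rightarrow> (complex ^ 'n, 'v) hspace" where
  "model a N \<beta> e = \<lparr>hcarrier = synth a N \<beta> e ` coeff_seqs N,
     hinner = (\<lambda>f g. coeffs_inner N (analysis a N \<beta> e f) (analysis a N \<beta> e g))\<rparr>"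

definition coeffs_scale ::
  "complex \<Rightarrow> (nat \<Rightarrow> ('n::finite \<Rightarrow> nat) \<Rightarrow> complex) \<Rightarrow> (nat \<Rightarrow> ('n \<Rightarrow> nat) \<Rightarrow> complex)" where
  "coeffs_scale s c = (\<lambda>b \<alpha>. s * c b \<alpha>)"

definition coeffs_shift ::
  "nat \<Rightarrow> nat \<Rightarrow> (nat \<Rightarrow> 'n::finite \<Rightarrow> nat) \<Rightarrow> 'n \<Rightarrow>
   (nat \<Rightarrow> ('n \<Rightarrow> nat) \<Rightarrow> complex) \<Rightarrow> (nat \<Rightarrow> ('n \<Rightarrow> nat) \<Rightarrow> complex)" where
  "coeffs_shift a N \<beta> k c = (\<lambda>b. if b < N then shift_coeffs a (\<beta> b) k (c b) else 0)"

lemma coeff_seqs_zero: "0 \<in> coeff_seqs N"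
  by (simp add: coeff_seqs_def)

lemma coeff_seqs_add: "c \<in> coeff_seqs N \<Longrightarrow> d \<in> coeff_seqs N \<Longrightarrow> c + d \<in> coeff_seqs N"
  by (simp add: coeff_seqs_def l2_add)

lemma coeff_seqs_diff: "c \<in> coeff_seqs N \<Longrightarrow> d \<in> coeff_seqs N \<Longrightarrow> c - d \<in> coeff_seqs N"
  by (simp add: coeff_seqs_def l2_diff)

lemma coeff_seqs_scale: "c \<in> coeff_seqs N \<Longrightarrow> coeffs_scale s c \<in> coeff_seqs N"
  by (simp add: coeff_seqs_def coeffs_scale_def l2_scale) (simp add: fun_eq_iff)

lemma coeff_seqs_shift: "a > 0 \<Longrightarrow> c \<in> coeff_seqs N \<Longrightarrow> coeffs_shift a N \<beta> k c \<in> coeff_seqs N"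
  by (simp add: coeff_seqs_def coeffs_shift_def shift_coeffs_l2)

lemma coeffs_inner_self:
  "coeffs_inner N c c = complex_of_real (\<Sum>b<N. \<Sum>\<^sub>\<infinity>\<alpha>. (cmod (c b \<alpha>))\<^sup>2)"
  by (simp add: coeffs_inner_def l2_inner_self)

text \<open>The common finite support \<open>S\<close> turns every pairing with a basis vector into
  a finite sum, whatever the other argument.\<close>

locale model_frame =
  fixes a N :: nat and \<beta> :: "nat \<Rightarrow> 'n::finite \<Rightarrow> nat" and V S :: "'v set"
    and e :: "nat \<Rightarrow> 'v \<Rightarrow> complex"
  assumes a: "a > 0" and fin: "finite S" and sub: "S \<subseteq> V"
    and supp: "\<And>b v. b < N \<Longrightarrow> v \<notin> S \<Longrightarrow> e b v = 0"
    and ortho: "\<And>b b'. b < N \<Longrightarrow> b' < N \<Longrightarrow> l2_inner V (e b) (e b') = (if b = b' then 1 else 0)"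
begin

abbreviation "syn \<equiv> synth a N \<beta> e"
abbreviation "ana \<equiv> analysis a N \<beta> e"
abbreviation "H \<equiv> model a N \<beta> e"

lemma comb_inner:
  "l2_inner V (\<lambda>v. \<Sum>b<N. p b * e b v) x = (\<Sum>b<N. p b * l2_inner V (e b) x)"
proof -
  have left: "l2_inner V f x = (\<Sum>v\<in>S. f v * cnj (x v))" if "\<And>v. v \<notin> S \<Longrightarrow> f v = 0" for f
    using l2_inner_finite_support[OF fin sub, of f x] that
    by (subst l2_inner_cnj) (simp add: mult.commute)
  have "l2_inner V (\<lambda>v. \<Sum>b<N. p b * e b v) x = (\<Sum>v\<in>S. \<Sum>b<N. p b * (e b v * cnj (x v)))"
    using supp by (subst left) (simp_all add: sum_distrib_right mult.assoc)
  also have "\<dots> = (\<Sum>b<N. p b * l2_inner V (e b) x)"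
    unfolding sum.swap[of _ _ S] by (simp add: left supp sum_distrib_left)
  finally show ?thesis .
qed

lemma synth_inner:
  "norm z < 1 \<Longrightarrow> l2_inner V (syn c z) x = (\<Sum>b<N. pser a (\<beta> b) (c b) z * l2_inner V (e b) x)"
  by (simp add: synth_def comb_inner)

lemma synth_coord: "norm z < 1 \<Longrightarrow> b < N \<Longrightarrow> l2_inner V (syn c z) (e b) = pser a (\<beta> b) (c b) z"
  by (simp add: synth_inner ortho if_distrib[of "\<lambda>x. _ * x"] cong: if_cong)

lemma synth_add: "c \<in> coeff_seqs N \<Longrightarrow> d \<in> coeff_seqs N \<Longrightarrow> syn (c + d) = syn c + syn d"
  by (auto simp: synth_def fun_eq_iff coeff_seqs_def pser_add[OF a] distrib_right sum.distrib)

lemma synth_diff: "c \<in> coeff_seqs N \<Longrightarrow> d \<in> coeff_seqs N \<Longrightarrow> syn (c - d) = syn c - syn d"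
  by (auto simp: synth_def fun_eq_iff coeff_seqs_def pser_diff[OF a] left_diff_distrib sum_subtractf)

lemma synth_scale: "syn (coeffs_scale s c) = cscale s (syn c)"
  by (auto simp: synth_def cscale_def coeffs_scale_def fun_eq_iff pser_scale sum_distrib_left mult.assoc)

lemma synth_zero: "syn 0 = 0"
  using synth_scale[of 0 0] by (simp add: coeffs_scale_def cscale_def zero_fun_def)

lemma synth_shift: "c \<in> coeff_seqs N \<Longrightarrow> syn (coeffs_shift a N \<beta> k c) = mult_coord k (syn c)"
  by (auto simp: synth_def mult_coord_def coeffs_shift_def coeff_seqs_def fun_eq_iff pser_shift_coeffs[OF a]
      sum_distrib_left mult.assoc)

text \<open>Pairing with \<open>e b\<close> recovers the scalar power series of component b, and
  that series determines its coefficients.\<close>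

lemma synth_inj: "inj_on syn (coeff_seqs N)"
proof (rule inj_onI)
  fix c d assume c: "c \<in> coeff_seqs N" and d: "d \<in> coeff_seqs N" and eq: "syn c = syn d"
  have "c b = d b" for b
  proof (cases "b < N")
    case True
    then have l2: "c b \<in> l2 UNIV" "d b \<in> l2 UNIV" using c d by (auto simp: coeff_seqs_def)
    have "c b - d b = 0"
    proof (rule pser_eq_0_imp[OF a l2_diff[OF l2]])
      fix z :: "complex ^ 'n" assume z: "norm z < 1"
      show "pser a (\<beta> b) (c b - d b) z = 0"
        using synth_coord[OF z True, of c] synth_coord[OF z True, of d] eq
        by (simp add: pser_diff[OF a z l2])
    qed
    then show ?thesis by simp
  next
    case False
    with c d show ?thesis by (simp add: coeff_seqs_def)
  qed
  then show "c = d" by blast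
qed

lemma ana_syn [simp]: "c \<in> coeff_seqs N \<Longrightarrow> ana (syn c) = c"
  by (simp add: analysis_def synth_inj)

lemma carrier: "hcarrier H = syn ` coeff_seqs N"
  by (simp add: model_def)

lemma inner_syn:
  "c \<in> coeff_seqs N \<Longrightarrow> d \<in> coeff_seqs N \<Longrightarrow> hinner H (syn c) (syn d) = coeffs_inner N c d"
  by (simp add: model_def)

lemma hnorm_syn:
  "c \<in> coeff_seqs N \<Longrightarrow> hnorm H (syn c) = sqrt (\<Sum>b<N. \<Sum>\<^sub>\<infinity>\<alpha>. (cmod (c b \<alpha>))\<^sup>2)"
  by (simp add: hnorm_def inner_syn coeffs_inner_self)

lemma model_complete:
  assumes X: "\<And>n::nat. X n \<in> hcarrier H"
    and cauchy: "\<And>\<epsilon>. \<epsilon> > 0 \<Longrightarrow> \<exists>M. \<forall>m\<ge>M. \<forall>n\<ge>M. hnorm H (X m - X n) < \<epsilon>"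
  shows "\<exists>f\<in>hcarrier H. (\<lambda>n. hnorm H (X n - f)) \<longlonglongrightarrow> 0"
proof -
  from X have "\<forall>n. \<exists>c\<in>coeff_seqs N. X n = syn c" by (auto simp: carrier)
  then obtain c where c: "\<And>n. c n \<in> coeff_seqs N" and Xc: "\<And>n. X n = syn (c n)" by metis
  have hn: "hnorm H (X m - syn d) = sqrt (\<Sum>b<N. \<Sum>\<^sub>\<infinity>\<alpha>. (cmod (c m b \<alpha> - d b \<alpha>))\<^sup>2)"
    if "d \<in> coeff_seqs N" for m d
    using hnorm_syn[OF coeff_seqs_diff[OF c that], of m] by (simp add: Xc synth_diff[OF c that])
  have "\<exists>f\<in>l2 UNIV. (\<lambda>n. \<Sum>\<^sub>\<infinity>\<alpha>. (cmod (c n b \<alpha> - f \<alpha>))\<^sup>2) \<longlonglongrightarrow> 0" if b: "b < N" for b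
  proof (rule l2_complete)
    show "c n b \<in> l2 UNIV" for n using c[of n] b by (simp add: coeff_seqs_def)
    fix \<epsilon> :: real assume "\<epsilon> > 0"
    then have "sqrt \<epsilon> > 0" by simp
    from cauchy[OF this] obtain M where
      M: "\<And>m n. m \<ge> M \<Longrightarrow> n \<ge> M \<Longrightarrow> hnorm H (X m - X n) < sqrt \<epsilon>" by blast
    have "(\<Sum>\<^sub>\<infinity>\<alpha>. (cmod (c m b \<alpha> - c n b \<alpha>))\<^sup>2) < \<epsilon>" if "m \<ge> M" "n \<ge> M" for m n
    proof -
      have "(\<Sum>\<^sub>\<infinity>\<alpha>. (cmod (c m b \<alpha> - c n b \<alpha>))\<^sup>2) \<le>
          (\<Sum>b<N. \<Sum>\<^sub>\<infinity>\<alpha>. (cmod (c m b \<alpha> - c n b \<alpha>))\<^sup>2)"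
        using b by (intro member_le_sum infsum_nonneg) auto
      also have "\<dots> < \<epsilon>"
        using M[OF that] hn[OF c] by (simp add: Xc)
      finally show ?thesis .
    qed
    then show "\<exists>M. \<forall>m\<ge>M. \<forall>n\<ge>M. (\<Sum>\<^sub>\<infinity>\<alpha>. (cmod (c m b \<alpha> - c n b \<alpha>))\<^sup>2) < \<epsilon>" by blast
  qed
  then have "\<forall>b. \<exists>f. b < N \<longrightarrow> f \<in> l2 UNIV \<and> (\<lambda>n. \<Sum>\<^sub>\<infinity>\<alpha>. (cmod (c n b \<alpha> - f \<alpha>))\<^sup>2) \<longlonglongrightarrow> 0"
    by blast
  from choice[OF this] obtain f where f: "\<And>b. b < N \<Longrightarrow> f b \<in> l2 UNIV"
    "\<And>b. b < N \<Longrightarrow> (\<lambda>n. \<Sum>\<^sub>\<infinity>\<alpha>. (cmod (c n b \<alpha> - f b \<alpha>))\<^sup>2) \<longlonglongrightarrow> 0" by blast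
  define d where "d b = (if b < N then f b else 0)" for b
  have d: "d \<in> coeff_seqs N" using f by (simp add: coeff_seqs_def d_def)
  have "(\<lambda>n. \<Sum>b<N. \<Sum>\<^sub>\<infinity>\<alpha>. (cmod (c n b \<alpha> - d b \<alpha>))\<^sup>2) \<longlonglongrightarrow> 0"
    by (intro tendsto_null_sum) (simp add: d_def f)
  then have "(\<lambda>n. hnorm H (X n - syn d)) \<longlonglongrightarrow> sqrt 0"
    unfolding hn[OF d] by (rule tendsto_real_sqrt)
  with d show ?thesis by (auto simp: carrier)
qed

lemma model_hilbert: "complex_hilbert_space H"
proof -
  interpret M: module "cscale :: complex \<Rightarrow> (complex ^ 'n \<Rightarrow> 'v \<Rightarrow> complex) \<Rightarrow> _"
    by unfold_locales (simp_all add: cscale_def fun_eq_iff algebra_simps)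
  have l2: "c b \<in> l2 UNIV" if "c \<in> coeff_seqs N" "b < N" for c :: "nat \<Rightarrow> ('n \<Rightarrow> nat) \<Rightarrow> complex" and b
    using that by (simp add: coeff_seqs_def)
  show ?thesis
    unfolding complex_hilbert_space_def
  proof (intro conjI)
    show "M.subspace (hcarrier H)"
      unfolding M.subspace_def carrier
    proof (intro conjI ballI allI)
      show "0 \<in> syn ` coeff_seqs N"
        using synth_zero coeff_seqs_zero by (metis image_eqI)
      show "f + g \<in> syn ` coeff_seqs N" if "f \<in> syn ` coeff_seqs N" "g \<in> syn ` coeff_seqs N" for f g
        using that by (auto simp: synth_add[symmetric] intro: coeff_seqs_add)
      show "cscale s f \<in> syn ` coeff_seqs N" if "f \<in> syn ` coeff_seqs N" for s f
        using that by (auto simp: synth_scale[symmetric] intro: coeff_seqs_scale)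
    qed
    show "\<forall>f\<in>hcarrier H. \<forall>g\<in>hcarrier H. \<forall>h\<in>hcarrier H.
        hinner H (f + g) h = hinner H f h + hinner H g h"
      by (auto simp: carrier synth_add[symmetric] inner_syn coeff_seqs_add coeffs_inner_def
          l2_inner_add_left l2 sum.distrib)
    show "\<forall>s. \<forall>f\<in>hcarrier H. \<forall>g\<in>hcarrier H. hinner H (cscale s f) g = s * hinner H f g"
      by (auto simp: carrier synth_scale[symmetric] inner_syn coeff_seqs_scale coeffs_inner_def
          sum_distrib_left) (simp add: coeffs_scale_def l2_inner_scale_left)
    show "\<forall>f\<in>hcarrier H. \<forall>g\<in>hcarrier H. hinner H g f = cnj (hinner H f g)"
      by (auto simp: carrier inner_syn coeffs_inner_def l2_inner_cnj[symmetric])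
    show "\<forall>f\<in>hcarrier H. f \<noteq> 0 \<longrightarrow> 0 < Re (hinner H f f)"
    proof (intro ballI impI)
      fix f assume f: "f \<in> hcarrier H" "f \<noteq> 0"
      then obtain c where c: "c \<in> coeff_seqs N" "f = syn c" by (auto simp: carrier)
      have "c \<noteq> 0" using f c synth_zero by auto
      then obtain b where b: "c b \<noteq> 0" by (auto simp: fun_eq_iff)
      with c have "b < N" unfolding coeff_seqs_def by (metis (mono_tags, lifting) mem_Collect_eq not_le)
      have "0 < (\<Sum>b<N. Re (l2_inner UNIV (c b) (c b)))"
      proof (rule sum_pos2)
        show "0 < Re (l2_inner UNIV (c b) (c b))"
          by (rule l2_inner_self_pos) (use b l2 c \<open>b < N\<close> in auto)
        show "0 \<le> Re (l2_inner UNIV (c i) (c i))" for i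
          by (simp add: l2_inner_self infsum_nonneg)
      qed (use \<open>b < N\<close> in auto)
      then show "0 < Re (hinner H f f)"
        using c by (simp add: inner_syn coeffs_inner_def)
    qed
    show "\<forall>X. (\<forall>n::nat. X n \<in> hcarrier H) \<and>
          (\<forall>\<epsilon>>0. \<exists>N. \<forall>m\<ge>N. \<forall>n\<ge>N. hnorm H (X m - X n) < \<epsilon>) \<longrightarrow>
          (\<exists>f\<in>hcarrier H. (\<lambda>n. hnorm H (X n - f)) \<longlonglongrightarrow> 0)"
      using model_complete by blast
  qed
qed

lemma model_rkhs:
  assumes E: "\<And>p. (\<lambda>v. \<Sum>b<N. p b * e b v) \<in> E"
    and K: "\<And>z w x. norm z < 1 \<Longrightarrow> norm w < 1 \<Longrightarrow> x \<in> E \<Longrightarrow> K z w x =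
      (\<lambda>v. \<Sum>b<N. kcoeff (real a) (\<beta> b) z w * (l2_inner V x (e b) * e b v))"
  shows "is_rkhs (ball 0 1) E (l2_inner V) K H"
  unfolding is_rkhs_def
proof (intro conjI ballI model_hilbert allI impI)
  fix f assume "f \<in> hcarrier H"
  then obtain c where c: "f = syn c" by (auto simp: carrier)
  show "f z \<in> E" if "z \<in> ball 0 1" for z
    using that by (simp add: c synth_def E)
  show "f z = 0" if "z \<notin> ball 0 1" for z
    using that by (simp add: c synth_def)
next
  fix w :: "complex ^ 'n" and x assume w': "w \<in> ball 0 1" and x: "x \<in> E"
  then have w: "norm w < 1" by simp
  define s where "s b = l2_inner V x (e b)" for b
  \<comment> \<open>The element representing evaluation at w paired with x: the kernel coefficients
    at w, scaled by the coordinates of x.\<close>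
  define d where "d b = (if b < N then (\<lambda>\<alpha>. s b * kvec a (\<beta> b) w \<alpha>) else 0)" for b
  have d: "d \<in> coeff_seqs N"
    by (simp add: coeff_seqs_def d_def l2_scale kvec_l2[OF a w])
  have k: "(\<lambda>z. if z \<in> ball 0 1 then K z w x else 0) = syn d"
    by (auto simp: fun_eq_iff synth_def K[OF _ w x] d_def pser_scale pser_kvec[OF a] s_def mult_ac)
  have "hinner H f (syn d) = l2_inner V (f w) x" if f: "f \<in> hcarrier H" for f
  proof -
    from f obtain c where c: "c \<in> coeff_seqs N" "f = syn c" by (auto simp: carrier)
    have "l2_inner UNIV (c b) (d b) = pser a (\<beta> b) (c b) w * l2_inner V (e b) x" if "b < N" for b
      using that l2_inner_scale_left[of UNIV "s b" "kvec a (\<beta> b) w" "c b"]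
      by (subst l2_inner_cnj)
         (simp add: d_def pser_def s_def l2_inner_cnj[symmetric] mult.commute)
    then show ?thesis
      by (simp add: c inner_syn d coeffs_inner_def synth_inner[OF w])
  qed
  with d show "let k = \<lambda>z. if z \<in> ball 0 1 then K z w x else 0
      in k \<in> hcarrier H \<and> (\<forall>f\<in>hcarrier H. hinner H f k = l2_inner V (f w) x)"
    unfolding Let_def k carrier by blast
qed

lemma model_holomorphic:
  assumes "f \<in> hcarrier H" shows "holomorphic_on_ball (\<lambda>z. l2_inner V (f z) x)"
proof -
  from assms obtain c where c: "c \<in> coeff_seqs N" "f = syn c" by (auto simp: carrier)
  have "holomorphic_on_ball (\<lambda>z. \<Sum>b<N. pser a (\<beta> b) (c b) z * l2_inner V (e b) x)"
    using c by (intro holomorphic_on_ball_sum holomorphic_on_ball_mult holomorphic_on_ball_const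
        holomorphic_on_ball_pser a) (auto simp: coeff_seqs_def)
  then show ?thesis
    by (rule holomorphic_on_ball_cong) (simp add: c synth_inner)
qed

lemma model_mult_coord:
  assumes "f \<in> hcarrier H"
  shows "mult_coord k f \<in> hcarrier H" "hnorm H (mult_coord k f) \<le> hnorm H f"
proof -
  from assms obtain c where c: "c \<in> coeff_seqs N" "f = syn c" by (auto simp: carrier)
  have m: "mult_coord k f = syn (coeffs_shift a N \<beta> k c)" by (simp add: c synth_shift)
  show "mult_coord k f \<in> hcarrier H"
    unfolding m carrier by (intro imageI coeff_seqs_shift a c)
  have "hnorm H (syn (coeffs_shift a N \<beta> k c)) \<le> hnorm H (syn c)"
    unfolding hnorm_syn[OF coeff_seqs_shift[OF a c(1)]] hnorm_syn[OF c(1)]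
    using c by (intro real_sqrt_le_mono sum_mono) (simp add: coeffs_shift_def coeff_seqs_def shift_coeffs_l2[OF a])
  then show "hnorm H (mult_coord k f) \<le> hnorm H f"
    unfolding m c(2)[symmetric] .
qed

text \<open>Both models are parametrised by the same coefficient sequences.\<close>

lemma model_iso:
  assumes "model_frame a N V' S' e'"
  shows "hmodule_iso H (model a N \<beta> e')"
proof -
  interpret F: model_frame a N \<beta> V' S' e' by (rule assms)
  let ?U = "\<lambda>f. F.syn (ana f)"
  have "bij_betw ana (hcarrier H) (coeff_seqs N)"
    unfolding carrier analysis_def by (rule bij_betw_inv_into) (simp add: bij_betw_def synth_inj)
  moreover have "bij_betw F.syn (coeff_seqs N) (hcarrier F.H)"
    by (simp add: bij_betw_def F.synth_inj F.carrier)
  ultimately have "bij_betw ?U (hcarrier H) (hcarrier F.H)"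
    using bij_betw_trans by (fastforce simp: comp_def)
  then show ?thesis
    unfolding hmodule_iso_def
    by (intro exI[of _ ?U])
       (auto simp: carrier synth_add[symmetric] F.synth_add coeff_seqs_add synth_scale[symmetric]
         F.synth_scale coeff_seqs_scale synth_shift[symmetric] F.synth_shift coeff_seqs_shift[OF a]
         inner_syn F.inner_syn)
qed

end

section \<open>The multiplicity as an isomorphism invariant\<close>

lemma l2_inner_delta: "l2_inner UNIV x (\<lambda>\<alpha>. if \<alpha> = \<gamma> then s else 0) = x \<gamma> * cnj s"
  using l2_inner_finite_support[of "{\<gamma>}" UNIV "\<lambda>\<alpha>. if \<alpha> = \<gamma> then s else 0" x] by simp

definition single :: "nat \<Rightarrow> ('n::finite \<Rightarrow> nat) \<Rightarrow> nat \<Rightarrow> ('n \<Rightarrow> nat) \<Rightarrow> complex" where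
  "single b \<gamma> = (\<lambda>b'. if b' = b then (\<lambda>\<alpha>. if \<alpha> = \<gamma> then 1 else 0) else 0)"

lemma single_coeff_seqs: "b < N \<Longrightarrow> single b \<gamma> \<in> coeff_seqs N"
  using l2_finite_support[of "{\<gamma>}" "\<lambda>\<alpha>. if \<alpha> = \<gamma> then 1 else 0" UNIV]
  by (auto simp: coeff_seqs_def single_def)

lemma l2_inner_zero_right [simp]: "l2_inner V x 0 = 0"
  by (simp add: l2_inner_def)

lemma coeffs_inner_cnj: "coeffs_inner N d c = cnj (coeffs_inner N c d)"
  by (simp add: coeffs_inner_def flip: l2_inner_cnj)

lemma coeffs_inner_single: "b < N \<Longrightarrow> coeffs_inner N c (single b \<gamma>) = c b \<gamma>"
  by (simp add: coeffs_inner_def single_def l2_inner_delta if_distrib[of "l2_inner _ _"] cong: if_cong)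

lemma coeffs_inner_shift_single:
  assumes "b < N"
  shows "coeffs_inner N c (coeffs_shift a N \<beta> k (single b \<gamma>)) =
    c b (\<gamma>(k := Suc (\<gamma> k))) * complex_of_real (sqrt (shift_ratio a (\<beta> b) k \<gamma>))"
proof -
  have "shift_coeffs a (\<beta> b) k (\<lambda>\<alpha>. if \<alpha> = \<gamma> then 1 else 0) =
      (\<lambda>\<alpha>. if \<alpha> = \<gamma>(k := Suc (\<gamma> k)) then complex_of_real (sqrt (shift_ratio a (\<beta> b) k \<gamma>)) else 0)"
  proof
    fix \<alpha>
    have "\<alpha> k \<noteq> 0 \<and> \<alpha>(k := \<alpha> k - 1) = \<gamma> \<longleftrightarrow> \<alpha> = \<gamma>(k := Suc (\<gamma> k))"
    proof
      assume "\<alpha> k \<noteq> 0 \<and> \<alpha>(k := \<alpha> k - 1) = \<gamma>"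
      then have "\<alpha> k \<noteq> 0" and g: "\<gamma> = \<alpha>(k := \<alpha> k - 1)" by blast+
      then show "\<alpha> = \<gamma>(k := Suc (\<gamma> k))" unfolding g by simp
    next
      assume eq: "\<alpha> = \<gamma>(k := Suc (\<gamma> k))"
      show "\<alpha> k \<noteq> 0 \<and> \<alpha>(k := \<alpha> k - 1) = \<gamma>" unfolding eq by simp
    qed
    then show "shift_coeffs a (\<beta> b) k (\<lambda>\<alpha>. if \<alpha> = \<gamma> then 1 else 0) \<alpha> =
        (if \<alpha> = \<gamma>(k := Suc (\<gamma> k)) then complex_of_real (sqrt (shift_ratio a (\<beta> b) k \<gamma>)) else 0)"
      by (cases "\<alpha> k = 0"; cases "\<alpha>(k := \<alpha> k - 1) = \<gamma>") (simp_all add: shift_coeffs_def)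
  qed
  moreover have "shift_coeffs a (\<beta> b') k 0 = 0" for b'
    by (simp add: shift_coeffs_def fun_eq_iff)
  ultimately have "l2_inner UNIV (c b') (coeffs_shift a N \<beta> k (single b \<gamma>) b') =
      (if b' = b then c b (\<gamma>(k := Suc (\<gamma> k))) * complex_of_real (sqrt (shift_ratio a (\<beta> b) k \<gamma>)) else 0)"
    if "b' < N" for b'
    using that by (simp add: coeffs_shift_def single_def l2_inner_delta)
  with assms show ?thesis
    by (simp add: coeffs_inner_def)
qed

text \<open>The joint kernel of the adjoints of the coordinate multiplications, expressed through
  module data alone and therefore preserved by isomorphisms.\<close>

definition wandering :: "(complex ^ 'n::finite, 'v) hspace \<Rightarrow> (complex ^ 'n \<Rightarrow> 'v \<Rightarrow> complex) set" where
  "wandering H = {f \<in> hcarrier H. \<forall>k. \<forall>h\<in>hcarrier H. hinner H f (mult_coord k h) = 0}"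

context model_frame
begin

definition const_vec :: "nat \<Rightarrow> complex ^ 'n \<Rightarrow> 'v \<Rightarrow> complex" where
  "const_vec b = syn (single b (\<lambda>_. 0))"

lemma const_vec_wandering: 
  assumes "b < N" shows "const_vec b \<in> wandering H"
proof -
  have "coeffs_inner N (single b (\<lambda>_. 0)) (coeffs_shift a N \<beta> k c) = 0" for k c
    using assms by (subst coeffs_inner_cnj) (simp add: coeffs_inner_single coeffs_shift_def shift_coeffs_def)
  with assms show ?thesis
    by (auto simp: wandering_def const_vec_def carrier single_coeff_seqs synth_shift[symmetric]
        inner_syn coeff_seqs_shift[OF a])
qed

lemma const_vec_inner:
  "b < N \<Longrightarrow> b' < N \<Longrightarrow> hinner H (const_vec b) (const_vec b') = (if b = b' then 1 else 0)"
  by (simp add: const_vec_def inner_syn single_coeff_seqs coeffs_inner_single) (simp add: single_def)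

text \<open>Orthogonality to z_k times every monomial kills all coefficients of nonzero index, since
  the shift weights are positive. What is left is a combination of the orthonormal
  constants.\<close>

lemma wandering_parseval:
  assumes "f \<in> wandering H"
  shows "hinner H f f = complex_of_real (\<Sum>b<N. (cmod (hinner H f (const_vec b)))\<^sup>2)"
proof -
  from assms obtain c where c: "c \<in> coeff_seqs N" "f = syn c"
    by (auto simp: wandering_def carrier)
  have zero: "c b \<alpha> = 0" if b: "b < N" and \<alpha>: "\<alpha> \<noteq> (\<lambda>_. 0)" for b \<alpha>
  proof -
    from \<alpha> obtain k where k: "\<alpha> k \<noteq> 0" by (auto simp: fun_eq_iff)
    define \<gamma> where "\<gamma> = \<alpha>(k := \<alpha> k - 1)"
    have up: "\<gamma>(k := Suc (\<gamma> k)) = \<alpha>" using k by (auto simp: \<gamma>_def)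
    have "hinner H f (mult_coord k (syn (single b \<gamma>))) = 0"
      using assms single_coeff_seqs[OF b] by (auto simp: wandering_def carrier)
    then have "coeffs_inner N c (coeffs_shift a N \<beta> k (single b \<gamma>)) = 0"
      by (simp add: c synth_shift[symmetric] single_coeff_seqs[OF b] inner_syn coeff_seqs_shift[OF a])
    then show ?thesis
      using shift_ratio_pos[OF a, of "\<beta> b" k \<gamma>] unfolding coeffs_inner_shift_single[OF b] up by simp
  qed
  have "(\<Sum>\<^sub>\<infinity>\<alpha>. (cmod (c b \<alpha>))\<^sup>2) = (cmod (c b (\<lambda>_. 0)))\<^sup>2" if "b < N" for b
  proof -
    have "(\<Sum>\<^sub>\<infinity>\<alpha>. (cmod (c b \<alpha>))\<^sup>2) = (\<Sum>\<^sub>\<infinity>\<alpha>\<in>{\<lambda>_. 0}. (cmod (c b \<alpha>))\<^sup>2)"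
      by (rule infsum_cong_neutral) (use zero[OF that] in auto)
    then show ?thesis by simp
  qed
  then show ?thesis
    by (simp add: c inner_syn coeffs_inner_self const_vec_def single_coeff_seqs coeffs_inner_single)
qed

text \<open>Double counting. The squared moduli of the inner products between the two families of
  constants sum to 1 over either family, by Parseval; the double sum is therefore both N and
  N'.\<close>

lemma model_iso_multiplicity:
  assumes "model_frame a N' V' S' e'" and iso: "hmodule_iso H (model a N' \<beta>' e')"
  shows "N = N'"
proof -
  interpret F: model_frame a N' \<beta>' V' S' e' by (rule assms)
  from iso obtain U where bij: "bij_betw U (hcarrier H) (hcarrier F.H)"
    and isom: "\<And>f g. f \<in> hcarrier H \<Longrightarrow> g \<in> hcarrier H \<Longrightarrow> hinner F.H (U f) (U g) = hinner H f g"
    and inter: "\<And>k f. f \<in> hcarrier H \<Longrightarrow> U (mult_coord k f) = mult_coord k (U f)"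
    unfolding hmodule_iso_def by blast
  have carr: "hcarrier F.H = U ` hcarrier H" using bij by (simp add: bij_betw_def)
  have wand: "U f \<in> wandering F.H \<longleftrightarrow> f \<in> wandering H" if f: "f \<in> hcarrier H" for f
    using f model_mult_coord(1)
    by (auto simp: wandering_def carr inter[symmetric] isom)
  have "\<exists>g. g \<in> wandering H \<and> U g = F.const_vec b" if "b < N'" for b
  proof -
    note w = F.const_vec_wandering[OF that]
    then have "F.const_vec b \<in> hcarrier F.H" by (simp add: wandering_def)
    then obtain g where g: "g \<in> hcarrier H" "F.const_vec b = U g" unfolding carr by blast
    with wand[OF g(1)] w show ?thesis by auto
  qed
  then have "\<forall>b. \<exists>g. b < N' \<longrightarrow> g \<in> wandering H \<and> U g = F.const_vec b" by blast
  from choice[OF this] obtain g where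
    g: "\<And>b. b < N' \<Longrightarrow> g b \<in> wandering H" "\<And>b. b < N' \<Longrightarrow> U (g b) = F.const_vec b" by blast
  have inH: "f \<in> hcarrier H" if "f \<in> wandering H" for f using that by (simp add: wandering_def)
  have sym: "cmod (hinner H x y) = cmod (hinner H y x)" if "x \<in> hcarrier H" "y \<in> hcarrier H" for x y
    using that model_hilbert unfolding complex_hilbert_space_def by (metis complex_mod_cnj)
  have "(\<Sum>b<N. (1::real)) = (\<Sum>b<N. \<Sum>b'<N'. (cmod (hinner H (const_vec b) (g b')))\<^sup>2)"
  proof (rule sum.cong[OF refl])
    fix b assume "b \<in> {..<N}"
    then have b: "b < N" by simp
    note w = const_vec_wandering[OF b]
    have "complex_of_real 1 = hinner F.H (U (const_vec b)) (U (const_vec b))"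
      using const_vec_inner[OF b b] by (simp add: isom inH[OF w])
    also have "\<dots> = complex_of_real (\<Sum>b'<N'. (cmod (hinner F.H (U (const_vec b)) (F.const_vec b')))\<^sup>2)"
      by (rule F.wandering_parseval) (simp add: wand inH w)
    also have "(\<Sum>b'<N'. (cmod (hinner F.H (U (const_vec b)) (F.const_vec b')))\<^sup>2) =
        (\<Sum>b'<N'. (cmod (hinner H (const_vec b) (g b')))\<^sup>2)"
      by (rule sum.cong) (simp_all add: g(2)[symmetric] isom inH w g(1))
    finally show "1 = (\<Sum>b'<N'. (cmod (hinner H (const_vec b) (g b')))\<^sup>2)"
      unfolding of_real_eq_iff .
  qed
  also have "\<dots> = (\<Sum>b'<N'. \<Sum>b<N. (cmod (hinner H (g b') (const_vec b)))\<^sup>2)"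
    unfolding sum.swap[of _ "{..<N}"]
    by (intro sum.cong refl) (simp add: sym inH g(1) const_vec_wandering)
  also have "\<dots> = (\<Sum>b'<N'. (1::real))"
  proof (rule sum.cong[OF refl])
    fix b' assume "b' \<in> {..<N'}"
    then have b': "b' < N'" by simp
    have "complex_of_real (\<Sum>b<N. (cmod (hinner H (g b') (const_vec b)))\<^sup>2) = hinner H (g b') (g b')"
      by (rule wandering_parseval[OF g(1)[OF b'], symmetric])
    also have "\<dots> = complex_of_real 1"
      using F.const_vec_inner[OF b' b'] by (simp add: g(2)[OF b', symmetric] isom inH g(1)[OF b'])
    finally show "(\<Sum>b<N. (cmod (hinner H (g b') (const_vec b)))\<^sup>2) = 1"
      unfolding of_real_eq_iff .
  qed
  finally show ?thesis by simp
qed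

end


section \<open>Trees given by a parent function\<close>

definition ptree :: "(nat \<Rightarrow> nat) \<Rightarrow> nat dgraph" where
  "ptree f = \<lparr>verts = UNIV, edges = {(f v, v) | v. v > 0}\<rparr>"

text \<open>A parent smaller than its child makes the graph acyclic and lets induction reach the
  root 0.\<close>

locale parent_function =
  fixes f :: "nat \<Rightarrow> nat"
  assumes less: "v > 0 \<Longrightarrow> f v < v"
    and leafless: "\<exists>v>0. f v = u"
    and finite_children: "finite {v. v > 0 \<and> f v = u}"
begin

lemma verts_ptree [simp]: "verts (ptree f) = UNIV"
  by (simp add: ptree_def)

lemma edges_ptree: "(u, v) \<in> edges (ptree f) \<longleftrightarrow> v > 0 \<and> u = f v"
  by (auto simp: ptree_def)

lemma Chi_ptree: "Chi (ptree f) u = {v. v > 0 \<and> f v = u}"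
  by (auto simp: Chi_def edges_ptree)

lemma par_ptree: "v > 0 \<Longrightarrow> par (ptree f) v = f v"
  by (auto simp: par_def edges_ptree)

lemma sib_ptree: "v > 0 \<Longrightarrow> sib (ptree f) v = {w. w > 0 \<and> f w = f v}"
  by (simp add: sib_def par_ptree Chi_ptree)

lemma root_unique: "(\<forall>p. (p, r) \<notin> edges (ptree f)) \<longleftrightarrow> r = 0"
  by (auto simp: edges_ptree)

lemma tree_root_ptree [simp]: "tree_root (ptree f) = 0"
  by (simp add: tree_root_def root_unique)

lemma locally_finite_ptree: "locally_finite (ptree f)"
  by (simp add: locally_finite_def Chi_ptree finite_children)

lemma rooted_directed_tree_ptree: "rooted_directed_tree (ptree f)"
proof -
  let ?E = "edges (ptree f)"
  have "edges (ptree f) \<subseteq> less_than"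
    using less by (auto simp: edges_ptree)
  then have "acyclic ?E"
    using wf_acyclic[OF wf_less_than] acyclic_subset by blast
  moreover have root: "(0, v) \<in> (?E \<union> ?E\<inverse>)\<^sup>*" for v
  proof (induction v rule: less_induct)
    case (less v)
    show ?case
    proof (cases "v = 0")
      case False
      then have "(f v, v) \<in> ?E \<union> ?E\<inverse>" by (simp add: edges_ptree)
      with less.IH[of "f v"] parent_function.less[OF parent_function_axioms, of v] False
      show ?thesis by (meson neq0_conv rtrancl.rtrancl_into_rtrancl)
    qed simp
  qed
  have "sym ((?E \<union> ?E\<inverse>)\<^sup>*)" by (simp add: sym_rtrancl sym_Un_converse)
  then have "dgraph_connected (ptree f)"
    using root unfolding dgraph_connected_def by (meson rtrancl_trans symD)
  ultimately show ?thesis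
    using leafless by (auto simp: rooted_directed_tree_def root_unique edges_ptree Chi_ptree)
qed

text \<open>\<open>depth\<close> is a definite description and needs this to be evaluated.
  Uniqueness holds because the last edge of a path into u must come from \<open>f u\<close>.\<close>

lemma depth_exists_unique: "\<exists>!n. (0, u) \<in> edges (ptree f) ^^ n"
proof (induction u rule: less_induct)
  case (less u)
  show ?case
  proof (cases "u = 0")
    case True
    have "n = 0" if "(0, 0) \<in> edges (ptree f) ^^ n" for n
      using that by (cases n) (auto simp: edges_ptree)
    then show ?thesis using True by (metis Id_on_iff pair_in_Id_conv relpow.simps(1))
  next
    case False
    then have "f u < u" using parent_function.less[OF parent_function_axioms] by blast
    from less.IH[OF this] obtain m where m: "(0, f u) \<in> edges (ptree f) ^^ m"
      and uni: "\<And>n. (0, f u) \<in> edges (ptree f) ^^ n \<Longrightarrow> n = m" by blast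
    show ?thesis
    proof (rule ex1I[of _ "Suc m"])
      show "(0, u) \<in> edges (ptree f) ^^ Suc m" using m False by (auto simp: edges_ptree)
      show "n = Suc m" if "(0, u) \<in> edges (ptree f) ^^ n" for n
        using that False uni by (cases n) (auto simp: edges_ptree)
    qed
  qed
qed

lemma depth_root [simp]: "depth (ptree f) 0 = 0"
  unfolding depth_def using depth_exists_unique[of 0] by (intro the1_equality) auto

lemma depth_Suc: "v > 0 \<Longrightarrow> depth (ptree f) v = Suc (depth (ptree f) (f v))"
  unfolding depth_def tree_root_ptree
  by (rule the1_equality[OF depth_exists_unique])
     (use theI'[OF depth_exists_unique[of "f v"]] in \<open>auto simp: edges_ptree\<close>)

end

section \<open>Products of parent-function trees\<close>

locale parent_functions =
  fixes g :: "'n::finite \<Rightarrow> nat \<Rightarrow> nat"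
  assumes pf: "parent_function (g j)"
begin

sublocale pf: parent_function "g j" for j by (rule pf)

abbreviation T :: "'n \<Rightarrow> nat dgraph" where "T \<equiv> \<lambda>j. ptree (g j)"

lemma verts_prod [simp]: "verts (dcart_prod T) = UNIV"
  by (simp add: dcart_prod_def Let_def)

lemma Chi_at_eq: "Chi_at T j v = (\<lambda>m. v(j := m)) ` Chi (T j) (v j)"
proof (intro set_eqI iffI)
  fix w assume w: "w \<in> Chi_at T j v"
  then have "w = v(j := w j)" by (auto simp: Chi_at_def fun_eq_iff)
  moreover have "w j \<in> Chi (T j) (v j)" using w by (simp add: Chi_at_def)
  ultimately show "w \<in> (\<lambda>m. v(j := m)) ` Chi (T j) (v j)" by (rule image_eqI)
qed (auto simp: Chi_at_def)

lemma lam_pos: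
  assumes "a > 0" shows "0 < lam a T j w"
proof -
  have "finite (Chi_at T j v)" "Chi_at T j v \<noteq> {}" for v
    using pf.finite_children[where u = "v j" and j = j] pf.leafless[where u = "v j" and j = j] by (auto simp: Chi_at_eq pf.Chi_ptree)
  then have "0 < card (Chi_at T j v)" for v by (simp add: card_gt_0_iff)
  with assms show ?thesis
    unfolding lam_def Let_def by (intro mult_pos_pos divide_pos_pos) (auto intro: add_nonneg_pos)
qed

text \<open>The weight sees w only through its parent in direction j, so it is constant on sibling
  sets.\<close>

lemma lam_cong:
  "w(j := par (T j) (w j)) = w'(j := par (T j) (w' j)) \<Longrightarrow> lam a T j w = lam a T j w'"
  unfolding lam_def by (simp only:)

lemma sib_refl: "v > 0 \<Longrightarrow> v \<in> sib (T j) v"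
  by (simp add: pf.sib_ptree)

lemma sib_eq: "v > 0 \<Longrightarrow> w \<in> sib (T j) v \<Longrightarrow> w > 0 \<and> sib (T j) w = sib (T j) v"
  by (auto simp: pf.sib_ptree)

lemma Phi_eq: "v \<in> Phi T F \<longleftrightarrow> (\<forall>j. j \<in> F \<longleftrightarrow> v j > 0)"
  by (simp add: Phi_def)

lemma sibF_self: "u \<in> Phi T F \<Longrightarrow> u \<in> sibF T F u"
  by (auto simp: sibF_def Phi_eq sib_refl)

lemma sibF_class:
  assumes "u \<in> Phi T F" "w \<in> sibF T F u"
  shows "w \<in> Phi T F" "sibF T F w = sibF T F u"
proof -
  have inF: "w j > 0 \<and> sib (T j) (w j) = sib (T j) (u j)" if "j \<in> F" for j
    using assms that by (intro sib_eq) (auto simp: Phi_eq sibF_def split: if_splits dest!: spec[of _ j])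
  have offF: "w j = u j" if "j \<notin> F" for j
    using assms that by (auto simp: sibF_def dest!: spec[of _ j])
  show "w \<in> Phi T F"
    using assms(1) inF offF unfolding Phi_eq by metis
  show "sibF T F w = sibF T F u"
    using inF offF by (auto simp: sibF_def)
qed

lemma Omega_Phi:
  assumes "u \<in> Omega T F" shows "u \<in> Phi T F"
proof -
  from assms obtain u' where u': "u' \<in> Phi T F" "u = (SOME u. u \<in> sibF T F u')"
    by (auto simp: Omega_def)
  then have "u \<in> sibF T F u'" using someI[of "\<lambda>u. u \<in> sibF T F u'"] sibF_self by metis
  then show ?thesis by (rule sibF_class(1)[OF u'(1)])
qed

text \<open>Classes that meet are equal, so the element selected from the class of u is the only
  selected one in it.\<close>

lemma Omega_class:
  assumes "u \<in> Phi T F" shows "\<exists>!u0. u0 \<in> Omega T F \<and> u0 \<in> sibF T F u"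
proof (rule ex1I[of _ "SOME x. x \<in> sibF T F u"])
  show "(SOME x. x \<in> sibF T F u) \<in> Omega T F \<and> (SOME x. x \<in> sibF T F u) \<in> sibF T F u"
    using assms someI[of "\<lambda>x. x \<in> sibF T F u", OF sibF_self[OF assms]] by (auto simp: Omega_def)
  fix u0 assume u0: "u0 \<in> Omega T F \<and> u0 \<in> sibF T F u"
  then obtain u' where u': "u' \<in> Phi T F" "u0 = (SOME x. x \<in> sibF T F u')"
    by (auto simp: Omega_def)
  then have "u0 \<in> sibF T F u'" using someI[of "\<lambda>x. x \<in> sibF T F u'"] sibF_self by metis
  then have "sibF T F u0 = sibF T F u'" by (rule sibF_class(2)[OF u'(1)])
  moreover have "sibF T F u0 = sibF T F u" using u0 by (intro sibF_class(2)[OF assms]) simp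
  ultimately show "u0 = (SOME x. x \<in> sibF T F u)" using u'(2) by simp
qed

lemma sib_at_eq:
  assumes "u \<in> Phi T F" "w \<in> sibF T F u" "j \<in> F"
  shows "sib_at T j ((root_off T (F - {j}) w)(j := u j)) =
    {x. (\<forall>i. i \<noteq> j \<longrightarrow> x i = w i) \<and> x j \<in> sib (T j) (u j)}"
proof -
  have "root_off T (F - {j}) w i = w i" if "i \<noteq> j" for i
    using assms that by (auto simp: root_off_def Phi_eq sibF_def dest!: spec[of _ i])
  then show ?thesis by (auto simp: sib_at_def)
qed

text \<open>With a single sibling in direction j, the defining condition is a one-term sum with
  positive weight. This disposes of every F that contains a path direction.\<close>

lemma Lspace_zero:
  assumes a: "a > 0" and u: "u \<in> Phi T F" and j: "j \<in> F" and sing: "sib (T j) (u j) = {u j}"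
  shows "Lspace a T F u = {0}"
proof
  show "{0} \<subseteq> Lspace a T F u" by (simp add: Lspace_def)
  show "Lspace a T F u \<subseteq> {0}"
  proof
    fix f assume f: "f \<in> Lspace a T F u"
    have "f w = 0" for w
    proof (cases "w \<in> sibF T F u")
      case False
      with f show ?thesis by (simp add: Lspace_def l2_def)
    next
      case True
      then have "if j \<in> F then w j \<in> sib (T j) (u j) else w j = u j"
        unfolding sibF_def by blast
      then have wj: "w j = u j" using j sing by simp
      have "x = w" if "\<forall>i. i \<noteq> j \<longrightarrow> x i = w i" "x j = u j" for x
      proof
        fix i show "x i = w i" using that wj by (cases "i = j") auto
      qed
      then have "sib_at T j ((root_off T (F - {j}) w)(j := u j)) = {w}"
        unfolding sib_at_eq[OF u True j] sing using wj by blast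
      moreover have "(\<Sum>x\<in>sib_at T j ((root_off T (F - {j}) w)(j := u j)).
          f x * complex_of_real (lam a T j x)) = 0"
        using f j True unfolding Lspace_def by blast
      ultimately show ?thesis using lam_pos[OF a, of j w] by simp
    qed
    then show "f \<in> {0}" by (simp add: fun_eq_iff)
  qed
qed

end


section \<open>Fourier bases of the spaces of functions with vanishing sum\<close>

text \<open>\<open>orth_proj\<close> is a definite description, so existence and uniqueness are both
  shown. Elements of L live on a finite set, which makes all pairings with x finite sums.\<close>

lemma orth_proj_expansion:
  assumes S: "finite S" "S \<subseteq> V" and LS: "\<And>g v. g \<in> L \<Longrightarrow> v \<notin> S \<Longrightarrow> g v = 0"
    and diff: "\<And>g h. g \<in> L \<Longrightarrow> h \<in> L \<Longrightarrow> g - h \<in> L"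
    and e: "\<And>b v. b \<in> B \<Longrightarrow> v \<notin> S \<Longrightarrow> e b v = 0"
    and comb: "\<And>p. (\<lambda>v. \<Sum>b\<in>B. p b * e b v) \<in> L"
    and expand: "\<And>g v. g \<in> L \<Longrightarrow> g v = (\<Sum>b\<in>B. l2_inner V g (e b) * e b v)"
  shows "orth_proj V L x = (\<lambda>v. \<Sum>b\<in>B. l2_inner V x (e b) * e b v)"
proof -
  let ?y = "\<lambda>v. \<Sum>b\<in>B. l2_inner V x (e b) * e b v"
  have ip: "l2_inner V h g = (\<Sum>v\<in>S. h v * cnj (g v))" if "\<And>v. v \<notin> S \<Longrightarrow> g v = 0" for h g
    using l2_inner_finite_support[OF S, of g h] that by blast
  have orth: "l2_inner V (x - ?y) g = 0" if g: "g \<in> L" for g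
  proof -
    have "(\<Sum>v\<in>S. x v * cnj (g v)) = (\<Sum>v\<in>S. x v * cnj (\<Sum>b\<in>B. l2_inner V g (e b) * e b v))"
      using expand[OF g] by simp
    also have "\<dots> = (\<Sum>b\<in>B. cnj (l2_inner V g (e b)) * (\<Sum>v\<in>S. x v * cnj (e b v)))"
      by (simp add: sum_distrib_left sum.swap[of _ S] mult_ac)
    also have "\<dots> = (\<Sum>b\<in>B. l2_inner V x (e b) * (\<Sum>v\<in>S. e b v * cnj (g v)))"
      by (intro sum.cong refl) (simp add: ip e mult.commute)
    also have "\<dots> = (\<Sum>v\<in>S. ?y v * cnj (g v))"
      by (simp add: sum_distrib_left sum_distrib_right sum.swap[of _ S] mult.assoc)
    finally show ?thesis
      by (simp add: ip LS g left_diff_distrib sum_subtractf)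
  qed
  show ?thesis
    unfolding orth_proj_def
  proof (rule the_equality)
    show "?y \<in> L \<and> (\<forall>g\<in>L. l2_inner V (x - ?y) g = 0)"
      by (intro conjI ballI comb orth)
    fix y assume y: "y \<in> L \<and> (\<forall>g\<in>L. l2_inner V (x - y) g = 0)"
    have d: "y - ?y \<in> L" by (rule diff[OF conjunct1[OF y] comb])
    have "l2_inner V h (y - ?y) = (\<Sum>v\<in>S. h v * cnj ((y - ?y) v))" for h
      by (rule ip) (rule LS[OF d])
    then have "l2_inner V (y - ?y) (y - ?y) = l2_inner V (x - ?y) (y - ?y) - l2_inner V (x - y) (y - ?y)"
      by (simp add: left_diff_distrib sum_subtractf)
    then have "l2_inner V (y - ?y) (y - ?y) = 0" using orth[OF d] y d by simp
    moreover have "y - ?y \<in> l2 V"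
      by (rule l2_finite_support[OF S(1) LS[OF d] S(2)])
    ultimately have "y - ?y = 0"
      using l2_inner_self_pos[of "y - ?y" V] by auto
    then show "y = ?y" by simp
  qed
qed

definition axis_pt :: "'n \<Rightarrow> nat \<Rightarrow> 'n \<Rightarrow> nat" where
  "axis_pt j m = (\<lambda>_. 0)(j := m)"

lemma axis_pt_same [simp]: "axis_pt j m j = m"
  by (simp add: axis_pt_def)

lemma axis_pt_other [simp]: "i \<noteq> j \<Longrightarrow> axis_pt j m i = 0"
  by (simp add: axis_pt_def)

lemma inj_axis_pt: "inj_on (axis_pt j) A"
  by (rule inj_onI) (metis axis_pt_same)

lemma axis_pt_eqI: "(\<And>i. i \<noteq> j \<Longrightarrow> v i = 0) \<Longrightarrow> v = axis_pt j (v j)"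
  by (auto simp: axis_pt_def)

text \<open>Children will be numbered consecutively, so the relevant sibling sets are intervals on a
  coordinate axis.\<close>

definition axis_block :: "'n \<Rightarrow> nat \<Rightarrow> nat \<Rightarrow> ('n \<Rightarrow> nat) set" where
  "axis_block j s r = axis_pt j ` {s..<s + r}"

definition fourier :: "'n \<Rightarrow> nat \<Rightarrow> nat \<Rightarrow> nat \<Rightarrow> ('n \<Rightarrow> nat) \<Rightarrow> complex" where
  "fourier j s r k = (\<lambda>v. if v \<in> axis_block j s r
     then unit_root r k ^ (v j - s) / complex_of_real (sqrt (real r)) else 0)"

lemma finite_axis_block: "finite (axis_block j s r)"
  by (simp add: axis_block_def)

lemma axis_pt_in_block: "axis_pt j m \<in> axis_block j s r \<longleftrightarrow> s \<le> m \<and> m < s + r"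
  by (simp add: axis_block_def inj_image_mem_iff[OF inj_axis_pt])

lemma sum_axis_block: "(\<Sum>v\<in>axis_block j s r. f v) = (\<Sum>m<r. f (axis_pt j (s + m)))"
proof -
  have "(\<Sum>v\<in>axis_block j s r. f v) = (\<Sum>m\<in>{s..<s + r}. f (axis_pt j m))"
    by (simp add: axis_block_def sum.reindex[OF inj_axis_pt])
  also have "\<dots> = (\<Sum>m<r. f (axis_pt j (s + m)))"
    by (rule sum.reindex_bij_witness[of _ "\<lambda>m. s + m" "\<lambda>m. m - s"]) auto
  finally show ?thesis .
qed

lemma fourier_axis_pt:
  "m < r \<Longrightarrow> fourier j s r k (axis_pt j (s + m)) = unit_root r k ^ m / complex_of_real (sqrt (real r))"
  by (simp add: fourier_def axis_pt_in_block)

lemma fourier_off_block: "v \<notin> axis_block j s r \<Longrightarrow> fourier j s r k v = 0"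
  by (simp add: fourier_def)

lemma fourier_prod:
  assumes "r > 0"
  shows "x / complex_of_real (sqrt (real r)) * cnj (y / complex_of_real (sqrt (real r))) =
    x * cnj y / of_nat r"
proof -
  have "complex_of_real (sqrt (real r)) * complex_of_real (sqrt (real r)) = of_nat r"
    by (simp flip: of_real_mult)
  then show ?thesis by (simp add: field_simps)
qed

lemma fourier_inner_eq:
  "l2_inner UNIV f (fourier j s r k) = (\<Sum>v\<in>axis_block j s r. f v * cnj (fourier j s r k v))"
  by (rule l2_inner_finite_support) (simp_all add: finite_axis_block fourier_off_block)

lemma fourier_orthonormal:
  assumes "k < r" "k' < r"
  shows "l2_inner UNIV (fourier j s r k) (fourier j s r k') = (if k = k' then 1 else 0)"
proof -
  have r: "r > 0" using assms by simp
  have "l2_inner UNIV (fourier j s r k) (fourier j s r k') =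
      (\<Sum>m<r. unit_root r k ^ m * cnj (unit_root r k' ^ m)) / of_nat r"
    unfolding fourier_inner_eq sum_axis_block sum_divide_distrib
    by (intro sum.cong refl) (simp only: lessThan_iff fourier_axis_pt fourier_prod[OF r])
  also have "\<dots> = (if k = k' then 1 else 0)"
    unfolding unit_root_orthogonal[OF assms] using r by simp
  finally show ?thesis .
qed

lemma fourier_orthogonal_blocks:
  assumes "axis_block j s r \<inter> axis_block j s' r' = {}"
  shows "l2_inner UNIV (fourier j s r k) (fourier j s' r' k') = 0"
  unfolding fourier_inner_eq
proof (intro sum.neutral ballI)
  fix v assume "v \<in> axis_block j s' r'"
  then have "v \<notin> axis_block j s r" using assms by blast
  then show "fourier j s r k v * cnj (fourier j s' r' k' v) = 0" by (simp add: fourier_off_block)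
qed

lemma sum_fourier:
  assumes "0 < k" "k < r"
  shows "(\<Sum>v\<in>axis_block j s r. fourier j s r k v) = 0"
proof -
  have "(\<Sum>v\<in>axis_block j s r. fourier j s r k v) =
      (\<Sum>m<r. unit_root r k ^ m * cnj (unit_root r 0 ^ m)) / complex_of_real (sqrt (real r))"
    unfolding sum_axis_block sum_divide_distrib by (intro sum.cong refl) (simp add: fourier_axis_pt)
  also have "(\<Sum>m<r. unit_root r k ^ m * cnj (unit_root r 0 ^ m)) = 0"
    using unit_root_orthogonal[of k r 0] assms by simp
  finally show ?thesis by simp
qed

text \<open>Orthogonality of the columns of the Fourier matrix, which by symmetry is that of its
  rows.\<close>

lemma fourier_completeness:
  assumes "v \<in> axis_block j s r" "w \<in> axis_block j s r"
  shows "(\<Sum>k<r. fourier j s r k v * cnj (fourier j s r k w)) = (if v = w then 1 else 0)"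
proof -
  have "\<exists>m<r. x = axis_pt j (s + m)" if "x \<in> axis_block j s r" for x
  proof -
    from that obtain i where "s \<le> i" "i < s + r" "x = axis_pt j i" by (auto simp: axis_block_def)
    then show ?thesis by (intro exI[of _ "i - s"]) auto
  qed
  with assms obtain m m' where m: "v = axis_pt j (s + m)" "m < r"
    and m': "w = axis_pt j (s + m')" "m' < r" by blast
  have r: "r > 0" using m by simp
  have "(\<Sum>k<r. fourier j s r k v * cnj (fourier j s r k w)) =
      (\<Sum>k<r. unit_root r m ^ k * cnj (unit_root r m' ^ k)) / of_nat r"
    unfolding sum_divide_distrib m(1) m'(1)
    by (intro sum.cong refl)
       (simp only: fourier_axis_pt[OF m(2)] fourier_axis_pt[OF m'(2)] fourier_prod[OF r]
         unit_root_power_swap[of r _ m] unit_root_power_swap[of r _ m'])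
  also have "\<dots> = (if m = m' then 1 else 0)"
    unfolding unit_root_orthogonal[OF m(2) m'(2)] using r by simp
  also have "(m = m') = (v = w)"
    using inj_axis_pt[of j UNIV] by (auto simp: m m' dest: injD)
  finally show ?thesis .
qed

lemma fourier_expansion:
  assumes supp: "\<And>v. v \<notin> axis_block j s r \<Longrightarrow> g v = 0"
  shows "g v = (\<Sum>k<r. l2_inner UNIV g (fourier j s r k) * fourier j s r k v)"
proof (cases "v \<in> axis_block j s r")
  case False
  with supp show ?thesis by (simp add: fourier_off_block)
next
  case True
  have "(\<Sum>k<r. l2_inner UNIV g (fourier j s r k) * fourier j s r k v) =
      (\<Sum>w\<in>axis_block j s r. g w * (\<Sum>k<r. fourier j s r k v * cnj (fourier j s r k w)))"
    unfolding fourier_inner_eq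
    by (simp add: sum_distrib_left sum_distrib_right sum.swap[of _ "{..<r}"] mult_ac)
  also have "\<dots> = (\<Sum>w\<in>axis_block j s r. if w = v then g v else 0)"
    by (intro sum.cong refl) (auto simp: fourier_completeness[OF True])
  also have "\<dots> = g v" using True by (simp add: finite_axis_block)
  finally show ?thesis by simp
qed

text \<open>The coefficient of mode 0 is the sum of \<open>g\<close> divided by the square root of
  r, hence 0.\<close>

lemma fourier_expansion_sum_zero:
  assumes supp: "\<And>v. v \<notin> axis_block j s r \<Longrightarrow> g v = 0" and zero: "(\<Sum>v\<in>axis_block j s r. g v) = 0"
  shows "g v = (\<Sum>k\<in>{1..<r}. l2_inner UNIV g (fourier j s r k) * fourier j s r k v)"
proof -
  have "l2_inner UNIV g (fourier j s r 0) =
      (\<Sum>v\<in>axis_block j s r. g v) / complex_of_real (sqrt (real r))"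
    unfolding fourier_inner_eq sum_divide_distrib
    by (intro sum.cong refl) (simp add: fourier_def)
  then have "l2_inner UNIV g (fourier j s r 0) = 0" using zero by simp
  then have "(\<Sum>k<r. l2_inner UNIV g (fourier j s r k) * fourier j s r k v) =
      (\<Sum>k\<in>{1..<r}. l2_inner UNIV g (fourier j s r k) * fourier j s r k v)"
    by (intro sum.mono_neutral_right) (auto simp: Suc_le_eq)
  moreover have "g v = (\<Sum>k<r. l2_inner UNIV g (fourier j s r k) * fourier j s r k v)"
    by (rule fourier_expansion) (rule supp)
  ultimately show ?thesis by (rule trans[rotated])
qed

section \<open>Forked trees\<close>

text \<open>
  The root has children \<open>1\<close> and \<open>2\<close>, which have \<open>p\<close> and \<open>q\<close> children respectively; below
  these, every vertex has exactly one child.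
\<close>

definition fork_parent :: "nat \<Rightarrow> nat \<Rightarrow> nat \<Rightarrow> nat" where
  "fork_parent p q v =
     (if v \<le> 2 then 0 else if v \<le> 2 + p then 1 else if v \<le> 2 + p + q then 2 else v - (p + q))"

lemma parent_function_path: "parent_function (\<lambda>v. v - 1)"
proof
  show "\<exists>v>0. v - 1 = u" for u :: nat by (rule exI[of _ "Suc u"]) simp
  show "finite {v. v > 0 \<and> v - 1 = u}" for u :: nat
    by (rule finite_subset[of _ "{Suc u}"]) auto
qed simp

text \<open>Below depth 2 the p + q paths are numbered in rounds, so a vertex exceeds its parent by
  p + q.\<close>

lemma parent_function_fork:
  assumes "p > 0" "q > 0" shows "parent_function (fork_parent p q)"
proof
  show "fork_parent p q v < v" if "v > 0" for v
    using that assms by (auto simp: fork_parent_def)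
  show "\<exists>v>0. fork_parent p q v = u" for u
  proof -
    consider "u = 0" | "u = 1" | "u = 2" | "u > 2" by linarith
    then show ?thesis
    proof cases
      case 1 then show ?thesis by (intro exI[of _ 1]) (simp add: fork_parent_def)
    next
      case 2 then show ?thesis using assms by (intro exI[of _ 3]) (simp add: fork_parent_def)
    next
      case 3 then show ?thesis using assms by (intro exI[of _ "3 + p"]) (simp add: fork_parent_def)
    next
      case 4 then show ?thesis by (intro exI[of _ "u + (p + q)"]) (simp add: fork_parent_def)
    qed
  qed
  show "finite {v. v > 0 \<and> fork_parent p q v = u}" for u
    by (rule finite_subset[of _ "{..u + p + q + 2}"]) (auto simp: fork_parent_def split: if_splits)
qed

text \<open>
  The basis vector of the joint kernel with index \<open>b < p + q\<close> lives on the set of \<open>block_len\<close>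
  siblings that starts at \<open>block_start\<close>, and is the Fourier mode \<open>block_freq\<close> there. Mode \<open>0\<close>
  occurs only at the root (\<open>b = 0\<close>): elsewhere the entries must sum to zero.
\<close>

definition block_start :: "nat \<Rightarrow> nat \<Rightarrow> nat" where
  "block_start p b = (if b = 0 then 0 else if b = 1 then 1 else if b \<le> p then 3 else 3 + p)"

definition block_len :: "nat \<Rightarrow> nat \<Rightarrow> nat \<Rightarrow> nat" where
  "block_len p q b = (if b = 0 then 1 else if b = 1 then 2 else if b \<le> p then p else q)"

text \<open>Modes 1 to p - 1 below vertex 1 take the indices 2 to p, and modes 1 to q - 1 below
  vertex 2 take the indices p + 1 to p + q - 1.\<close>

definition block_freq :: "nat \<Rightarrow> nat \<Rightarrow> nat" where
  "block_freq p b = (if b \<le> 1 then b else if b \<le> p then b - 1 else b - p)"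

text \<open>The index alone decides the depth, independently of how p + q is split. This is why
  products with equal p + q share a model up to the choice of basis.\<close>

definition block_depth :: "'n \<Rightarrow> nat \<Rightarrow> 'n \<Rightarrow> nat" where
  "block_depth j0 b = axis_pt j0 (min b 2)"

section \<open>The product of a forked tree with paths\<close>

locale fork_product =
  fixes j0 :: "'n::finite" and p q :: nat
  assumes p: "p > 0" and q: "q > 0"
begin

definition gs :: "'n \<Rightarrow> nat \<Rightarrow> nat" where
  "gs j = (if j = j0 then fork_parent p q else (\<lambda>v. v - 1))"

sublocale parent_functions gs
  by (rule parent_functions.intro)
     (simp add: gs_def parent_function_path[simplified] parent_function_fork p q)

definition basis :: "nat \<Rightarrow> ('n \<Rightarrow> nat) \<Rightarrow> complex" where
  "basis b = fourier j0 (block_start p b) (block_len p q b) (block_freq p b)"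

abbreviation block :: "nat \<Rightarrow> ('n \<Rightarrow> nat) set" where
  "block b \<equiv> axis_block j0 (block_start p b) (block_len p q b)"

lemma Chi_j0: "Chi (T j0) u = (if u = 0 then {1..2} else if u = 1 then {3..2 + p}
    else if u = 2 then {3 + p..2 + p + q} else {u + p + q})"
  unfolding pf.Chi_ptree by (auto simp: gs_def fork_parent_def split: if_splits)

lemma Chi_other: "j \<noteq> j0 \<Longrightarrow> Chi (T j) u = {Suc u}"
  unfolding pf.Chi_ptree by (auto simp: gs_def)

lemma sib_other: "j \<noteq> j0 \<Longrightarrow> v > 0 \<Longrightarrow> sib (T j) v = {v}"
  unfolding pf.sib_ptree by (auto simp: gs_def)

lemma admissible_fork: "admissible T"
proof -
  have "branching_vertices (T j) \<subseteq> {..2}" for j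
    by (cases "j = j0") (auto simp: branching_vertices_def Chi_j0 Chi_other split: if_splits)
  then have "finite (branching_vertices (T j))" for j
    by (meson finite_atMost finite_subset)
  then show ?thesis
    by (simp add: admissible_def pf.rooted_directed_tree_ptree pf.locally_finite_ptree
        finite_joint_branching_index_def)
qed

definition sib_start :: "nat \<Rightarrow> nat" where
  "sib_start m = (if m \<le> 2 then 1 else if m \<le> 2 + p then 3 else if m \<le> 2 + p + q then 3 + p else m)"

definition sib_len :: "nat \<Rightarrow> nat" where
  "sib_len m = (if m \<le> 2 then 2 else if m \<le> 2 + p then p else if m \<le> 2 + p + q then q else 1)"

lemma sib_j0:
  assumes "m > 0" shows "sib (T j0) m = {sib_start m..<sib_start m + sib_len m}"
proof -
  have "sib (T j0) m = Chi (T j0) (fork_parent p q m)"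
    by (simp add: sib_def pf.par_ptree[OF assms]) (simp add: gs_def)
  also have "\<dots> = {sib_start m..<sib_start m + sib_len m}"
    using assms unfolding Chi_j0
    by (auto simp: fork_parent_def sib_start_def sib_len_def)
  finally show ?thesis .
qed

lemma axis_pt_Phi: "m > 0 \<Longrightarrow> axis_pt j0 m \<in> Phi T {j0}"
  unfolding Phi_eq by (metis axis_pt_other axis_pt_same less_numeral_extra(3) singleton_iff)

lemma Phi_axis:
  assumes "u \<in> Phi T {j0}" obtains m where "m > 0" "u = axis_pt j0 m"
proof (rule that)
  show "u j0 > 0" using assms unfolding Phi_eq by blast
  show "u = axis_pt j0 (u j0)" by (rule axis_pt_eqI) (use assms in \<open>auto simp: Phi_eq\<close>)
qed

lemma Phi_empty: "u \<in> Phi T {} \<longleftrightarrow> u = axis_pt j0 0"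
  by (auto simp: Phi_eq axis_pt_def fun_eq_iff)

lemma in_axis_block: "x \<in> axis_block j0 s r \<longleftrightarrow> (\<forall>i. i \<noteq> j0 \<longrightarrow> x i = 0) \<and> x j0 \<in> {s..<s + r}"
proof
  assume "x \<in> axis_block j0 s r"
  then show "(\<forall>i. i \<noteq> j0 \<longrightarrow> x i = 0) \<and> x j0 \<in> {s..<s + r}" by (auto simp: axis_block_def)
next
  assume x: "(\<forall>i. i \<noteq> j0 \<longrightarrow> x i = 0) \<and> x j0 \<in> {s..<s + r}"
  then have "x = axis_pt j0 (x j0)" by (intro axis_pt_eqI) blast
  with x show "x \<in> axis_block j0 s r" unfolding axis_block_def by blast
qed

lemma sibF_axis:
  assumes "m > 0"
  shows "sibF T {j0} (axis_pt j0 m) = axis_block j0 (sib_start m) (sib_len m)"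
  by (rule set_eqI) (auto simp: sibF_def in_axis_block sib_j0[OF assms] simp del: atLeastLessThan_iff)

lemma sibF_root: "sibF T {} (axis_pt j0 0) = axis_block j0 0 1"
  by (auto simp: sibF_def axis_block_def fun_eq_iff)

text \<open>The weights are positive and constant on the sibling set, so a weighted sum vanishes
  exactly when the plain sum does.\<close>

lemma Lspace_axis:
  assumes a: "a > 0" and m: "m > 0"
  shows "Lspace a T {j0} (axis_pt j0 m) =
    {f. (\<forall>v. v \<notin> axis_block j0 (sib_start m) (sib_len m) \<longrightarrow> f v = 0) \<and>
        (\<Sum>v\<in>axis_block j0 (sib_start m) (sib_len m). f v) = 0}"
proof -
  let ?B = "axis_block j0 (sib_start m) (sib_len m)" and ?u = "axis_pt j0 m"
  have u: "?u \<in> ?B" using sibF_self[OF axis_pt_Phi[OF m]] unfolding sibF_axis[OF m] .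
  have sibat: "sib_at T j0 ((root_off T ({j0} - {j0}) w)(j0 := ?u j0)) = ?B" if "w \<in> ?B" for w
    unfolding sib_at_eq[OF axis_pt_Phi[OF m] that[folded sibF_axis[OF m]] insertI1]
    using that by (auto simp: in_axis_block sib_j0[OF m] simp del: atLeastLessThan_iff)
  have lam: "lam a T j0 w = lam a T j0 ?u" if "w \<in> ?B" for w
  proof (rule lam_cong)
    have w: "w j0 \<in> sib (T j0) m" "\<And>i. i \<noteq> j0 \<Longrightarrow> w i = 0"
      using that by (auto simp: in_axis_block sib_j0[OF m])
    then have "w j0 > 0" "gs j0 (w j0) = gs j0 m" by (auto simp: pf.sib_ptree[OF m])
    then have "par (T j0) (w j0) = par (T j0) (?u j0)"
      by (simp add: pf.par_ptree m)
    then show "w(j0 := par (T j0) (w j0)) = ?u(j0 := par (T j0) (?u j0))"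
      using w(2) by (auto simp: fun_eq_iff)
  qed
  have "(\<Sum>w\<in>?B. f w * complex_of_real (lam a T j0 w)) =
      (\<Sum>w\<in>?B. f w) * complex_of_real (lam a T j0 ?u)" for f
    by (simp add: sum_distrib_right lam)
  then have "(\<Sum>w\<in>?B. f w * complex_of_real (lam a T j0 w)) = 0 \<longleftrightarrow> (\<Sum>w\<in>?B. f w) = 0" for f
    using lam_pos[OF a, of j0 ?u] by simp
  then have cond: "(\<forall>vG \<in> root_off T ({j0} - {j0}) ` ?B.
      (\<Sum>w\<in>sib_at T j0 (vG(j0 := ?u j0)). f w * complex_of_real (lam a T j0 w)) = 0) \<longleftrightarrow>
      (\<Sum>w\<in>?B. f w) = 0" for f
    using u sibat by (simp del: axis_pt_same Diff_cancel) blast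
  have "f \<in> l2 ?B \<longleftrightarrow> (\<forall>v. v \<notin> ?B \<longrightarrow> f v = 0)" for f :: "('n \<Rightarrow> nat) \<Rightarrow> complex"
    by (auto simp: l2_def finite_axis_block)
  with cond show ?thesis
    unfolding Lspace_def sibF_axis[OF m] by (simp del: axis_pt_same Diff_cancel)
qed

lemma Lspace_root: "Lspace a T {} (axis_pt j0 0) = {f. \<forall>v. v \<notin> axis_block j0 0 1 \<longrightarrow> f v = 0}"
  by (auto simp: Lspace_def sibF_root l2_def finite_axis_block)

section \<open>Projections and the operator-valued kernel\<close>

definition basis_of_class :: "nat \<Rightarrow> 'n set \<Rightarrow> ('n \<Rightarrow> nat) \<Rightarrow> bool" where
  "basis_of_class b F u \<longleftrightarrow> F = (if b = 0 then {} else {j0}) \<and> u \<in> block b"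

lemma sum_basis_of_class:
  assumes "m > 0"
  shows "(\<Sum>b | b < p + q \<and> basis_of_class b {j0} (axis_pt j0 m).
      h (block_start p b) (block_len p q b) (block_freq p b)) =
    (\<Sum>k\<in>{1..<sib_len m}. h (sib_start m) (sib_len m) k)"
proof -
  \<comment> \<open>The offset between Fourier mode and basis index: mode k has index k, k + 1 or k
    + p according to the sibling set. Below depth 2 that set is a singleton and no mode
    remains.\<close>
  define c where "c = (if m \<le> 2 then 0 else if m \<le> 2 + p then 1 else p)"
  show ?thesis
    by (rule sum.reindex_bij_witness[of _ "\<lambda>k. k + c" "block_freq p"])
       (use assms p q in \<open>auto simp: basis_of_class_def axis_pt_in_block block_start_def block_len_def
          block_freq_def sib_start_def sib_len_def c_def split: if_splits\<close>)
qed

text \<open>The spaces are a line at the root, the functions of sum zero on a sibling set for F =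
  {j0}, and zero for every other F.\<close>

lemma orth_proj_Lspace:
  assumes a: "a > 0" and u: "u \<in> Phi T F"
  shows "orth_proj UNIV (Lspace a T F u) x v =
    (\<Sum>b | b < p + q \<and> basis_of_class b F u. l2_inner UNIV x (basis b) * basis b v)"
proof -
  consider "F = {}" | "F = {j0}" | j where "j \<in> F" "j \<noteq> j0" by blast
  then show ?thesis
  proof cases
    case 1
    then have u0: "u = axis_pt j0 0" using u Phi_empty by simp
    have L: "Lspace a T F u = {f. \<forall>v. v \<notin> axis_block j0 0 1 \<longrightarrow> f v = 0}"
      unfolding 1 u0 by (rule Lspace_root)
    have "orth_proj UNIV (Lspace a T F u) x =
        (\<lambda>v. \<Sum>k<1. l2_inner UNIV x (fourier j0 0 1 k) * fourier j0 0 1 k v)"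
    proof (rule orth_proj_expansion[of "axis_block j0 0 1"])
      show "g v = (\<Sum>k<1. l2_inner UNIV g (fourier j0 0 1 k) * fourier j0 0 1 k v)"
        if "g \<in> Lspace a T F u" for g v
        by (rule fourier_expansion) (use that in \<open>simp add: L\<close>)
    qed (auto simp: L finite_axis_block fourier_off_block)
    moreover have "{b. b < p + q \<and> basis_of_class b F u} = {0}"
      using p by (auto simp: 1 u0 basis_of_class_def axis_pt_in_block block_start_def block_len_def split: if_splits)
    ultimately show ?thesis
      by (simp add: basis_def block_start_def block_len_def block_freq_def)
  next
    case 2
    from Phi_axis[OF u[unfolded 2]] obtain m where m: "m > 0" "u = axis_pt j0 m" .
    let ?s = "sib_start m" and ?r = "sib_len m"
    have L: "Lspace a T F u = {f. (\<forall>v. v \<notin> axis_block j0 ?s ?r \<longrightarrow> f v = 0) \<and>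
        (\<Sum>v\<in>axis_block j0 ?s ?r. f v) = 0}"
      unfolding 2 m(2) by (rule Lspace_axis[OF a m(1)])
    have "orth_proj UNIV (Lspace a T F u) x =
        (\<lambda>v. \<Sum>k\<in>{1..<?r}. l2_inner UNIV x (fourier j0 ?s ?r k) * fourier j0 ?s ?r k v)"
    proof (rule orth_proj_expansion[of "axis_block j0 ?s ?r"])
      show "(\<lambda>v. \<Sum>k\<in>{1..<?r}. c k * fourier j0 ?s ?r k v) \<in> Lspace a T F u" for c
        unfolding L
        by (simp add: fourier_off_block sum.swap[of _ _ "axis_block j0 ?s ?r"] sum_fourier
            flip: sum_distrib_left)
      show "g v = (\<Sum>k\<in>{1..<?r}. l2_inner UNIV g (fourier j0 ?s ?r k) * fourier j0 ?s ?r k v)"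
        if "g \<in> Lspace a T F u" for g v
        by (rule fourier_expansion_sum_zero) (use that in \<open>auto simp: L\<close>)
    qed (auto simp: L finite_axis_block fourier_off_block sum_subtractf)
    then show ?thesis
      unfolding 2 m(2) basis_def
      by (simp add: sum_basis_of_class[OF m(1), of "\<lambda>s r k. l2_inner UNIV x (fourier j0 s r k) * fourier j0 s r k v"])
  next
    case 3
    then have "u j > 0" using u by (simp add: Phi_eq)
    then have L: "Lspace a T F u = {0}"
      by (intro Lspace_zero[OF a u 3(1)] sib_other 3(2))
    have "orth_proj UNIV (Lspace a T F u) x = (\<lambda>v. \<Sum>b\<in>{}. l2_inner UNIV x (basis b) * basis b v)"
      unfolding L by (rule orth_proj_expansion[of "{}"]) (simp_all add: zero_fun_def)
    moreover have "\<not> basis_of_class b F u" for b using 3 by (auto simp: basis_of_class_def)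
    ultimately show ?thesis by simp
  qed
qed

text \<open>All members of a sibling block have equal depth, so the kernel coefficient does not
  depend on the chosen representative.\<close>

lemma mdepth_basis_of_class:
  assumes "basis_of_class b F u" shows "mdepth T u = block_depth j0 b"
proof -
  from assms obtain m where m: "u = axis_pt j0 m" "block_start p b \<le> m" "m < block_start p b + block_len p q b"
    by (auto simp: basis_of_class_def axis_block_def)
  have fp: "depth (T j0) v = Suc (depth (T j0) (fork_parent p q v))" if "v > 0" for v
    using pf.depth_Suc[OF that, of j0] by (simp add: gs_def)
  have d1: "depth (T j0) v = 1" if "v > 0" "v \<le> 2" for v
    using fp[OF that(1)] that by (simp add: fork_parent_def)
  have d2: "depth (T j0) v = 2" if "v > 2" "v \<le> 2 + p + q" for v
    using fp[of v] that by (simp add: fork_parent_def d1)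
  have "depth (T j0) m = min b 2"
  proof -
    consider "b = 0" | "b = 1" | "b > 1" by linarith
    then show ?thesis
    proof cases
      case 1 then show ?thesis using m by (simp add: block_start_def block_len_def)
    next
      case 2 then show ?thesis using m by (simp add: block_start_def block_len_def d1)
    next
      case 3 then show ?thesis using m by (simp add: block_start_def block_len_def d2 split: if_splits)
    qed
  qed
  then show ?thesis
    by (auto simp: fun_eq_iff mdepth_def block_depth_def m(1) axis_pt_def)
qed

lemma basis_of_class_Omega:
  assumes b: "b < p + q" and F: "F = (if b = 0 then {} else {j0})"
  shows "\<exists>!u. u \<in> Omega T F \<and> basis_of_class b F u"
proof (cases "b = 0")
  case True
  have "axis_pt j0 0 \<in> Phi T {}" by (simp add: Phi_empty)
  from Omega_class[OF this] show ?thesis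
    using True F by (simp add: sibF_root basis_of_class_def block_start_def block_len_def)
next
  case False
  have s: "block_start p b > 0" using False by (simp add: block_start_def)
  have "sib_start (block_start p b) = block_start p b" "sib_len (block_start p b) = block_len p q b"
    using False b p q by (auto simp: sib_start_def sib_len_def block_start_def block_len_def)
  with Omega_class[OF axis_pt_Phi[OF s]] show ?thesis
    using False F by (simp add: sibF_axis[OF s] basis_of_class_def)
qed

text \<open>Every basis index belongs to exactly one F and one representative u; after interchanging
  the sums, one term per index is left.\<close>

lemma kernel_eq:
  assumes "a > 0"
  shows "kernel a T z w x =
    (\<lambda>v. \<Sum>b<p + q. kcoeff a (block_depth j0 b) z w * (l2_inner UNIV x (basis b) * basis b v))"
proof
  fix v
  let ?t = "\<lambda>b. kcoeff a (block_depth j0 b) z w * (l2_inner UNIV x (basis b) * basis b v)"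
  let ?F = "\<lambda>b. if b = 0 then {} else {j0}"
  have inner: "(\<Sum>\<^sub>\<infinity>u\<in>Omega T F. kcoeff a (mdepth T u) z w *
      orth_proj (verts (dcart_prod T)) (Lspace a T F u) x v) =
      (\<Sum>b<p + q. if F = ?F b then ?t b else 0)" for F
  proof -
    have "(\<Sum>\<^sub>\<infinity>u\<in>Omega T F. kcoeff a (mdepth T u) z w *
        orth_proj (verts (dcart_prod T)) (Lspace a T F u) x v) =
        (\<Sum>\<^sub>\<infinity>u\<in>Omega T F. \<Sum>b<p + q. if basis_of_class b F u then ?t b else 0)"
    proof (rule infsum_cong)
      fix u assume "u \<in> Omega T F"
      then have u: "u \<in> Phi T F" by (rule Omega_Phi)
      have "kcoeff a (mdepth T u) z w * orth_proj (verts (dcart_prod T)) (Lspace a T F u) x v =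
          (\<Sum>b | b < p + q \<and> basis_of_class b F u. ?t b)"
        unfolding verts_prod orth_proj_Lspace[OF assms u] sum_distrib_left
        by (intro sum.cong refl) (auto dest: mdepth_basis_of_class)
      also have "\<dots> = (\<Sum>b<p + q. if basis_of_class b F u then ?t b else 0)"
        by (rule sum.mono_neutral_cong_left) auto
      finally show "kcoeff a (mdepth T u) z w * orth_proj (verts (dcart_prod T)) (Lspace a T F u) x v =
          (\<Sum>b<p + q. if basis_of_class b F u then ?t b else 0)" .
    qed
    \<comment> \<open>The set of representatives may be infinite, but each index b contributes at
      most one nonzero term.\<close>
    also have "\<dots> = (\<Sum>b<p + q. if F = ?F b then ?t b else 0)"
    proof (rule infsumI, rule has_sum_sum)
      fix b assume "b \<in> {..<p + q}"
      then have b: "b < p + q" by simp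
      show "((\<lambda>u. if basis_of_class b F u then ?t b else 0) has_sum (if F = ?F b then ?t b else 0)) (Omega T F)"
      proof (cases "F = ?F b")
        case True
        from basis_of_class_Omega[OF b True] obtain u0 where u0: "u0 \<in> Omega T F" "basis_of_class b F u0"
          and uni: "\<And>u. u \<in> Omega T F \<Longrightarrow> basis_of_class b F u \<Longrightarrow> u = u0" by blast
        have "((\<lambda>u. if basis_of_class b F u then ?t b else 0) has_sum ?t b) (Omega T F)"
        proof (rule has_sum_finite_neutralI)
          show "finite {u0}" "{u0} \<subseteq> Omega T F" using u0 by simp_all
          show "(if basis_of_class b F u then ?t b else 0) = 0" if "u \<in> Omega T F - {u0}" for u
          proof -
            have "\<not> basis_of_class b F u" using uni[of u] that by blast
            then show ?thesis by simp
          qed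
          show "?t b = (\<Sum>u\<in>{u0}. if basis_of_class b F u then ?t b else 0)" using u0 by simp
        qed
        then show ?thesis using True by simp
      next
        case False
        then have "\<not> basis_of_class b F u" for u by (simp add: basis_of_class_def)
        with False show ?thesis by simp
      qed
    qed
    finally show ?thesis .
  qed
  have "kernel a T z w x v = (\<Sum>F\<in>UNIV. \<Sum>b<p + q. if F = ?F b then ?t b else 0)"
    unfolding kernel_def inner ..
  also have "\<dots> = (\<Sum>b<p + q. \<Sum>F\<in>UNIV. if F = ?F b then ?t b else 0)"
    by (rule sum.swap)
  also have "\<dots> = (\<Sum>b<p + q. ?t b)"
    by (intro sum.cong refl) (rule sum.delta[THEN trans], simp_all)
  finally show "kernel a T z w x v = (\<Sum>b<p + q. ?t b)" .
qed

lemma basis_off_block: "v \<notin> block b \<Longrightarrow> basis b v = 0"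
  by (simp add: basis_def fourier_off_block)

lemma block_freq_less: "b < p + q \<Longrightarrow> block_freq p b < block_len p q b"
  using p q by (auto simp: block_freq_def block_len_def)

lemma block_cases:
  obtains "b = 0" "block_start p b = 0" "block_len p q b = 1" "block_freq p b = 0"
    | "b = 1" "block_start p b = 1" "block_len p q b = 2" "block_freq p b = 1"
    | "1 < b" "b \<le> p" "block_start p b = 3" "block_len p q b = p" "block_freq p b = b - 1"
    | "1 < b" "p < b" "block_start p b = 3 + p" "block_len p q b = q" "block_freq p b = b - p"
proof -
  consider "b = 0" | "b = 1" | "1 < b" "b \<le> p" | "1 < b" "p < b" by linarith
  then show ?thesis
    using that by cases (auto simp: block_start_def block_len_def block_freq_def)
qed

text \<open>The possible starts 0, 1, 3 and 3 + p are distinct, so the start identifies the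
  block.\<close>

lemma block_start_eq:
  assumes "block_start p b = block_start p b'"
  shows "block_len p q b = block_len p q b'" "block_freq p b = block_freq p b' \<longleftrightarrow> b = b'"
  using assms p by (cases b rule: block_cases; cases b' rule: block_cases; force)+

lemma basis_orthonormal:
  assumes "b < p + q" "b' < p + q"
  shows "l2_inner UNIV (basis b) (basis b') = (if b = b' then 1 else 0)"
proof (cases "block_start p b = block_start p b'")
  case True
  note eq = block_start_eq[OF this]
  show ?thesis
    using block_freq_less[OF assms(1)] block_freq_less[OF assms(2)] eq(2)
    by (simp add: basis_def True eq(1) fourier_orthonormal)
next
  case False
  then have "{block_start p b..<block_start p b + block_len p q b} \<inter>
      {block_start p b'..<block_start p b' + block_len p q b'} = {}"
    by (cases b rule: block_cases; cases b' rule: block_cases) auto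
  then have "block b \<inter> block b' = {}"
    unfolding disjoint_iff in_axis_block by blast
  with False show ?thesis by (auto simp: basis_def fourier_orthogonal_blocks)
qed

lemma model_frame_fork:
  assumes "a > 0" shows "model_frame a (p + q) UNIV (\<Union>b<p + q. block b) basis"
proof
  show "basis b v = 0" if "b < p + q" "v \<notin> (\<Union>b<p + q. block b)" for b v
    using that by (intro basis_off_block) blast
qed (auto simp: assms finite_axis_block basis_orthonormal)

text \<open>A shifted function is constant on a sibling block in direction \<open>j0\<close>, where
  a basis vector of positive index sums to zero. In all other cases the block has the root as its
  j-th coordinate, and there the shift produces 0.\<close>

lemma basis_perp_shift:
  assumes "b < p + q"
  shows "l2_inner UNIV (shift_op a T j h) (basis b) = 0"
proof -
  have ip: "l2_inner UNIV (shift_op a T j h) (basis b) = (\<Sum>v\<in>block b. shift_op a T j h v * cnj (basis b v))"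
    by (rule l2_inner_finite_support) (auto simp: finite_axis_block basis_off_block)
  show ?thesis
  proof (cases "j = j0 \<and> b > 0")
    case False
    have "shift_op a T j h v = 0" if "v \<in> block b" for v
    proof -
      have "v j = 0"
        using that False by (cases "j = j0") (auto simp: in_axis_block block_start_def block_len_def)
      then show ?thesis by (simp add: shift_op_def)
    qed
    then show ?thesis by (simp add: ip)
  next
    case True
    then have b: "b > 0" and j: "j = j0" by auto
    let ?m = "block_start p b"
    have m: "?m > 0" using b by (simp add: block_start_def)
    have gen: "sib_start ?m = block_start p b" "sib_len ?m = block_len p q b"
      using b assms p q by (auto simp: sib_start_def sib_len_def block_start_def block_len_def)
    have const: "shift_op a T j h v = shift_op a T j h (axis_pt j0 ?m)" if "v \<in> block b" for v
    proof -
      have v: "v j0 \<in> sib (T j0) ?m" "\<And>i. i \<noteq> j0 \<Longrightarrow> v i = 0"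
        using that by (auto simp: in_axis_block sib_j0[OF m] gen)
      then have pos: "v j0 > 0" "gs j0 (v j0) = gs j0 ?m" by (auto simp: pf.sib_ptree[OF m])
      then have "par (T j0) (v j0) = par (T j0) (axis_pt j0 ?m j0)"
        by (simp add: pf.par_ptree m)
      then have eq: "v(j0 := par (T j0) (v j0)) = (axis_pt j0 ?m)(j0 := par (T j0) (axis_pt j0 ?m j0))"
        using v(2) by (auto simp: fun_eq_iff)
      show ?thesis
        using pos m by (simp add: shift_op_def j eq lam_cong[OF eq] del: axis_pt_same) simp
    qed
    have "0 < block_freq p b" "block_freq p b < block_len p q b"
      using b assms p q by (auto simp: block_freq_def block_len_def)
    then have "(\<Sum>v\<in>block b. basis b v) = 0"
      unfolding basis_def by (rule sum_fourier)
    then have "(\<Sum>v\<in>block b. cnj (basis b v)) = 0"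
      by (simp flip: cnj_sum)
    then show ?thesis
      unfolding ip by (simp add: const flip: sum_distrib_left)
  qed
qed

lemma comb_joint_kernel:
  assumes "a > 0"
  shows "(\<lambda>v. \<Sum>b<p + q. c b * basis b v) \<in> joint_kernel (real a) T"
proof -
  interpret M: model_frame a "p + q" "block_depth j0" UNIV "\<Union>b<p + q. block b" basis
    by (rule model_frame_fork[OF assms])
  have "(\<lambda>v. \<Sum>b<p + q. c b * basis b v) \<in> l2 UNIV"
    using M.fin by (rule l2_finite_support) (auto simp: basis_off_block)
  moreover have "l2_inner UNIV (shift_op (real a) T j h) (\<lambda>v. \<Sum>b<p + q. c b * basis b v) = 0" for j h
    by (subst l2_inner_cnj)
       (simp add: M.comb_inner l2_inner_cnj[of UNIV "basis _"] basis_perp_shift)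
  ultimately show ?thesis by (simp add: joint_kernel_def Let_def)
qed

lemma is_DA_module_fork:
  assumes "a > 0"
  shows "is_DA_module (real a) T (model a (p + q) (block_depth j0) basis)"
proof -
  interpret M: model_frame a "p + q" "block_depth j0" UNIV "\<Union>b<p + q. block b" basis
    by (rule model_frame_fork[OF assms])
  have "is_rkhs (ball 0 1) (joint_kernel (real a) T) (l2_inner UNIV) (kernel (real a) T) M.H"
    by (rule M.model_rkhs) (use assms in \<open>simp_all add: comb_joint_kernel kernel_eq\<close>)
  moreover have "\<exists>C. \<forall>f\<in>hcarrier M.H. hnorm M.H (mult_coord k f) \<le> C * hnorm M.H f" for k
    by (rule exI[of _ 1]) (simp add: M.model_mult_coord)
  ultimately show ?thesis
    unfolding is_DA_module_def Let_def verts_prod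
    using M.model_holomorphic M.model_mult_coord(1) by blast
qed

section \<open>Out-degrees of the products\<close>

lemma card_Chi_prod: "card (Chi (dcart_prod T) v) = (\<Sum>j\<in>UNIV. card (Chi (T j) (v j)))"
proof -
  \<comment> \<open>This keeps children in different directions apart: v(i := m) = v(j := m') with i
    \<noteq> j would force m = v i.\<close>
  have sub: "m \<noteq> v j" if "m \<in> Chi (T j) (v j)" for m j
    using that pf.less[of m j] by (auto simp: pf.Chi_ptree)
  have "Chi (dcart_prod T) v = (\<Union>j. (\<lambda>m. v(j := m)) ` Chi (T j) (v j))"
  proof (intro set_eqI iffI)
    fix w assume "w \<in> Chi (dcart_prod T) v"
    then obtain k where k: "\<And>j. j \<noteq> k \<Longrightarrow> v j = w j" "(v k, w k) \<in> edges (T k)"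
      by (auto simp: Chi_def dcart_prod_def Let_def)
    then have "w = v(k := w k)" by (auto simp: fun_eq_iff)
    moreover have "w k \<in> Chi (T k) (v k)" using k(2) by (simp add: Chi_def)
    ultimately show "w \<in> (\<Union>j. (\<lambda>m. v(j := m)) ` Chi (T j) (v j))" by blast
  next
    fix w assume "w \<in> (\<Union>j. (\<lambda>m. v(j := m)) ` Chi (T j) (v j))"
    then obtain j m where "m \<in> Chi (T j) (v j)" "w = v(j := m)" by blast
    then show "w \<in> Chi (dcart_prod T) v"
      by (auto simp: Chi_def dcart_prod_def Let_def intro!: exI[of _ j])
  qed
  also have "card \<dots> = (\<Sum>j\<in>UNIV. card ((\<lambda>m. v(j := m)) ` Chi (T j) (v j)))"
  proof (rule card_UN_disjoint)
    show "\<forall>j\<in>UNIV. finite ((\<lambda>m. v(j := m)) ` Chi (T j) (v j))"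
      using pf.finite_children by (simp add: pf.Chi_ptree)
    show "\<forall>i\<in>UNIV. \<forall>j\<in>UNIV. i \<noteq> j \<longrightarrow>
        (\<lambda>m. v(i := m)) ` Chi (T i) (v i) \<inter> (\<lambda>m. v(j := m)) ` Chi (T j) (v j) = {}"
    proof (intro ballI impI equals0I)
      fix i j w assume "i \<noteq> j"
        and "w \<in> (\<lambda>m. v(i := m)) ` Chi (T i) (v i) \<inter> (\<lambda>m. v(j := m)) ` Chi (T j) (v j)"
      then obtain m m' where "m \<in> Chi (T i) (v i)" "w = v(i := m)" "w = v(j := m')" by blast
      then have "m = v i" using \<open>i \<noteq> j\<close> by (metis fun_upd_other fun_upd_same)
      with sub \<open>m \<in> Chi (T i) (v i)\<close> show False by blast
    qed
  qed simp
  also have "\<dots> = (\<Sum>j\<in>UNIV. card (Chi (T j) (v j)))"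
    by (intro sum.cong refl card_image inj_onI) (metis fun_upd_same)
  finally show ?thesis .
qed

lemma card_Chi_fork:
  "card (Chi (dcart_prod T) v) =
    (if v j0 = 0 then 2 else if v j0 = 1 then p else if v j0 = 2 then q else 1) + (CARD('n) - 1)"
proof -
  have "card (Chi (dcart_prod T) v) = card (Chi (T j0) (v j0)) + (\<Sum>j\<in>UNIV - {j0}. card (Chi (T j) (v j)))"
    unfolding card_Chi_prod by (rule sum.remove) simp_all
  also have "(\<Sum>j\<in>UNIV - {j0}. card (Chi (T j) (v j))) = (\<Sum>j\<in>UNIV - {j0}. 1)"
    by (intro sum.cong refl) (simp add: Chi_other)
  finally show ?thesis by (auto simp: Chi_j0)
qed

end

text \<open>An isomorphism maps children onto children. The edges must stay within the vertex sets
  because \<open>dgraph_iso\<close> constrains only pairs of vertices.\<close>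

lemma dgraph_iso_outdegrees:
  assumes iso: "dgraph_iso G H"
    and "edges G \<subseteq> verts G \<times> verts G" "edges H \<subseteq> verts H \<times> verts H"
  shows "(\<lambda>v. card (Chi G v)) ` verts G = (\<lambda>v. card (Chi H v)) ` verts H"
proof -
  from iso obtain \<phi> where bij: "bij_betw \<phi> (verts G) (verts H)"
    and edge: "\<And>u v. u \<in> verts G \<Longrightarrow> v \<in> verts G \<Longrightarrow> (u, v) \<in> edges G \<longleftrightarrow> (\<phi> u, \<phi> v) \<in> edges H"
    unfolding dgraph_iso_def by blast
  have img: "\<phi> ` verts G = verts H" using bij by (simp add: bij_betw_def)
  have "card (Chi H (\<phi> v)) = card (Chi G v)" if v: "v \<in> verts G" for v
  proof -
    have sub: "Chi G v \<subseteq> verts G" using assms(2) by (auto simp: Chi_def)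
    have "Chi H (\<phi> v) = \<phi> ` Chi G v"
    proof
      show "\<phi> ` Chi G v \<subseteq> Chi H (\<phi> v)"
        using sub v edge by (auto simp: Chi_def)
      show "Chi H (\<phi> v) \<subseteq> \<phi> ` Chi G v"
      proof
        fix w assume w: "w \<in> Chi H (\<phi> v)"
        then have "w \<in> verts H" using assms(3) by (auto simp: Chi_def)
        then obtain x where x: "x \<in> verts G" "w = \<phi> x" using img by blast
        with w edge[OF v x(1)] show "w \<in> \<phi> ` Chi G v" by (auto simp: Chi_def)
      qed
    qed
    moreover have "inj_on \<phi> (Chi G v)"
      using bij sub by (meson bij_betw_def inj_on_subset)
    ultimately show ?thesis by (simp add: card_image)
  qed
  then show ?thesis
    unfolding img[symmetric] image_image by (intro image_cong) simp_all
qed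

lemma edges_dcart_prod: "edges (dcart_prod T) \<subseteq> verts (dcart_prod T) \<times> verts (dcart_prod T)"
  by (auto simp: dcart_prod_def Let_def)

text \<open>With d factors, vertex 2 on the branching axis has q + (d - 1) children, while q' + (d -
  1) is the largest out-degree of the other product, its root having 2 + (d - 1). Applied in both
  directions, this recovers q from the out-degrees.\<close>

lemma fork_iso_imp_le:
  fixes j0 :: "'n::finite"
  assumes "fork_product p q" "fork_product p' q'" "p' \<le> q'" "2 \<le> q'"
    and "(\<lambda>v. card (Chi (dcart_prod (\<lambda>j. ptree (fork_product.gs j0 p q j))) v)) ` UNIV =
         (\<lambda>v. card (Chi (dcart_prod (\<lambda>j. ptree (fork_product.gs j0 p' q' j))) v)) ` UNIV"
  shows "q \<le> q'"
proof -
  interpret A: fork_product j0 p q by (rule assms)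
  interpret B: fork_product j0 p' q' by (rule assms)
  have "card (Chi (dcart_prod A.T) (axis_pt j0 2)) \<in> (\<lambda>v. card (Chi (dcart_prod B.T) v)) ` UNIV"
    using assms(5) by blast
  then obtain v where "card (Chi (dcart_prod A.T) (axis_pt j0 2)) = card (Chi (dcart_prod B.T) v)"
    by blast
  then show ?thesis
    unfolding A.card_Chi_fork B.card_Chi_fork using assms(3,4) by (auto split: if_splits)
qed

section \<open>Choice of the two families of products\<close>

theorem corollary1p7:
  fixes a :: nat
  assumes "a > 0"
  shows "(\<exists>(T :: nat \<Rightarrow> 'n::finite \<Rightarrow> nat dgraph) H.
            (\<forall>m. admissible (T m) \<and> is_DA_module (real a) (T m) (H m)) \<and>
            (\<forall>m l. m \<noteq> l \<longrightarrow> \<not> hmodule_iso (H m) (H l))) \<and>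
         (\<forall>k::nat. k > 0 \<longrightarrow>
           (\<exists>(T :: nat \<Rightarrow> 'n \<Rightarrow> nat dgraph) H.
              (\<forall>i<k. admissible (T i) \<and> is_DA_module (real a) (T i) (H i)) \<and>
              (\<forall>i<k. \<forall>j<k. i \<noteq> j \<longrightarrow> \<not> dgraph_iso (dcart_prod (T i)) (dcart_prod (T j))) \<and>
              (\<forall>i<k. \<forall>j<k. hmodule_iso (H i) (H j))))"
proof (intro conjI allI impI)
  \<comment> \<open>An arbitrary coordinate, which carries the forked tree; all others carry
    paths.\<close>
  fix j0 :: 'n
  let ?T = "\<lambda>p q j. ptree (fork_product.gs j0 p q j)"
  let ?e = "\<lambda>p q. fork_product.basis j0 p q"
  let ?H = "\<lambda>p q. model a (p + q) (block_depth j0) (?e p q)"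
  have fork: "fork_product p q" if "p > 0" "q > 0" for p q
    using that by (rule fork_product.intro)
  have adm: "admissible (?T p q)" and DA: "is_DA_module (real a) (?T p q) (?H p q)"
    if "p > 0" "q > 0" for p q
    using fork_product.admissible_fork[OF fork[OF that]]
      fork_product.is_DA_module_fork[OF fork[OF that] assms] by blast+
  note frame = fork_product.model_frame_fork[OF fork assms]
  show "\<exists>(T :: nat \<Rightarrow> 'n \<Rightarrow> nat dgraph) H.
      (\<forall>m. admissible (T m) \<and> is_DA_module (real a) (T m) (H m)) \<and>
      (\<forall>m l. m \<noteq> l \<longrightarrow> \<not> hmodule_iso (H m) (H l))"
  \<comment> \<open>With p = m + 1 and q = 1 the number of basis vectors is m + 2, which separates
    the modules.\<close>
  proof (intro exI[of _ "\<lambda>m. ?T (Suc m) 1"] exI[of _ "\<lambda>m. ?H (Suc m) 1"] conjI allI impI)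
    show "admissible (?T (Suc m) 1)" "is_DA_module (real a) (?T (Suc m) 1) (?H (Suc m) 1)" for m
      by (rule adm DA; simp)+
    show "\<not> hmodule_iso (?H (Suc m) 1) (?H (Suc l) 1)" if "m \<noteq> l" for m l
      using model_frame.model_iso_multiplicity[OF frame frame, of "Suc m" 1 "Suc l" 1] that by auto
  qed
  fix k :: nat assume "k > 0"
  \<comment> \<open>The values p = i + 1 and q = 2k - i have constant sum 2k + 1. Since i < k, they
    satisfy p \<le> k < q, and distinct i give distinct q.\<close>
  let ?T' = "\<lambda>i. ?T (Suc i) (2 * k - i)" and ?H' = "\<lambda>i. ?H (Suc i) (2 * k - i)"
  show "\<exists>(T :: nat \<Rightarrow> 'n \<Rightarrow> nat dgraph) H.
      (\<forall>i<k. admissible (T i) \<and> is_DA_module (real a) (T i) (H i)) \<and>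
      (\<forall>i<k. \<forall>j<k. i \<noteq> j \<longrightarrow> \<not> dgraph_iso (dcart_prod (T i)) (dcart_prod (T j))) \<and>
      (\<forall>i<k. \<forall>j<k. hmodule_iso (H i) (H j))"
  proof (intro exI[of _ ?T'] exI[of _ ?H'] conjI allI impI)
    fix i assume i: "i < k"
    show "admissible (?T' i)" "is_DA_module (real a) (?T' i) (?H' i)"
      by (rule adm DA; use i in simp)+
    fix l assume l: "l < k"
    have "Suc i + (2 * k - i) = Suc l + (2 * k - l)" using i l by simp
    \<comment> \<open>Equal sums mean the same number of components with the same depths; the two
      modules differ only in the orthonormal family into which they synthesise.\<close>
    moreover have "hmodule_iso (?H' i) (model a (Suc i + (2 * k - i)) (block_depth j0) (?e (Suc l) (2 * k - l)))"
    proof (rule model_frame.model_iso)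
      show "model_frame a (Suc i + (2 * k - i)) UNIV (\<Union>b<Suc i + (2 * k - i).
          axis_block j0 (block_start (Suc i) b) (block_len (Suc i) (2 * k - i) b)) (?e (Suc i) (2 * k - i))"
        using i by (intro frame) auto
      show "model_frame a (Suc i + (2 * k - i)) UNIV (\<Union>b<Suc l + (2 * k - l).
          axis_block j0 (block_start (Suc l) b) (block_len (Suc l) (2 * k - l) b)) (?e (Suc l) (2 * k - l))"
        unfolding \<open>Suc i + (2 * k - i) = Suc l + (2 * k - l)\<close> using l by (intro frame) auto
    qed
    ultimately show "hmodule_iso (?H' i) (?H' l)" by simp
    assume "i \<noteq> l"
    show "\<not> dgraph_iso (dcart_prod (?T' i)) (dcart_prod (?T' l))"
    proof
      assume "dgraph_iso (dcart_prod (?T' i)) (dcart_prod (?T' l))"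
      from dgraph_iso_outdegrees[OF this edges_dcart_prod edges_dcart_prod]
      have eq: "(\<lambda>v. card (Chi (dcart_prod (?T' i)) v)) ` UNIV = (\<lambda>v. card (Chi (dcart_prod (?T' l)) v)) ` UNIV"
        by (simp add: dcart_prod_def Let_def ptree_def)
      have "2 * k - i \<le> 2 * k - l"
        by (rule fork_iso_imp_le[OF fork fork _ _ eq]) (use i l in simp_all)
      moreover have "2 * k - l \<le> 2 * k - i"
        by (rule fork_iso_imp_le[OF fork fork _ _ eq[symmetric]]) (use i l in simp_all)
      ultimately show False using i l \<open>i \<noteq> l\<close> by linarith
    qed
  qed
qed

end
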